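(* Let $\alpha\in(0,2)$ and let $\pi^X$ be a probability density on $\mathbb{R}^d$ satisfying the $\alpha$-fractional Poincaré inequality with parameter $C_{\mathrm{FPI}(\alpha)}$. For any step size $\eta>0$ and any initial density $\rho_0^X$, the law $\rho_k^X$ of the $k$-th iterate $x_k$ of the stable proximal sampler with parameter $\alpha$, step size $\eta$ and target $\pi^X$ satisfies $$\chi^2(\rho_k^X|\pi^X)\le\exp\Big(-k\eta\,\big(C_{\mathrm{FPI}(\alpha)}+\eta\big)^{-1}\Big)\,\chi^2(\rho_0^X|\pi^X).$$
   Context: For probability densities, $\chi^2(\rho|\pi)=\int(\rho/\pi-1)^2\pi\,\mathrm{d}x$. Isotropic $\alpha$-stable density: $p_t^{(\alpha)}(y)=(2\pi)^{-d}\int_{\mathbb{R}^d}e^{-t|\xi|^\alpha}e^{-i\langle\xi,y\rangle}\,\mathrm{d}\xi$ and $p^{(\alpha)}(t;x,y)=p_t^{(\alpha)}(y-x)$. Stable proximal sampler with parameter $\alpha$, step $\eta$, target $\pi^X$: started from $x_0\sim\rho_0^X$, at each iteration $k=0,1,\dots$ (i) sample $y_k\mid x_k\sim p^{(\alpha)}(\eta;x_k,\cdot)$; (ii) sample $x_{k+1}\mid y_k$ from the density $\pi^{X|Y}(\cdot|y_k)\propto\pi^X(\cdot)\,p^{(\alpha)}(\eta;\cdot,y_k)$. Fractional Poincaré inequality: for $\vartheta\in(0,2)$, a probability density $\mu$ satisfies the $\vartheta$-fractional Poincaré inequality ($\vartheta$-FPI) with parameter $C_{\mathrm{FPI}(\vartheta)}>0$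 if $\mathrm{Var}_\mu(\phi)\le C_{\mathrm{FPI}(\vartheta)}\mathcal{E}_\mu^{(\vartheta)}(\phi)$ for every $\phi:\mathbb{R}^d\to\mathbb{R}$ in the domain of $\mathcal{E}_\mu^{(\vartheta)}$, where $$\mathcal{E}_\mu^{(\vartheta)}(\phi)=c_{d,\vartheta}\iint_{\{x\ne y\}}\frac{(\phi(x)-\phi(y))^2}{|x-y|^{d+\vartheta}}\,\mathrm{d}x\,\mu(y)\,\mathrm{d}y,\qquad c_{d,\vartheta}=\frac{2^\vartheta\Gamma((d+\vartheta)/2)}{\pi^{d/2}|\Gamma(-\vartheta/2)|}.$$ *)

theory Defs
  imports "HOL-Probability.Probability"
begin

definition prob_density :: "('a::euclidean_space \<Rightarrow> real) \<Rightarrow> bool" where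
  "prob_density f \<longleftrightarrow> f \<in> borel_measurable borel \<and> (\<forall>x. 0 \<le> f x) \<and> (\<integral>\<^sup>+x. ennreal (f x) \<partial>lborel) = 1"

text \<open>
  The usual convention is made explicit: the divergence is infinite if \<open>\<rho>\<close> puts mass where \<open>\<pi>\<close>
  vanishes, whereas points where both densities vanish contribute nothing.
\<close>

definition chi2 :: "('a::euclidean_space \<Rightarrow> real) \<Rightarrow> ('a \<Rightarrow> real) \<Rightarrow> ennreal" where
  "chi2 \<rho> \<pi> = (\<integral>\<^sup>+x. (if \<pi> x = 0 then (if \<rho> x = 0 then 0 else \<infinity>)
                     else ennreal ((\<rho> x / \<pi> x - 1)\<^sup>2 * \<pi> x)) \<partial>lborel)"

text \<open>The Fourier integral is real by the symmetry of the integrand, so taking \<open>Re\<close> loses nothing.\<close>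

definition stable_density :: "real \<Rightarrow> real \<Rightarrow> 'a::euclidean_space \<Rightarrow> real" where
  "stable_density \<alpha> t y = Re (complex_of_real (1 / (2 * pi) ^ DIM('a)) *
     (\<integral>\<xi>. complex_of_real (exp (- t * norm \<xi> powr \<alpha>)) * exp (- \<i> * complex_of_real (\<xi> \<bullet> y)) \<partial>lborel))"

definition stable_transition :: "real \<Rightarrow> real \<Rightarrow> 'a::euclidean_space \<Rightarrow> 'a \<Rightarrow> real" where
  "stable_transition \<alpha> t x y = stable_density \<alpha> t (y - x)"

text \<open>\<open>target_given \<alpha> \<eta> \<pi> y\<close> is the density \<open>\<pi>\<^sup>X\<^sup>|\<^sup>Y(\<cdot> | y)\<close>.\<close>

definition target_given :: "real \<Rightarrow> real \<Rightarrow> ('a::euclidean_space \<Rightarrow> real) \<Rightarrow> 'a \<Rightarrow> 'a \<Rightarrow> real" where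
  "target_given \<alpha> \<eta> \<pi> y x =
     \<pi> x * stable_transition \<alpha> \<eta> x y / (\<integral>z. \<pi> z * stable_transition \<alpha> \<eta> z y \<partial>lborel)"

definition forward_kernel :: "real \<Rightarrow> real \<Rightarrow> 'a::euclidean_space \<Rightarrow> 'a measure" where
  "forward_kernel \<alpha> \<eta> x = density lborel (\<lambda>y. ennreal (stable_transition \<alpha> \<eta> x y))"

definition backward_kernel :: "real \<Rightarrow> real \<Rightarrow> ('a::euclidean_space \<Rightarrow> real) \<Rightarrow> 'a \<Rightarrow> 'a measure" where
  "backward_kernel \<alpha> \<eta> \<pi> y = density lborel (\<lambda>x. ennreal (target_given \<alpha> \<eta> \<pi> y x))"

text \<open>The law of the \<open>k\<close>-th iterate \<open>x\<^sub>k\<close>; \<open>bind\<close> is that of the Giry monad.\<close>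

primrec sampler_law ::
  "real \<Rightarrow> real \<Rightarrow> ('a::euclidean_space \<Rightarrow> real) \<Rightarrow> ('a \<Rightarrow> real) \<Rightarrow> nat \<Rightarrow> 'a measure" where
  "sampler_law \<alpha> \<eta> \<pi> \<rho>0 0 = density lborel (\<lambda>x. ennreal (\<rho>0 x))"
| "sampler_law \<alpha> \<eta> \<pi> \<rho>0 (Suc k) =
     Giry_Monad.bind (Giry_Monad.bind (sampler_law \<alpha> \<eta> \<pi> \<rho>0 k) (forward_kernel \<alpha> \<eta>))
       (backward_kernel \<alpha> \<eta> \<pi>)"

definition frac_const :: "nat \<Rightarrow> real \<Rightarrow> real" where
  "frac_const d \<theta> = 2 powr \<theta> * Gamma ((real d + \<theta>) / 2) / (pi powr (real d / 2) * \<bar>Gamma (- \<theta> / 2)\<bar>)"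

definition frac_energy :: "real \<Rightarrow> ('a::euclidean_space \<Rightarrow> real) \<Rightarrow> ('a \<Rightarrow> real) \<Rightarrow> ennreal" where
  "frac_energy \<theta> \<mu> \<phi> = ennreal (frac_const DIM('a) \<theta>) *
     (\<integral>\<^sup>+y. (\<integral>\<^sup>+x. (if x = y then 0
                 else ennreal ((\<phi> x - \<phi> y)\<^sup>2 / norm (x - y) powr (real DIM('a) + \<theta>))) \<partial>lborel)
            * ennreal (\<mu> y) \<partial>lborel)"

text \<open>
  The form domain inside \<open>L\<^sup>2(\<mu>)\<close>. Requiring square integrability does not change the inequality
  below: truncation and Fatou's lemma extend it to every measurable function of finite energy.
\<close>

definition frac_domain :: "real \<Rightarrow> ('a::euclidean_space \<Rightarrow> real) \<Rightarrow> ('a \<Rightarrow> real) set" where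
  "frac_domain \<theta> \<mu> = {\<phi>. \<phi> \<in> borel_measurable borel \<and>
     integrable (density lborel (\<lambda>x. ennreal (\<mu> x))) (\<lambda>x. (\<phi> x)\<^sup>2) \<and> frac_energy \<theta> \<mu> \<phi> < \<infinity>}"

definition frac_poincare :: "real \<Rightarrow> ('a::euclidean_space \<Rightarrow> real) \<Rightarrow> real \<Rightarrow> bool" where
  "frac_poincare \<theta> \<mu> C \<longleftrightarrow> 0 < C \<and>
     (\<forall>\<phi>\<in>frac_domain \<theta> \<mu>.
        ennreal (prob_space.variance (density lborel (\<lambda>x. ennreal (\<mu> x))) \<phi>)
          \<le> ennreal C * frac_energy \<theta> \<mu> \<phi>)"

end

(* Write P for convolution with the stable density at time eta. The heart is the pointwise reverse
   local Poincare inequality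
     P(g^2) - (P g)^2 >= eta * (fractional carre du champ of P g)        for bounded g.
   Integrated against the target it shows that P g has finite energy, and the fractional
   Poincare inequality together with the law of total variance gives
     Var_pi(P g) <= C / (C + eta) * Var_piY(g),    piY = pi * p_eta.
   For g the ratio of the two laws of y_k, P g is the ratio of x_{k+1} to the target, so one iteration
   contracts by C / (C + eta) <= exp (- eta / (C + eta)); the forward step does not increase the
   divergence, by Jensen.

   To prove the reverse inequality, superadditivity of the variance reduces it to small times h.
   There the stable density is bounded below by its jump-free and one-jump parts relative to a
   finite part L of the Levy measure. That bound is a statement of positive definiteness: the
   symbol of the difference is exp (- h (|xi|^alpha - psi_L)) times a power series in the Fourier transform of L
   with nonnegative coefficients. Writing the Levy measure as a mixture of heat kernels
   (subordination) produces both the exponent |xi|^alpha and the constant c_{d,alpha}. *)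

theory Submission
  imports Defs
begin

section \<open>Gaussian Fourier transforms\<close>

text \<open>The stable density is available only as a Fourier integral, so the usual proof,
  differentiating \<open>P_s ((P_(t-s) g)^2)\<close> in s by means of a generator, is out of reach.
  Cutting t dyadically into pieces of length h replaces that differentiation: convolutions commute
  with translations, so halving a time step loses nothing, and the variance over time t is at least
  t / h times the variance of P_(t-h) g over time h. What remains is to see that the latter is at
  least h times the jump form up to a factor tending to 1. The terms with no jump and with one jump
  are just enough: with m the mass of L, the factor is exp (- h m) / (1 + h m), so no constant is
  lost and the rate is exactly C / (C + eta). The order of the limits matters. Since m grows without
  bound as L approaches the full Levy measure, h tends to 0 with L fixed, and only then L increases.
  L is cut off in subordination time and not in jump size; it stays a mixture of Gaussians, with an
  explicit nonnegative transform.\<close>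

lemma lborel_distr_minus: "distr lborel borel (\<lambda>x. c - x) = (lborel :: 'a::euclidean_space measure)"
proof -
  have "lborel = density (distr lborel borel (\<lambda>x. c + (-1::real) *\<^sub>R x)) (\<lambda>_. \<bar>-1::real\<bar>^DIM('a))"
    by (rule lborel_affine) simp
  then show ?thesis by (simp add: density_1)
qed

lemma nn_integral_lborel_plus:
  fixes f :: "'a::euclidean_space \<Rightarrow> ennreal"
  assumes [measurable]: "f \<in> borel_measurable borel"
  shows "(\<integral>\<^sup>+x. f (c + x) \<partial>lborel) = (\<integral>\<^sup>+x. f x \<partial>lborel)"
  by (subst (2) lborel_distr_plus[symmetric, of c], subst nn_integral_distr) simp_all

lemma lborel_integral_plus:
  fixes f :: "'a::euclidean_space \<Rightarrow> 'b::{banach,second_countable_topology}"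
  assumes [measurable]: "f \<in> borel_measurable borel"
  shows "(\<integral>x. f (c + x) \<partial>lborel) = (\<integral>x. f x \<partial>lborel)"
    and "integrable lborel (\<lambda>x. f (c + x)) \<longleftrightarrow> integrable lborel f"
  by (subst (2) lborel_distr_plus[symmetric, of c], subst integral_distr, simp_all)
     (subst (2) lborel_distr_plus[symmetric, of c], subst integrable_distr_eq, simp_all)

lemma lborel_integral_minus:
  fixes f :: "'a::euclidean_space \<Rightarrow> 'b::{banach,second_countable_topology}"
  assumes [measurable]: "f \<in> borel_measurable borel"
  shows "(\<integral>x. f (c - x) \<partial>lborel) = (\<integral>x. f x \<partial>lborel)"
    and "integrable lborel (\<lambda>x. f (c - x)) \<longleftrightarrow> integrable lborel f"
  by (subst (2) lborel_distr_minus[symmetric, of c], subst integral_distr, simp_all)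
     (subst (2) lborel_distr_minus[symmetric, of c], subst integrable_distr_eq, simp_all)

text \<open>Tensorization: it reduces to one dimension both the Gaussian integrals and the
  integrability of \<open>exp (- t * norm \<xi> powr \<alpha>)\<close>.\<close>

lemma lborel_integral_prod_Basis:
  fixes f :: "'a::euclidean_space \<Rightarrow> real \<Rightarrow> 'c::{real_normed_field,banach,second_countable_topology}"
  assumes f: "\<And>b. b \<in> Basis \<Longrightarrow> integrable lborel (f b)"
  shows "integrable lborel (\<lambda>x::'a. \<Prod>b\<in>Basis. f b (x \<bullet> b))"
    and "(\<integral>x. (\<Prod>b\<in>Basis. f b (x \<bullet> b)) \<partial>(lborel :: 'a measure)) = (\<Prod>b\<in>Basis. (\<integral>x. f b x \<partial>lborel))"
proof -
  interpret product_sigma_finite "\<lambda>_::'a. lborel :: real measure" ..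
  let ?M = "\<Pi>\<^sub>M b\<in>Basis. lborel :: ('a \<Rightarrow> real) measure"
  let ?T = "\<lambda>f::'a \<Rightarrow> real. \<Sum>b\<in>Basis. f b *\<^sub>R b"
  have T[measurable]: "?T \<in> ?M \<rightarrow>\<^sub>M borel" by measurable
  have [measurable]: "(\<lambda>x::'a. \<Prod>b\<in>Basis. f b (x \<bullet> b)) \<in> borel_measurable borel"
  proof (rule borel_measurable_prod)
    fix b :: 'a assume "b \<in> Basis"
    from f[OF this] have [measurable]: "f b \<in> borel_measurable borel" by auto
    show "(\<lambda>x. f b (x \<bullet> b)) \<in> borel_measurable borel" by measurable
  qed
  have eq: "(\<Prod>b\<in>Basis. f b (?T x \<bullet> b)) = (\<Prod>b\<in>Basis. f b (x b))" for x
    by (rule prod.cong) (auto simp: inner_sum_left inner_Basis if_distrib cong: if_cong)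
  show "integrable lborel (\<lambda>x::'a. \<Prod>b\<in>Basis. f b (x \<bullet> b))"
    by (subst lborel_eq, subst integrable_distr_eq) (use f in \<open>auto simp: eq intro!: product_integrable_prod\<close>)
  show "(\<integral>x. (\<Prod>b\<in>Basis. f b (x \<bullet> b)) \<partial>(lborel :: 'a measure)) = (\<Prod>b\<in>Basis. (\<integral>x. f b x \<partial>lborel))"
    by (subst lborel_eq, subst integral_distr) (use f in \<open>auto simp: eq intro!: product_integral_prod\<close>)
qed

text \<open>A rescaling by \<open>sqrt (2 * s)\<close> of the characteristic function of the
  standard normal law.\<close>

lemma gaussian_fourier_real:
  fixes s t :: real
  assumes s: "s > 0"
  shows "integrable lborel (\<lambda>x. complex_of_real (exp (- s * x\<^sup>2)) * iexp (t * x))"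
    and "(\<integral>x. complex_of_real (exp (- s * x\<^sup>2)) * iexp (t * x) \<partial>lborel)
       = complex_of_real (sqrt (pi / s) * exp (- t\<^sup>2 / (4 * s)))"
proof -
  define c where "c = sqrt (2 * s)"
  have c: "c > 0" "c\<^sup>2 = 2 * s" using s by (auto simp: c_def)
  have "integrable lborel (\<lambda>x. std_normal_density x)" by (rule integrable_normal_density) simp
  then have i1: "integrable lborel (\<lambda>x. std_normal_density (0 + c * x))"
    using c by (intro lborel_integrable_real_affine) auto
  have dens: "std_normal_density (c * x) = exp (- s * x\<^sup>2) / sqrt (2 * pi)" for x
    using c by (simp add: std_normal_density_def power_mult_distrib)
  have i2: "integrable lborel (\<lambda>x. exp (- s * x\<^sup>2))"
    using integrable_mult_left[OF i1, of "sqrt (2 * pi)"] by (simp add: dens)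
  show "integrable lborel (\<lambda>x. complex_of_real (exp (- s * x\<^sup>2)) * iexp (t * x))"
    by (rule Bochner_Integration.integrable_bound[OF i2]) (auto simp: norm_mult)
  have "complex_of_real (exp (- (t / c)\<^sup>2 / 2)) = char std_normal_distribution (t / c)"
    by (simp add: char_std_normal_distribution)
  also have "\<dots> = (\<integral>x. complex_of_real (std_normal_density x) * iexp (t / c * x) \<partial>lborel)"
    unfolding char_def by (subst integral_density) (auto simp: scaleR_conv_of_real)
  also have "\<dots> = c * (\<integral>x. complex_of_real (std_normal_density (c * x)) * iexp (t * x) \<partial>lborel)"
    using c by (subst lborel_integral_real_affine[where c = c and t = 0]) (auto simp: scaleR_conv_of_real)
  also have "\<dots> = c * (\<integral>x. complex_of_real (1 / sqrt (2*pi)) * (complex_of_real (exp (- s * x\<^sup>2)) * iexp (t * x)) \<partial>lborel)"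
    unfolding dens by (auto intro!: arg_cong2[where f = "(*)"] Bochner_Integration.integral_cong simp: field_simps)
  also have "\<dots> = complex_of_real (c / sqrt (2*pi)) * (\<integral>x. complex_of_real (exp (- s * x\<^sup>2)) * iexp (t * x) \<partial>lborel)"
    by simp
  finally have *: "complex_of_real (exp (- (t / c)\<^sup>2 / 2)) = \<dots>" .
  have c2: "c / sqrt (2 * pi) * sqrt (pi / s) = 1"
    using s by (simp add: c_def real_sqrt_mult[symmetric] real_sqrt_divide[symmetric])
  have "complex_of_real (sqrt (pi / s) * exp (- (t / c)\<^sup>2 / 2))
      = complex_of_real (c / sqrt (2 * pi) * sqrt (pi / s)) * (\<integral>x. complex_of_real (exp (- s * x\<^sup>2)) * iexp (t * x) \<partial>lborel)"
    using * by (simp add: mult_ac)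
  then show "(\<integral>x. complex_of_real (exp (- s * x\<^sup>2)) * iexp (t * x) \<partial>lborel)
       = complex_of_real (sqrt (pi / s) * exp (- t\<^sup>2 / (4 * s)))"
    unfolding c2 using c by (simp add: power_divide mult.commute)
qed

lemma gaussian_fourier_complex:
  fixes y :: "'a::euclidean_space"
  assumes s: "s > 0"
  shows "integrable lborel (\<lambda>x. complex_of_real (exp (- s * (norm x)\<^sup>2)) * iexp (x \<bullet> y))"
    and "(\<integral>x. complex_of_real (exp (- s * (norm x)\<^sup>2)) * iexp (x \<bullet> y) \<partial>lborel)
       = complex_of_real (sqrt (pi / s) ^ DIM('a) * exp (- (norm y)\<^sup>2 / (4 * s)))"
proof -
  have norm2: "(norm x)\<^sup>2 = (\<Sum>b\<in>Basis. (x \<bullet> b)\<^sup>2)" for x :: 'a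
    by (subst power2_norm_eq_inner, subst euclidean_inner) (simp add: power2_eq_square)
  have eq: "complex_of_real (exp (- s * (norm x)\<^sup>2)) * iexp (x \<bullet> y)
      = (\<Prod>b\<in>Basis. complex_of_real (exp (- s * (x \<bullet> b)\<^sup>2)) * iexp ((y \<bullet> b) * (x \<bullet> b)))" for x
    by (simp add: prod.distrib norm2 euclidean_inner[of x y] sum_distrib_left exp_sum sum_negf[symmetric]
        mult.commute[of "y \<bullet> _"] flip: of_real_prod)
  show "integrable lborel (\<lambda>x. complex_of_real (exp (- s * (norm x)\<^sup>2)) * iexp (x \<bullet> y))"
    unfolding eq by (rule lborel_integral_prod_Basis(1)) (rule gaussian_fourier_real[OF s])
  show "(\<integral>x. complex_of_real (exp (- s * (norm x)\<^sup>2)) * iexp (x \<bullet> y) \<partial>lborel)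
       = complex_of_real (sqrt (pi / s) ^ DIM('a) * exp (- (norm y)\<^sup>2 / (4 * s)))"
    unfolding eq
    by (subst lborel_integral_prod_Basis(2), rule gaussian_fourier_real[OF s])
       (simp only: gaussian_fourier_real(2)[OF s],
        simp add: prod.distrib norm2 exp_sum sum_divide_distrib sum_negf[symmetric] flip: of_real_prod)
qed

lemma gaussian_fourier:
  fixes y :: "'a::euclidean_space"
  assumes s: "s > 0"
  shows "integrable lborel (\<lambda>x::'a. exp (- s * (norm x)\<^sup>2))"
    and "(\<integral>x. exp (- s * (norm x)\<^sup>2) * cos (x \<bullet> y) \<partial>lborel)
       = sqrt (pi / s) ^ DIM('a) * exp (- (norm y)\<^sup>2 / (4 * s))"
proof -
  have *: "integrable lborel (\<lambda>x::'a. complex_of_real (exp (- s * (norm x)\<^sup>2)))"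
    using gaussian_fourier_complex(1)[OF s, of "0::'a"] by simp
  show "integrable lborel (\<lambda>x::'a. exp (- s * (norm x)\<^sup>2))"
    using integrable_Re[OF *] by simp
  have "(\<integral>x. exp (- s * (norm x)\<^sup>2) * cos (x \<bullet> y) \<partial>lborel)
     = (\<integral>x. Re (complex_of_real (exp (- s * (norm x)\<^sup>2)) * iexp (x \<bullet> y)) \<partial>lborel)"
    by (simp add: Re_exp)
  also have "\<dots> = Re (\<integral>x. complex_of_real (exp (- s * (norm x)\<^sup>2)) * iexp (x \<bullet> y) \<partial>lborel)"
    by (rule integral_Re[OF gaussian_fourier_complex(1)[OF s]])
  finally show "(\<integral>x. exp (- s * (norm x)\<^sup>2) * cos (x \<bullet> y) \<partial>lborel)
       = sqrt (pi / s) ^ DIM('a) * exp (- (norm y)\<^sup>2 / (4 * s))"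
    by (simp only: gaussian_fourier_complex(2)[OF s] Re_complex_of_real)
qed

section \<open>Fourier inversion and positive definiteness\<close>

lemma lborel_integral_affine:
  fixes f :: "'a::euclidean_space \<Rightarrow> real"
  assumes [measurable]: "f \<in> borel_measurable borel" and c: "c \<noteq> 0"
  shows "(\<integral>x. f x \<partial>lborel) = \<bar>c\<bar> ^ DIM('a) * (\<integral>x. f (t + c *\<^sub>R x) \<partial>lborel)"
  by (subst lborel_affine[OF c, of t], subst integral_density)
     (auto simp: integral_distr)

text \<open>The product \<open>f x * g y\<close> is integrable and a bounded factor keeps it so.
  With cosine kernels this moves a transform from one function to the other; with bounded test
  functions it interchanges two averages.\<close>

lemma (in pair_sigma_finite) integrable_mult_bounded_kernel:
  fixes f :: "'a \<Rightarrow> real" and g :: "'b \<Rightarrow> real" and h :: "'a \<Rightarrow> 'b \<Rightarrow> real"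
  assumes f: "integrable M1 f" and g: "integrable M2 g"
    and h[measurable]: "(\<lambda>(x, y). h x y) \<in> borel_measurable (M1 \<Otimes>\<^sub>M M2)"
    and bound: "\<And>x y. \<bar>h x y\<bar> \<le> B"
  shows "integrable (M1 \<Otimes>\<^sub>M M2) (\<lambda>(x, y). f x * g y * h x y)"
    and "(\<integral>x. f x * (\<integral>y. g y * h x y \<partial>M2) \<partial>M1) = (\<integral>y. g y * (\<integral>x. f x * h x y \<partial>M1) \<partial>M2)"
proof -
  have [measurable]: "f \<in> borel_measurable M1" "g \<in> borel_measurable M2" using f g by auto
  have "integrable (M1 \<Otimes>\<^sub>M M2) (\<lambda>(x, y). f x * g y)"
    by (rule Fubini_integrable) (use f g in \<open>simp_all add: abs_mult\<close>)
  then have "integrable (M1 \<Otimes>\<^sub>M M2) (\<lambda>p. (case p of (x, y) \<Rightarrow> f x * g y) * B)" by simp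
  then show *: "integrable (M1 \<Otimes>\<^sub>M M2) (\<lambda>(x, y). f x * g y * h x y)"
  proof (rule Bochner_Integration.integrable_bound)
    have "\<bar>f x * g y * h x y\<bar> \<le> \<bar>f x * g y * B\<bar>" for x y
      using bound[of x y] by (simp add: abs_mult mult_left_mono)
    then show "AE x in M1 \<Otimes>\<^sub>M M2. norm (case x of (x, y) \<Rightarrow> f x * g y * h x y)
        \<le> norm ((case x of (x, y) \<Rightarrow> f x * g y) * B)"
      by auto
  qed measurable
  show "(\<integral>x. f x * (\<integral>y. g y * h x y \<partial>M2) \<partial>M1) = (\<integral>y. g y * (\<integral>x. f x * h x y \<partial>M1) \<partial>M2)"
  proof -
    have "(\<integral>x. f x * g y * h x y \<partial>M1) = g y * (\<integral>x. f x * h x y \<partial>M1)" for y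
      by (subst integral_mult_right_zero[symmetric]) (simp only: mult_ac)
    moreover have "(\<integral>y. f x * g y * h x y \<partial>M2) = f x * (\<integral>y. g y * h x y \<partial>M2)" for x
      by (subst integral_mult_right_zero[symmetric]) (simp only: mult_ac)
    ultimately show ?thesis using Fubini_integral[OF *] by simp
  qed
qed

lemma integrable_mult_bounded:
  fixes f g :: "'a \<Rightarrow> real"
  assumes f: "integrable M f" and [measurable]: "g \<in> borel_measurable M" and "\<And>x. \<bar>g x\<bar> \<le> B"
  shows "integrable M (\<lambda>x. f x * g x)"
proof (rule Bochner_Integration.integrable_bound)
  show "integrable M (\<lambda>x. f x * B)" using f by simp
  have "\<bar>g x\<bar> \<le> \<bar>B\<bar>" for x using assms(3)[of x] by linarith
  then show "AE x in M. norm (f x * g x) \<le> norm (f x * B)" by (simp add: abs_mult mult_left_mono)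
qed (use f in measurable)

section \<open>The cosine transform and convolutions\<close>

text \<open>The symbols and densities of interest are even, so the cosine part is their whole
  Fourier transform. Staying real makes nonnegativity of a transform an ordinary inequality.\<close>

definition cos_transform :: "('a::euclidean_space \<Rightarrow> real) \<Rightarrow> 'a \<Rightarrow> real" where
  "cos_transform f \<xi> = (\<integral>z. f z * cos (\<xi> \<bullet> z) \<partial>lborel)"

definition inv_fourier :: "('a::euclidean_space \<Rightarrow> real) \<Rightarrow> 'a \<Rightarrow> real" where
  "inv_fourier \<phi> y = 1 / (2 * pi) ^ DIM('a) * cos_transform \<phi> y"

lemma cos_transform_measurable[measurable]:
  fixes f :: "'a::euclidean_space \<Rightarrow> real"
  assumes [measurable]: "f \<in> borel_measurable borel"
  shows "cos_transform f \<in> borel_measurable borel" "inv_fourier f \<in> borel_measurable borel"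
  unfolding inv_fourier_def[abs_def] cos_transform_def[abs_def] by measurable

lemma cos_transform_minus[simp]: "cos_transform f (- y) = cos_transform f y"
  by (simp add: cos_transform_def)

lemma inv_fourier_minus[simp]: "inv_fourier f (- y) = inv_fourier f y"
  by (simp add: inv_fourier_def)

lemma integrable_mult_cos:
  fixes f :: "'a::euclidean_space \<Rightarrow> real"
  assumes f: "integrable lborel f"
  shows "integrable lborel (\<lambda>z. f z * cos (\<xi> \<bullet> z))" "integrable lborel (\<lambda>z. f z * sin (\<xi> \<bullet> z))"
    "integrable lborel (\<lambda>z. f z * cos (z \<bullet> \<xi>))"
  by (rule integrable_mult_bounded[OF f, where B=1]; simp)+

lemma abs_cos_transform_le:
  fixes f :: "'a::euclidean_space \<Rightarrow> real"
  assumes f: "integrable lborel f"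
  shows "\<bar>cos_transform f \<xi>\<bar> \<le> (\<integral>z. \<bar>f z\<bar> \<partial>lborel)"
proof -
  have "\<bar>cos_transform f \<xi>\<bar> \<le> (\<integral>z. \<bar>f z * cos (\<xi> \<bullet> z)\<bar> \<partial>lborel)"
    unfolding cos_transform_def by (rule integral_abs_bound)
  also have "\<dots> \<le> (\<integral>z. \<bar>f z\<bar> \<partial>lborel)"
  proof (rule integral_mono)
    show "\<bar>f z * cos (\<xi> \<bullet> z)\<bar> \<le> \<bar>f z\<bar>" for z by (simp add: abs_mult mult_left_le)
  qed (intro integrable_abs integrable_mult_cos f)+
  finally show ?thesis .
qed

lemma continuous_cos_transform:
  fixes f :: "'a::euclidean_space \<Rightarrow> real"
  assumes f: "integrable lborel f"
  shows "continuous_on UNIV (cos_transform f)"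
  unfolding continuous_on_sequentially
proof (intro ballI allI impI)
  fix x :: "nat \<Rightarrow> 'a" and a assume x: "(\<forall>n. x n \<in> UNIV) \<and> x \<longlonglongrightarrow> a"
  have [measurable]: "f \<in> borel_measurable borel" using f by auto
  show "(cos_transform f \<circ> x) \<longlonglongrightarrow> cos_transform f a"
    unfolding cos_transform_def o_def
    by (rule integral_dominated_convergence[where w="\<lambda>z. \<bar>f z\<bar>"])
       (use f x in \<open>auto simp: abs_mult mult_left_le intro!: tendsto_intros AE_I2\<close>)
qed

lemma abs_inv_fourier_le:
  fixes \<phi> :: "'a::euclidean_space \<Rightarrow> real"
  assumes "integrable lborel \<phi>"
  shows "\<bar>inv_fourier \<phi> y\<bar> \<le> 1 / (2 * pi) ^ DIM('a) * (\<integral>z. \<bar>\<phi> z\<bar> \<partial>lborel)"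
  using abs_cos_transform_le[OF assms, of y]
  by (simp add: inv_fourier_def abs_mult divide_right_mono)

text \<open>The sine part of the transform of an even function vanishes.\<close>

lemma even_integral_cos_diff:
  fixes f :: "'a::euclidean_space \<Rightarrow> real"
  assumes f: "integrable lborel f" and even: "\<And>z. f (- z) = f z"
  shows "(\<integral>z. f z * cos (\<xi> \<bullet> (y - z)) \<partial>lborel) = cos (\<xi> \<bullet> y) * cos_transform f \<xi>"
proof -
  have [measurable]: "f \<in> borel_measurable borel" using f by auto
  have "(\<integral>z. f z * sin (\<xi> \<bullet> z) \<partial>lborel) = (\<integral>z. f (0 - z) * sin (\<xi> \<bullet> (0 - z)) \<partial>lborel)"
    by (rule lborel_integral_minus(1)[symmetric]) simp
  also have "\<dots> = - (\<integral>z. f z * sin (\<xi> \<bullet> z) \<partial>lborel)"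
    by (simp add: even)
  finally have "(\<integral>z. f z * sin (\<xi> \<bullet> z) \<partial>lborel) = 0" by simp
  moreover have "(\<integral>z. f z * cos (\<xi> \<bullet> (y - z)) \<partial>lborel)
    = (\<integral>z. cos (\<xi> \<bullet> y) * (f z * cos (\<xi> \<bullet> z)) + sin (\<xi> \<bullet> y) * (f z * sin (\<xi> \<bullet> z)) \<partial>lborel)"
    by (rule Bochner_Integration.integral_cong) (auto simp: inner_diff_right cos_diff algebra_simps)
  ultimately show ?thesis
    using integrable_mult_cos[OF f] by (simp add: cos_transform_def)
qed

text \<open>Multiplying a symbol by \<open>cos_transform f\<close> is convolution with
  \<open>f\<close> on the density side. The closure of positive definiteness under products rests on
  this.\<close>

lemma convolution_cos_transform:
  fixes f \<phi> :: "'a::euclidean_space \<Rightarrow> real"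
  assumes \<phi>: "integrable lborel \<phi>" and f: "integrable lborel f" and even: "\<And>z. f (- z) = f z"
  shows "(\<integral>z. f z * cos_transform \<phi> (y - z) \<partial>lborel) = cos_transform (\<lambda>\<xi>. \<phi> \<xi> * cos_transform f \<xi>) y"
proof -
  have "(\<integral>z. f z * cos_transform \<phi> (y - z) \<partial>lborel)
      = (\<integral>\<xi>. \<phi> \<xi> * (\<integral>z. f z * cos ((y - z) \<bullet> \<xi>) \<partial>lborel) \<partial>lborel)"
    unfolding cos_transform_def
    by (rule lborel_pair.integrable_mult_bounded_kernel(2)[OF f \<phi>, where B=1]) auto
  then show ?thesis
    using even_integral_cos_diff[OF f even] by (simp add: cos_transform_def inner_commute mult_ac)
qed

lemma convolution_inv_fourier:
  fixes f \<phi> :: "'a::euclidean_space \<Rightarrow> real"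
  assumes "integrable lborel \<phi>" and "integrable lborel f" and "\<And>z. f (- z) = f z"
  shows "(\<integral>z. f z * inv_fourier \<phi> (y - z) \<partial>lborel) = inv_fourier (\<lambda>\<xi>. \<phi> \<xi> * cos_transform f \<xi>) y"
  using convolution_cos_transform[OF assms] by (simp add: inv_fourier_def mult.left_commute[of "f _"])

text \<open>
  A concrete surrogate for positive definiteness. By Bochner's theorem it is equivalent to it for
  bounded continuous even functions, but its closure properties are immediate.
\<close>

definition pos_def :: "('a::euclidean_space \<Rightarrow> real) \<Rightarrow> bool" where
  "pos_def \<phi> \<longleftrightarrow> \<phi> \<in> borel_measurable borel \<and> (\<exists>B. \<forall>\<xi>. \<bar>\<phi> \<xi>\<bar> \<le> B) \<and>
     (\<forall>s>0. \<forall>y. 0 \<le> cos_transform (\<lambda>\<xi>. \<phi> \<xi> * exp (- s * (norm \<xi>)\<^sup>2)) y)"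

lemma bounded_mult_gaussian_integrable:
  fixes \<phi> :: "'a::euclidean_space \<Rightarrow> real"
  assumes [measurable]: "\<phi> \<in> borel_measurable borel" and "\<And>\<xi>. \<bar>\<phi> \<xi>\<bar> \<le> B" and "s > 0"
  shows "integrable lborel (\<lambda>\<xi>. \<phi> \<xi> * exp (- s * (norm \<xi>)\<^sup>2))"
proof -
  have "integrable lborel (\<lambda>\<xi>. exp (- s * (norm \<xi>)\<^sup>2) * \<phi> \<xi>)"
    by (rule integrable_mult_bounded[OF gaussian_fourier(1)[OF \<open>s > 0\<close>], where B=B]) (use assms in auto)
  then show ?thesis by (simp add: mult.commute)
qed

section \<open>Closure properties of positive definite symbols\<close>

lemma pos_def_1: "pos_def (\<lambda>_::'a::euclidean_space. 1)"
proof -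
  have "cos_transform (\<lambda>\<xi>::'a. exp (- (s * (norm \<xi>)\<^sup>2))) y \<ge> 0" if "s > 0" for s y
    using gaussian_fourier(2)[OF that, of y] that by (simp add: cos_transform_def inner_commute)
  then show ?thesis by (auto simp: pos_def_def)
qed

text \<open>The Gaussian damping built into \<open>pos_def\<close> provides the dominating function,
  so bounded pointwise convergence is enough although the symbols themselves may fail to be
  integrable.\<close>

lemma pos_def_limit:
  fixes \<phi> :: "'a::euclidean_space \<Rightarrow> real"
  assumes pd: "\<And>n. pos_def (f n)" and bound: "\<And>n \<xi>. \<bar>f n \<xi>\<bar> \<le> B"
    and lim: "\<And>\<xi>. (\<lambda>n. f n \<xi>) \<longlonglongrightarrow> \<phi> \<xi>"
  shows "pos_def \<phi>"
proof -
  have [measurable]: "f n \<in> borel_measurable borel" for n using pd by (simp add: pos_def_def)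
  have [measurable]: "\<phi> \<in> borel_measurable borel"
    by (rule borel_measurable_LIMSEQ_metric[OF _ lim]) simp
  have "\<bar>\<phi> \<xi>\<bar> \<le> B" for \<xi>
    by (rule LIMSEQ_le_const2[OF tendsto_rabs[OF lim]]) (use bound in auto)
  moreover have "0 \<le> cos_transform (\<lambda>\<xi>. \<phi> \<xi> * exp (- s * (norm \<xi>)\<^sup>2)) y" if s: "s > 0" for s y
  proof (rule LIMSEQ_le_const)
    show "(\<lambda>n. cos_transform (\<lambda>\<xi>. f n \<xi> * exp (- s * (norm \<xi>)\<^sup>2)) y)
       \<longlonglongrightarrow> cos_transform (\<lambda>\<xi>. \<phi> \<xi> * exp (- s * (norm \<xi>)\<^sup>2)) y"
      unfolding cos_transform_def
    proof (rule integral_dominated_convergence[where w="\<lambda>\<xi>. B * exp (- s * (norm \<xi>)\<^sup>2)"])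
      show "integrable lborel (\<lambda>\<xi>::'a. B * exp (- s * (norm \<xi>)\<^sup>2))"
        by (rule integrable_mult_right) (rule gaussian_fourier(1)[OF s])
      have "\<bar>f n \<xi>\<bar> * exp (- (s * (norm \<xi>)\<^sup>2)) * \<bar>cos (y \<bullet> \<xi>)\<bar> \<le> B * exp (- (s * (norm \<xi>)\<^sup>2)) * 1" for n \<xi>
        by (intro mult_mono) (use bound[of n \<xi>] in auto)
      then show "AE x in lborel. norm (f n x * exp (- s * (norm x)\<^sup>2) * cos (y \<bullet> x)) \<le> B * exp (- s * (norm x)\<^sup>2)" for n
        by (simp add: abs_mult)
    qed (auto intro!: tendsto_intros lim)
    show "\<exists>N. \<forall>n\<ge>N. 0 \<le> cos_transform (\<lambda>\<xi>. f n \<xi> * exp (- s * (norm \<xi>)\<^sup>2)) y"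
      using pd s by (simp add: pos_def_def)
  qed
  ultimately show ?thesis by (auto simp: pos_def_def)
qed

lemma pos_def_add:
  fixes \<phi> \<psi> :: "'a::euclidean_space \<Rightarrow> real"
  assumes "pos_def \<phi>" "pos_def \<psi>"
  shows "pos_def (\<lambda>\<xi>. \<phi> \<xi> + \<psi> \<xi>)"
proof -
  from assms obtain B C where B: "\<And>\<xi>. \<bar>\<phi> \<xi>\<bar> \<le> B" and C: "\<And>\<xi>. \<bar>\<psi> \<xi>\<bar> \<le> C"
    by (auto simp: pos_def_def)
  have [measurable]: "\<phi> \<in> borel_measurable borel" "\<psi> \<in> borel_measurable borel"
    using assms by (auto simp: pos_def_def)
  have "\<bar>\<phi> \<xi> + \<psi> \<xi>\<bar> \<le> B + C" for \<xi> using B[of \<xi>] C[of \<xi>] by linarith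
  moreover have "0 \<le> cos_transform (\<lambda>\<xi>. (\<phi> \<xi> + \<psi> \<xi>) * exp (- s * (norm \<xi>)\<^sup>2)) y" if s: "s > 0" for s y
  proof -
    have "cos_transform (\<lambda>\<xi>. (\<phi> \<xi> + \<psi> \<xi>) * exp (- s * (norm \<xi>)\<^sup>2)) y
       = cos_transform (\<lambda>\<xi>. \<phi> \<xi> * exp (- s * (norm \<xi>)\<^sup>2)) y + cos_transform (\<lambda>\<xi>. \<psi> \<xi> * exp (- s * (norm \<xi>)\<^sup>2)) y"
      unfolding cos_transform_def distrib_right
      by (intro Bochner_Integration.integral_add integrable_mult_cos bounded_mult_gaussian_integrable[OF _ B] bounded_mult_gaussian_integrable[OF _ C] s) simp_all
    with assms s show ?thesis by (simp add: pos_def_def)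
  qed
  ultimately show ?thesis unfolding pos_def_def by (auto intro!: exI[of _ "B + C"])
qed

lemma pos_def_cmult:
  fixes \<phi> :: "'a::euclidean_space \<Rightarrow> real"
  assumes "pos_def \<phi>" "c \<ge> 0"
  shows "pos_def (\<lambda>\<xi>. c * \<phi> \<xi>)"
proof -
  from assms obtain B where B: "\<And>\<xi>. \<bar>\<phi> \<xi>\<bar> \<le> B" by (auto simp: pos_def_def)
  have "\<bar>c * \<phi> \<xi>\<bar> \<le> c * B" for \<xi> using B[of \<xi>] assms(2) by (simp add: abs_mult mult_left_mono)
  moreover have "cos_transform (\<lambda>\<xi>. c * \<phi> \<xi> * g \<xi>) y = c * cos_transform (\<lambda>\<xi>. \<phi> \<xi> * g \<xi>) y" for g y
    by (simp add: cos_transform_def mult.assoc)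
  ultimately show ?thesis using assms by (auto simp: pos_def_def intro!: exI[of _ "c * B"])
qed

text \<open>Convolving a nonnegative function with a nonnegative \<open>f\<close> leaves it
  nonnegative; the damping factor stays with \<open>\<phi>\<close>.\<close>

lemma pos_def_mult_cos_transform:
  fixes \<phi> f :: "'a::euclidean_space \<Rightarrow> real"
  assumes pd: "pos_def \<phi>" and f: "integrable lborel f" and even: "\<And>z. f (- z) = f z" and nonneg: "\<And>z. f z \<ge> 0"
  shows "pos_def (\<lambda>\<xi>. \<phi> \<xi> * cos_transform f \<xi>)"
proof -
  from pd obtain B where B: "\<And>\<xi>. \<bar>\<phi> \<xi>\<bar> \<le> B" by (auto simp: pos_def_def)
  have [measurable]: "\<phi> \<in> borel_measurable borel" "f \<in> borel_measurable borel"
    using pd f by (auto simp: pos_def_def)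
  have "B \<ge> 0" using B[of 0] by linarith
  then have "\<bar>\<phi> \<xi> * cos_transform f \<xi>\<bar> \<le> B * (\<integral>z. \<bar>f z\<bar> \<partial>lborel)" for \<xi>
    unfolding abs_mult by (intro mult_mono B abs_cos_transform_le f) auto
  moreover have "0 \<le> cos_transform (\<lambda>\<xi>. \<phi> \<xi> * cos_transform f \<xi> * exp (- s * (norm \<xi>)\<^sup>2)) y" if s: "s > 0" for s y
  proof -
    have "0 \<le> (\<integral>z. f z * cos_transform (\<lambda>\<xi>. \<phi> \<xi> * exp (- s * (norm \<xi>)\<^sup>2)) (y - z) \<partial>lborel)"
      using pd s nonneg by (auto simp: pos_def_def intro!: Bochner_Integration.integral_nonneg)
    also have "\<dots> = cos_transform (\<lambda>\<xi>. \<phi> \<xi> * exp (- s * (norm \<xi>)\<^sup>2) * cos_transform f \<xi>) y"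
      by (rule convolution_cos_transform[OF bounded_mult_gaussian_integrable[OF _ B s] f even]) simp
    finally show ?thesis by (simp add: mult_ac)
  qed
  ultimately show ?thesis unfolding pos_def_def by auto
qed

text \<open>The transform of a nonnegative \<open>f\<close> is bounded by the mass of
  \<open>f\<close>, so convergence of the series at that mass bounds all partial sums uniformly. The
  exponential series is the case of interest: its n-th term collects the paths with n jumps of
  density \<open>f\<close>.\<close>

lemma pos_def_mult_power_series:
  fixes \<phi> f :: "'a::euclidean_space \<Rightarrow> real"
  assumes pd: "pos_def \<phi>" and f: "integrable lborel f" and even: "\<And>z. f (- z) = f z" and nonneg: "\<And>z. f z \<ge> 0"
    and a: "\<And>n. a n \<ge> 0" and sum: "summable (\<lambda>n. a n * (\<integral>z. f z \<partial>lborel) ^ n)"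
  shows "pos_def (\<lambda>\<xi>. \<phi> \<xi> * (\<Sum>n. a n * cos_transform f \<xi> ^ n))"
proof -
  from pd obtain B where B: "\<And>\<xi>. \<bar>\<phi> \<xi>\<bar> \<le> B" by (auto simp: pos_def_def)
  have "B \<ge> 0" using B[of 0] by linarith
  let ?l = "\<integral>z. f z \<partial>lborel"
  have le: "\<bar>a n * cos_transform f \<xi> ^ n\<bar> \<le> a n * ?l ^ n" for n \<xi>
    using abs_cos_transform_le[OF f, of \<xi>] nonneg a
    by (simp add: abs_mult power_abs mult_left_mono power_mono)
  have pow: "pos_def (\<lambda>\<xi>. \<phi> \<xi> * cos_transform f \<xi> ^ n)" for n
  proof (induction n)
    case (Suc n)
    from pos_def_mult_cos_transform[OF this f even nonneg] show ?case by (simp add: mult_ac)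
  qed (use pd in simp)
  have zero: "pos_def (\<lambda>_::'a. 0)" using pos_def_cmult[OF pd, of 0] by simp
  have part: "pos_def (\<lambda>\<xi>. \<phi> \<xi> * (\<Sum>n<N. a n * cos_transform f \<xi> ^ n))" for N
  proof (induction N)
    case (Suc N)
    from pos_def_add[OF this pos_def_cmult[OF pow[of N] a[of N]]] show ?case
      by (simp add: algebra_simps)
  qed (use zero in simp)
  show ?thesis
  proof (rule pos_def_limit[OF part])
    fix N \<xi>
    have "\<bar>\<Sum>n<N. a n * cos_transform f \<xi> ^ n\<bar> \<le> (\<Sum>n<N. a n * ?l ^ n)"
      by (rule order_trans[OF sum_abs sum_mono]) (rule le)
    also have "\<dots> \<le> (\<Sum>n. a n * ?l ^ n)"
      by (rule sum_le_suminf[OF sum]) (use a nonneg in auto)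
    finally show "\<bar>\<phi> \<xi> * (\<Sum>n<N. a n * cos_transform f \<xi> ^ n)\<bar> \<le> B * (\<Sum>n. a n * ?l ^ n)"
      unfolding abs_mult by (intro mult_mono B \<open>B \<ge> 0\<close>) auto
  next
    fix \<xi>
    have "summable (\<lambda>n. a n * cos_transform f \<xi> ^ n)"
      by (rule summable_comparison_test'[OF sum, of 0]) (use le in auto)
    then show "(\<lambda>N. \<phi> \<xi> * (\<Sum>n<N. a n * cos_transform f \<xi> ^ n)) \<longlonglongrightarrow> \<phi> \<xi> * (\<Sum>n. a n * cos_transform f \<xi> ^ n)"
      by (intro tendsto_intros summable_LIMSEQ)
  qed
qed

section \<open>From positive definite symbols to densities: positivity and Fourier inversion\<close>

text \<open>For an integrable symbol the damping can be removed by dominated convergence.\<close>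

lemma pos_def_imp_inv_fourier_nonneg:
  fixes \<phi> :: "'a::euclidean_space \<Rightarrow> real"
  assumes pd: "pos_def \<phi>" and int: "integrable lborel \<phi>"
  shows "0 \<le> inv_fourier \<phi> y"
proof -
  have "0 \<le> cos_transform \<phi> y"
  proof (rule LIMSEQ_le_const)
    show "(\<lambda>n. cos_transform (\<lambda>\<xi>. \<phi> \<xi> * exp (- inverse (real (Suc n)) * (norm \<xi>)\<^sup>2)) y) \<longlonglongrightarrow> cos_transform \<phi> y"
      unfolding cos_transform_def
    proof (rule integral_dominated_convergence[where w="\<lambda>\<xi>. \<bar>\<phi> \<xi>\<bar>"])
      have [measurable]: "\<phi> \<in> borel_measurable borel" using int by auto
      show "(\<lambda>z. \<phi> z * cos (y \<bullet> z)) \<in> borel_measurable lborel"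
        "(\<lambda>z. \<phi> z * exp (- inverse (real (Suc n)) * (norm z)\<^sup>2) * cos (y \<bullet> z)) \<in> borel_measurable lborel" for n
        by measurable
      show "integrable lborel (\<lambda>\<xi>. \<bar>\<phi> \<xi>\<bar>)" using int by simp
      have "(\<lambda>n. exp (- inverse (real (Suc n)) * c)) \<longlonglongrightarrow> exp (- 0 * c)" for c :: real
        by (intro tendsto_intros LIMSEQ_inverse_real_of_nat)
      then have "(\<lambda>n. \<phi> x * exp (- inverse (real (Suc n)) * (norm x)\<^sup>2) * cos (y \<bullet> x)) \<longlonglongrightarrow> \<phi> x * 1 * cos (y \<bullet> x)" for x
        by (intro tendsto_intros) simp
      then show "AE x in lborel. (\<lambda>n. \<phi> x * exp (- inverse (real (Suc n)) * (norm x)\<^sup>2) * cos (y \<bullet> x)) \<longlonglongrightarrow> \<phi> x * cos (y \<bullet> x)"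
        by simp
      have "\<bar>\<phi> x\<bar> * exp (- (inverse (real (Suc n)) * (norm x)\<^sup>2)) * \<bar>cos (y \<bullet> x)\<bar> \<le> \<bar>\<phi> x\<bar> * 1 * 1" for x n
        by (intro mult_mono) auto
      then show "AE x in lborel. norm (\<phi> x * exp (- inverse (real (Suc n)) * (norm x)\<^sup>2) * cos (y \<bullet> x)) \<le> \<bar>\<phi> x\<bar>" for n
        by (simp add: abs_mult)
    qed
    show "\<exists>N. \<forall>n\<ge>N. 0 \<le> cos_transform (\<lambda>\<xi>. \<phi> \<xi> * exp (- inverse (real (Suc n)) * (norm \<xi>)\<^sup>2)) y"
      using pd by (auto simp: pos_def_def)
  qed
  then show ?thesis by (simp add: inv_fourier_def)
qed

text \<open>Inserting a Gaussian damping turns the inversion formula into convergence of a Gaussian approximate identity.\<close>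

lemma inv_fourier_gaussian:
  fixes \<phi> :: "'a::euclidean_space \<Rightarrow> real"
  assumes int: "integrable lborel \<phi>" and even: "\<And>\<xi>. \<phi> (- \<xi>) = \<phi> \<xi>" and \<epsilon>: "\<epsilon> > 0"
  shows "(\<integral>w. exp (- \<epsilon>\<^sup>2 * (norm w)\<^sup>2) * cos (\<xi>0 \<bullet> w) * inv_fourier \<phi> w \<partial>lborel)
    = (sqrt pi / (2 * pi)) ^ DIM('a) * (\<integral>\<eta>. exp (- (norm \<eta>)\<^sup>2 / 4) * \<phi> (\<xi>0 + \<epsilon> *\<^sub>R \<eta>) \<partial>lborel)"
proof -
  have [measurable]: "\<phi> \<in> borel_measurable borel" using int by auto
  let ?G = "\<lambda>w::'a. exp (- \<epsilon>\<^sup>2 * (norm w)\<^sup>2)"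
  let ?A = "\<integral>w. ?G w * cos (\<xi>0 \<bullet> w) * inv_fourier \<phi> w \<partial>lborel"
  let ?B = "\<integral>\<eta>. exp (- (norm \<eta>)\<^sup>2 / 4) * \<phi> (\<xi>0 + \<epsilon> *\<^sub>R \<eta>) \<partial>lborel"
  have \<epsilon>2: "\<epsilon>\<^sup>2 > 0" using \<epsilon> by simp
  have G: "integrable lborel ?G" by (rule gaussian_fourier(1)[OF \<epsilon>2])
  define k where "k \<xi> = exp (- (norm \<xi>)\<^sup>2 / (4 * \<epsilon>\<^sup>2))" for \<xi> :: 'a
  have [measurable]: "k \<in> borel_measurable borel" unfolding k_def[abs_def] by measurable
  have k_le: "\<bar>k \<xi>\<bar> \<le> 1" for \<xi> by (simp add: k_def)
  have gk: "(\<integral>w. ?G w * cos (w \<bullet> \<xi>) \<partial>lborel) = sqrt (pi / \<epsilon>\<^sup>2) ^ DIM('a) * k \<xi>" for \<xi>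
    using gaussian_fourier(2)[OF \<epsilon>2, of \<xi>] by (simp add: k_def)
  \<comment> \<open>By the product formula for cosines, the modulated Gaussian transforms into the
    average of two Gaussians centred at \<open>\<xi>0\<close> and \<open>- \<xi>0\<close>. Since
    \<open>\<phi>\<close> is even, both contribute equally to the integral against
    \<open>\<phi>\<close>.\<close>
  have cc: "(\<integral>w. ?G w * cos (\<xi>0 \<bullet> w) * cos (w \<bullet> \<xi>) \<partial>lborel)
      = sqrt (pi / \<epsilon>\<^sup>2) ^ DIM('a) * ((k (\<xi> - \<xi>0) + k (\<xi>0 + \<xi>)) / 2)" for \<xi>
  proof -
    have "(\<integral>w. ?G w * cos (\<xi>0 \<bullet> w) * cos (w \<bullet> \<xi>) \<partial>lborel)
       = (\<integral>w. (?G w * cos (w \<bullet> (\<xi> - \<xi>0)) + ?G w * cos (w \<bullet> (\<xi>0 + \<xi>))) / 2 \<partial>lborel)"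
      by (rule Bochner_Integration.integral_cong)
         (auto simp: inner_diff_right inner_add_right cos_diff cos_add inner_commute algebra_simps)
    also have "\<dots> = ((\<integral>w. ?G w * cos (w \<bullet> (\<xi> - \<xi>0)) \<partial>lborel) + (\<integral>w. ?G w * cos (w \<bullet> (\<xi>0 + \<xi>)) \<partial>lborel)) / 2"
      using integrable_mult_cos(3)[OF G] by simp
    finally show ?thesis unfolding gk by (simp add: algebra_simps)
  qed
  have G': "integrable lborel (\<lambda>w. ?G w * cos (\<xi>0 \<bullet> w))" by (rule integrable_mult_cos[OF G])
  have "(?A)
     = 1 / (2 * pi) ^ DIM('a) * (\<integral>w. ?G w * cos (\<xi>0 \<bullet> w) * (\<integral>\<xi>. \<phi> \<xi> * cos (w \<bullet> \<xi>) \<partial>lborel) \<partial>lborel)"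
    unfolding inv_fourier_def cos_transform_def by (simp add: mult_ac)
  also have "(\<integral>w. ?G w * cos (\<xi>0 \<bullet> w) * (\<integral>\<xi>. \<phi> \<xi> * cos (w \<bullet> \<xi>) \<partial>lborel) \<partial>lborel)
     = (\<integral>\<xi>. \<phi> \<xi> * (\<integral>w. ?G w * cos (\<xi>0 \<bullet> w) * cos (w \<bullet> \<xi>) \<partial>lborel) \<partial>lborel)"
    by (rule lborel_pair.integrable_mult_bounded_kernel(2)[OF G' int, where B=1]) auto
  also have "\<dots> = sqrt (pi / \<epsilon>\<^sup>2) ^ DIM('a) * (\<integral>\<xi>. (\<phi> \<xi> * k (\<xi> - \<xi>0) + \<phi> \<xi> * k (\<xi>0 + \<xi>)) / 2 \<partial>lborel)"
    unfolding cc
    by (subst integral_mult_right_zero[symmetric], rule Bochner_Integration.integral_cong) (auto simp: algebra_simps)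
  also have "(\<integral>\<xi>. (\<phi> \<xi> * k (\<xi> - \<xi>0) + \<phi> \<xi> * k (\<xi>0 + \<xi>)) / 2 \<partial>lborel)
     = ((\<integral>\<xi>. \<phi> \<xi> * k (\<xi> - \<xi>0) \<partial>lborel) + (\<integral>\<xi>. \<phi> \<xi> * k (\<xi>0 + \<xi>) \<partial>lborel)) / 2"
    by (simp add: integrable_mult_bounded[OF int _ k_le])
  also have "(\<integral>\<xi>. \<phi> \<xi> * k (\<xi> - \<xi>0) \<partial>lborel) = (\<integral>\<xi>. \<phi> (0 - \<xi>) * k (0 - \<xi> - \<xi>0) \<partial>lborel)"
    by (rule lborel_integral_minus(1)[symmetric]) simp
  also have "\<dots> = (\<integral>\<xi>. \<phi> \<xi> * k (\<xi>0 + \<xi>) \<partial>lborel)"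
  proof (rule Bochner_Integration.integral_cong)
    fix \<xi> :: 'a
    have "k (0 - \<xi> - \<xi>0) = k (\<xi>0 + \<xi>)"
      using norm_minus_cancel[of "- \<xi> - \<xi>0"] by (simp add: k_def)
    then show "\<phi> (0 - \<xi>) * k (0 - \<xi> - \<xi>0) = \<phi> \<xi> * k (\<xi>0 + \<xi>)" by (simp add: even)
  qed simp
  finally have 1: "(?A)
     = 1 / (2 * pi) ^ DIM('a) * (sqrt (pi / \<epsilon>\<^sup>2) ^ DIM('a) * (\<integral>\<xi>. \<phi> \<xi> * k (\<xi>0 + \<xi>) \<partial>lborel))"
    by simp
  have "(\<integral>\<xi>. \<phi> \<xi> * k (\<xi>0 + \<xi>) \<partial>lborel) = (\<integral>\<xi>. \<phi> (0 - \<xi>) * k (\<xi>0 + (0 - \<xi>)) \<partial>lborel)"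
    by (rule lborel_integral_minus(1)[symmetric]) simp
  also have "\<dots> = \<bar>\<epsilon>\<bar> ^ DIM('a) * (\<integral>\<eta>. \<phi> (0 - (\<xi>0 + \<epsilon> *\<^sub>R \<eta>)) * k (\<xi>0 + (0 - (\<xi>0 + \<epsilon> *\<^sub>R \<eta>))) \<partial>lborel)"
    by (rule lborel_integral_affine) (use \<epsilon> in auto)
  also have "(\<integral>\<eta>. \<phi> (0 - (\<xi>0 + \<epsilon> *\<^sub>R \<eta>)) * k (\<xi>0 + (0 - (\<xi>0 + \<epsilon> *\<^sub>R \<eta>))) \<partial>lborel)
      = (?B)"
  proof (rule Bochner_Integration.integral_cong)
    fix \<eta> :: 'a
    have "\<phi> (0 - (\<xi>0 + \<epsilon> *\<^sub>R \<eta>)) = \<phi> (\<xi>0 + \<epsilon> *\<^sub>R \<eta>)" using even[of "\<xi>0 + \<epsilon> *\<^sub>R \<eta>"] by simp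
    moreover have "k (\<xi>0 + (0 - (\<xi>0 + \<epsilon> *\<^sub>R \<eta>))) = exp (- (norm \<eta>)\<^sup>2 / 4)"
      using \<epsilon> by (simp add: k_def power_mult_distrib)
    ultimately show "\<phi> (0 - (\<xi>0 + \<epsilon> *\<^sub>R \<eta>)) * k (\<xi>0 + (0 - (\<xi>0 + \<epsilon> *\<^sub>R \<eta>))) = exp (- (norm \<eta>)\<^sup>2 / 4) * \<phi> (\<xi>0 + \<epsilon> *\<^sub>R \<eta>)"
      by simp
  qed simp
  finally have 2: "(\<integral>\<xi>. \<phi> \<xi> * k (\<xi>0 + \<xi>) \<partial>lborel) = \<epsilon> ^ DIM('a) * (?B)"
    using \<epsilon> by simp
  have "sqrt (pi / \<epsilon>\<^sup>2) ^ DIM('a) * \<epsilon> ^ DIM('a) = sqrt pi ^ DIM('a)"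
    using \<epsilon> by (simp add: real_sqrt_divide power_divide)
  then show ?thesis unfolding 1 2 by (simp add: power_divide field_simps)
qed

text \<open>The right-hand side of \<open>inv_fourier_gaussian\<close> averages
  \<open>\<phi>\<close> around \<open>\<xi>0\<close> at scale \<open>\<epsilon>\<close>, with
  Gaussian weights of total mass one, so continuity at \<open>\<xi>0\<close> gives the
  limit.\<close>

lemma inv_fourier_gaussian_LIMSEQ:
  fixes \<phi> :: "'a::euclidean_space \<Rightarrow> real"
  assumes int: "integrable lborel \<phi>" and even: "\<And>\<xi>. \<phi> (- \<xi>) = \<phi> \<xi>"
    and cont: "continuous_on UNIV \<phi>" and bound: "\<And>\<xi>. \<bar>\<phi> \<xi>\<bar> \<le> B"
  shows "(\<lambda>n. \<integral>w. exp (- (inverse (real (Suc n)))\<^sup>2 * (norm w)\<^sup>2) * cos (\<xi>0 \<bullet> w) * inv_fourier \<phi> w \<partial>lborel)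
    \<longlonglongrightarrow> \<phi> \<xi>0"
proof -
  have [measurable]: "\<phi> \<in> borel_measurable borel" using int by auto
  have B: "B \<ge> 0" using bound[of 0] by linarith
  have g: "integrable lborel (\<lambda>\<eta>::'a. exp (- (norm \<eta>)\<^sup>2 / 4))"
    "integral\<^sup>L lborel (\<lambda>\<eta>::'a. exp (- (norm \<eta>)\<^sup>2 / 4)) = sqrt (4 * pi) ^ DIM('a)"
    using gaussian_fourier(1)[where 'a='a and s="1/4"] gaussian_fourier(2)[of "1/4" "0::'a"]
    by (simp_all add: mult.commute)
  have "(\<lambda>n. \<integral>\<eta>. exp (- (norm \<eta>)\<^sup>2 / 4) * \<phi> (\<xi>0 + inverse (real (Suc n)) *\<^sub>R \<eta>) \<partial>lborel)
    \<longlonglongrightarrow> integral\<^sup>L lborel (\<lambda>\<eta>::'a. exp (- (norm \<eta>)\<^sup>2 / 4) * \<phi> \<xi>0)"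
  proof (rule integral_dominated_convergence[where w="\<lambda>\<eta>::'a. exp (- (norm \<eta>)\<^sup>2 / 4) * B"])
    have "(\<lambda>n. \<phi> (\<xi>0 + inverse (real (Suc n)) *\<^sub>R \<eta>)) \<longlonglongrightarrow> \<phi> \<xi>0" for \<eta>
    proof -
      have "(\<lambda>n. \<xi>0 + inverse (real (Suc n)) *\<^sub>R \<eta>) \<longlonglongrightarrow> \<xi>0 + 0 *\<^sub>R \<eta>"
        by (intro tendsto_intros LIMSEQ_inverse_real_of_nat)
      then show ?thesis
        using cont by (auto simp: continuous_on_sequentially o_def)
    qed
    then show "AE x in lborel. (\<lambda>i. exp (- (norm x)\<^sup>2 / 4) * \<phi> (\<xi>0 + inverse (real (Suc i)) *\<^sub>R x))
        \<longlonglongrightarrow> exp (- (norm x)\<^sup>2 / 4) * \<phi> \<xi>0"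
      by (intro AE_I2 tendsto_intros)
    show "AE x in lborel. norm (exp (- (norm x)\<^sup>2 / 4) * \<phi> (\<xi>0 + inverse (real (Suc i)) *\<^sub>R x)) \<le> exp (- (norm x)\<^sup>2 / 4) * B" for i
      using bound by (auto simp: abs_mult)
  qed (use g in auto)
  then have "(\<lambda>n. (sqrt pi / (2 * pi)) ^ DIM('a) * (\<integral>\<eta>. exp (- (norm \<eta>)\<^sup>2 / 4) * \<phi> (\<xi>0 + inverse (real (Suc n)) *\<^sub>R \<eta>) \<partial>lborel))
    \<longlonglongrightarrow> (sqrt pi / (2 * pi)) ^ DIM('a) * (sqrt (4 * pi) ^ DIM('a) * \<phi> \<xi>0)"
    using g by (intro tendsto_intros) simp
  moreover have "(sqrt pi / (2 * pi)) ^ DIM('a) * (sqrt (4 * pi) ^ DIM('a) * \<phi> \<xi>0) = \<phi> \<xi>0"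
  proof -
    have "sqrt pi / (2 * pi) * sqrt (4 * pi) = 1" by (simp add: real_sqrt_mult)
    then have "(sqrt pi / (2 * pi)) ^ DIM('a) * sqrt (4 * pi) ^ DIM('a) = 1"
      by (simp only: power_mult_distrib[symmetric] power_one)
    then show ?thesis by (metis mult.assoc mult_1)
  qed
  moreover have "(\<integral>w. exp (- (inverse (real (Suc n)))\<^sup>2 * (norm w)\<^sup>2) * cos (\<xi>0 \<bullet> w) * inv_fourier \<phi> w \<partial>lborel)
    = (sqrt pi / (2 * pi)) ^ DIM('a) * (\<integral>\<eta>. exp (- (norm \<eta>)\<^sup>2 / 4) * \<phi> (\<xi>0 + inverse (real (Suc n)) *\<^sub>R \<eta>) \<partial>lborel)" for n
    by (rule inv_fourier_gaussian[OF int even]) simp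
  ultimately show ?thesis by (simp only:)
qed

text \<open>Nonnegativity takes the place of an assumption that the inverse transform is integrable:
  at frequency zero the damped integrals increase and converge to \<open>\<phi> 0\<close>, so
  monotone convergence yields integrability. The inverse transform then dominates its own damped
  versions at every other frequency.\<close>

lemma fourier_inversion:
  fixes \<phi> :: "'a::euclidean_space \<Rightarrow> real"
  assumes int: "integrable lborel \<phi>" and even: "\<And>\<xi>. \<phi> (- \<xi>) = \<phi> \<xi>"
    and cont: "continuous_on UNIV \<phi>" and bound: "\<And>\<xi>. \<bar>\<phi> \<xi>\<bar> \<le> B"
    and nonneg: "\<And>y. 0 \<le> inv_fourier \<phi> y"
  shows "integrable lborel (inv_fourier \<phi>)" and "cos_transform (inv_fourier \<phi>) \<xi> = \<phi> \<xi>"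
proof -
  have [measurable]: "\<phi> \<in> borel_measurable borel" using int by auto
  define G where "G n w = exp (- (inverse (real (Suc n)))\<^sup>2 * (norm w)\<^sup>2)" for n and w :: 'a
  have [measurable]: "G n \<in> borel_measurable borel" for n unfolding G_def[abs_def] by measurable
  have G_le: "0 \<le> G n w" "G n w \<le> 1" for n w by (auto simp: G_def)
  have G_mono: "G m w \<le> G n w" if "m \<le> n" for m n w
    using that by (auto simp: G_def intro!: mult_right_mono power_mono le_imp_inverse_le)
  have "(\<lambda>n. exp (- (inverse (real (Suc n)))\<^sup>2 * c)) \<longlonglongrightarrow> exp (- 0\<^sup>2 * c)" for c :: real
    by (intro tendsto_intros LIMSEQ_inverse_real_of_nat)
  then have G_lim: "(\<lambda>n. G n w) \<longlonglongrightarrow> 1" for w by (simp add: G_def)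
  have lim: "(\<lambda>n. \<integral>w. G n w * cos (\<xi> \<bullet> w) * inv_fourier \<phi> w \<partial>lborel) \<longlonglongrightarrow> \<phi> \<xi>" for \<xi>
    unfolding G_def by (rule inv_fourier_gaussian_LIMSEQ[OF int even cont bound])
  have Gi: "integrable lborel (G n)" for n
    unfolding G_def[abs_def] by (rule gaussian_fourier(1)) simp
  have i: "integrable lborel (\<lambda>w. G n w * inv_fourier \<phi> w)" for n
    by (rule integrable_mult_bounded[OF Gi _ abs_inv_fourier_le[OF int]]) simp
  show I: "integrable lborel (inv_fourier \<phi>)"
  proof (rule integrable_monotone_convergence[OF i])
    show "AE x in lborel. mono (\<lambda>n. G n x * inv_fourier \<phi> x)"
      using G_mono nonneg by (auto simp: mono_def intro!: mult_right_mono)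
    have "(\<lambda>n. G n x * inv_fourier \<phi> x) \<longlonglongrightarrow> 1 * inv_fourier \<phi> x" for x
      by (intro tendsto_intros G_lim)
    then show "AE x in lborel. (\<lambda>n. G n x * inv_fourier \<phi> x) \<longlonglongrightarrow> inv_fourier \<phi> x" by simp
    show "(\<lambda>n. \<integral>w. G n w * inv_fourier \<phi> w \<partial>lborel) \<longlonglongrightarrow> \<phi> 0" using lim[of 0] by simp
  qed simp
  have "(\<lambda>n. \<integral>w. G n w * cos (\<xi> \<bullet> w) * inv_fourier \<phi> w \<partial>lborel) \<longlonglongrightarrow> (\<integral>w. inv_fourier \<phi> w * cos (\<xi> \<bullet> w) \<partial>lborel)"
  proof (rule integral_dominated_convergence[where w="inv_fourier \<phi>"])
    have "(\<lambda>n. G n x * cos (\<xi> \<bullet> x) * inv_fourier \<phi> x) \<longlonglongrightarrow> 1 * cos (\<xi> \<bullet> x) * inv_fourier \<phi> x" for x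
      by (intro tendsto_intros G_lim)
    then show "AE x in lborel. (\<lambda>n. G n x * cos (\<xi> \<bullet> x) * inv_fourier \<phi> x) \<longlonglongrightarrow> inv_fourier \<phi> x * cos (\<xi> \<bullet> x)"
      by (simp add: mult.commute)
    have "G n x * \<bar>cos (\<xi> \<bullet> x)\<bar> * inv_fourier \<phi> x \<le> 1 * 1 * inv_fourier \<phi> x" for n x
      using G_le[of n x] nonneg by (intro mult_mono) auto
    then show "AE x in lborel. norm (G n x * cos (\<xi> \<bullet> x) * inv_fourier \<phi> x) \<le> inv_fourier \<phi> x" for n
      using G_le nonneg by (auto simp: abs_mult)
  qed (use I in simp_all)
  from LIMSEQ_unique[OF this lim[of \<xi>]] show "cos_transform (inv_fourier \<phi>) \<xi> = \<phi> \<xi>"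
    by (simp add: cos_transform_def)
qed

section \<open>Subordination and the fractional jump kernel\<close>

lemma Gamma_nn_integral_scaled:
  fixes x u :: real
  assumes x: "x > 0" and u: "u > 0"
  shows "(\<integral>\<^sup>+s. ennreal (indicator {0<..} s * s powr (x - 1) * exp (- u * s)) \<partial>lborel) = ennreal (Gamma x * u powr (- x))"
proof -
  let ?h = "\<lambda>t. ennreal (indicator {0<..} t * t powr (x - 1) * exp (- u * t))"
  have "ennreal (Gamma x) = (\<integral>\<^sup>+t. ennreal (indicator {0..} t * t powr (x - 1) / exp t) \<partial>lborel)"
    by (rule Gamma_conv_nn_integral_real[OF x])
  also have "\<dots> = ennreal \<bar>u\<bar> * (\<integral>\<^sup>+t. ennreal (indicator {0..} (0 + u * t) * (0 + u * t) powr (x - 1) / exp (0 + u * t)) \<partial>lborel)"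
    by (rule nn_integral_real_affine) (use u in auto)
  also have "(\<integral>\<^sup>+t. ennreal (indicator {0..} (0 + u * t) * (0 + u * t) powr (x - 1) / exp (0 + u * t)) \<partial>lborel)
     = (\<integral>\<^sup>+t. ennreal (u powr (x - 1)) * ?h t \<partial>lborel)"
    by (rule nn_integral_cong)
       (use u in \<open>auto simp: indicator_def powr_mult exp_minus field_simps zero_le_mult_iff simp flip: ennreal_mult\<close>)
  also have "\<dots> = ennreal (u powr (x - 1)) * (\<integral>\<^sup>+t. ?h t \<partial>lborel)"
    by (rule nn_integral_cmult) measurable
  finally have *: "ennreal (Gamma x) = ennreal (u powr x) * (\<integral>\<^sup>+t. ?h t \<partial>lborel)"
    using u by (simp add: mult.assoc[symmetric] ennreal_mult[symmetric] powr_diff)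
  have "ennreal (Gamma x * u powr (- x)) = ennreal (u powr (- x)) * ennreal (Gamma x)"
    using Gamma_real_pos[OF x] by (simp add: mult.commute flip: ennreal_mult)
  also have "\<dots> = ennreal (u powr (- x) * u powr x) * (\<integral>\<^sup>+t. ?h t \<partial>lborel)"
    unfolding * by (simp add: mult.assoc ennreal_mult)
  also have "u powr (- x) * u powr x = 1" using u by (simp add: powr_minus field_simps)
  finally show ?thesis by simp
qed

text \<open>The substitution of \<open>a / s\<close> for the variable of the Gamma integral.
  Integrals of this type arise when a heat kernel is integrated in time against a power.\<close>

lemma Gamma_nn_integral_inverse:
  fixes x a :: real
  assumes x: "x > 0" and a: "a > 0"
  shows "(\<integral>\<^sup>+s. ennreal (indicator {0<..} s * s powr (- x - 1) * exp (- a / s)) \<partial>lborel) = ennreal (Gamma x * a powr (- x))"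
proof -
  let ?g = "\<lambda>s. a / s" and ?g' = "\<lambda>s. - a / s\<^sup>2" and ?f = "\<lambda>t. t powr (x - 1) / exp t"
  have image: "?g ` {0<..} = {0<..}"
  proof (intro set_eqI iffI)
    fix t :: real assume "t \<in> {0<..}"
    then have "t = ?g (a / t)" "a / t \<in> {0<..}" using a by auto
    then show "t \<in> ?g ` {0<..}" by (rule image_eqI)
  qed (use a in auto)
  \<comment> \<open>The Gamma integral runs over the closed half-line, whereas \<open>a / s\<close>
    is a bijection of the open one; the endpoint is negligible.\<close>
  have hi: "(?f has_integral Gamma x) {0<..}"
  proof (subst has_integral_spike_set_eq[of _ "{0..}"])
    have "{s \<in> {0::real..} - {0<..}. P s} \<subseteq> {0}" for P by auto
    then show "negligible {s \<in> {0..} - {0<..}. ?f s \<noteq> 0}"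
      by (rule negligible_subset[OF negligible_sing])
    have "{s \<in> {0<..} - {0::real..}. P s} = {}" for P by auto
    then show "negligible {s \<in> {0<..} - {0..}. ?f s \<noteq> 0}" by (simp only: negligible_empty)
  qed (rule Gamma_integral_real[OF x])
  then have ai: "?f absolutely_integrable_on {0<..}"
    by (intro nonnegative_absolutely_integrable_1) auto
  from hi have "integral {0<..} ?f = Gamma x" by (rule integral_unique)
  with ai have "?f absolutely_integrable_on ?g ` {0<..} \<and> integral (?g ` {0<..}) ?f = Gamma x"
    by (simp add: image)
  then have "(\<lambda>s. \<bar>?g' s\<bar> * ?f (?g s)) absolutely_integrable_on {0<..} \<and> integral {0<..} (\<lambda>s. \<bar>?g' s\<bar> * ?f (?g s)) = Gamma x"
    by (subst has_absolute_integral_change_of_variables_1')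
       (use a in \<open>auto intro!: derivative_eq_intros inj_onI simp: power2_eq_square\<close>)
  then have "((\<lambda>s. \<bar>?g' s\<bar> * ?f (?g s)) has_integral Gamma x) {0<..}"
    using set_lebesgue_integral_eq_integral(1) by (metis integrable_integral)
  from nn_integral_has_integral_lebesgue[OF _ this]
  have *: "(\<integral>\<^sup>+s. ennreal (indicator {0<..} s * (\<bar>?g' s\<bar> * ?f (?g s))) \<partial>lborel) = ennreal (Gamma x)" by simp
  have "(\<integral>\<^sup>+s. ennreal (indicator {0<..} s * s powr (- x - 1) * exp (- a / s)) \<partial>lborel)
     = (\<integral>\<^sup>+s. ennreal (a powr (- x)) * ennreal (indicator {0<..} s * (\<bar>?g' s\<bar> * ?f (?g s))) \<partial>lborel)"
  proof (rule nn_integral_cong)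
    fix s :: real
    have "s powr (- x - 1) * exp (- a / s) = a powr (- x) * (\<bar>?g' s\<bar> * ?f (?g s))" if "s > 0"
    proof -
      have "a powr (-x) * (a * (a / s) powr (x - 1)) = s powr (1 - x)"
        using a that by (simp add: powr_divide powr_diff powr_minus field_simps)
      moreover have "s powr (- x - 1) = s powr (1 - x) / s\<^sup>2"
        using that by (simp add: powr_diff powr_minus power2_eq_square field_simps)
      ultimately show ?thesis using a by (simp add: exp_minus field_simps)
    qed
    then show "ennreal (indicator {0<..} s * s powr (- x - 1) * exp (- a / s))
      = ennreal (a powr (- x)) * ennreal (indicator {0<..} s * (\<bar>?g' s\<bar> * ?f (?g s)))"
      by (cases "s > 0") (simp_all only: mult.assoc ennreal_mult[symmetric] powr_ge_zero, auto simp flip: ennreal_mult)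
  qed
  also have "\<dots> = ennreal (a powr (- x)) * ennreal (Gamma x)"
    by (subst nn_integral_cmult, simp, simp only: *)
  finally show ?thesis using Gamma_real_pos[OF x] by (simp add: mult.commute flip: ennreal_mult)
qed

text \<open>The Levy density of the \<open>\<beta>\<close>-stable subordinator.\<close>

definition sub_weight :: "real \<Rightarrow> real \<Rightarrow> real" where
  "sub_weight \<beta> s = indicator {0<..} s * s powr (- 1 - \<beta>) / \<bar>Gamma (- \<beta>)\<bar>"

lemma sub_weight_measurable[measurable]: "sub_weight \<beta> \<in> borel_measurable borel"
  unfolding sub_weight_def[abs_def] by measurable

lemma sub_weight_nonneg: "0 \<le> sub_weight \<beta> s"
  by (simp add: sub_weight_def)

text \<open>The functional equation at \<open>- \<beta>\<close>, which also shows that the Gamma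
  value is negative there; hence the absolute value in the normalizing constants.\<close>

lemma abs_Gamma_uminus:
  fixes \<beta> :: real
  assumes "0 < \<beta>" "\<beta> < 1"
  shows "\<bar>Gamma (- \<beta>)\<bar> = Gamma (1 - \<beta>) / \<beta>"
proof -
  have "- \<beta> \<notin> \<int>\<^sub>\<le>\<^sub>0"
  proof
    assume "- \<beta> \<in> \<int>\<^sub>\<le>\<^sub>0"
    then have "- \<beta> \<in> \<int>" using nonpos_Ints_subset_Ints by blast
    then obtain n where "- \<beta> = of_int n" by (rule Ints_cases)
    with assms have "- 1 < n" "n < 0" by linarith+
    then show False by linarith
  qed
  then have "Gamma (- \<beta> + 1) = - \<beta> * Gamma (- \<beta>)" by (rule Gamma_plus1)
  moreover have "Gamma (1 - \<beta>) > 0" using assms by (intro Gamma_real_pos) simp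
  ultimately have "Gamma (- \<beta>) = - (Gamma (1 - \<beta>) / \<beta>)" using assms by (simp add: field_simps)
  then show ?thesis using \<open>Gamma (1 - \<beta>) > 0\<close> assms by simp
qed

text \<open>Write \<open>1 - exp (- s * l)\<close> as the integral of
  \<open>s * exp (- u * s)\<close> over u from 0 to l and exchange the integrals. The integral over
  s is then a Gamma integral proportional to \<open>u powr (\<beta> - 1)\<close>, and
  \<open>abs_Gamma_uminus\<close> makes the constant come out as one.\<close>

lemma subordinator_exponent:
  fixes \<beta> l :: real
  assumes \<beta>: "0 < \<beta>" "\<beta> < 1" and l: "l \<ge> 0"
  shows "(\<integral>\<^sup>+s. ennreal (sub_weight \<beta> s * (1 - exp (- s * l))) \<partial>lborel) = ennreal (l powr \<beta>)"
proof -
  define c where "c = \<bar>Gamma (- \<beta>)\<bar>"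
  have c: "c = Gamma (1 - \<beta>) / \<beta>" unfolding c_def by (rule abs_Gamma_uminus[OF \<beta>])
  let ?k = "\<lambda>s u. ennreal (indicator {0..l} u / c * (indicator {0<..} s * s powr (- \<beta>) * exp (- u * s)))"
  have G: "Gamma (1 - \<beta>) > 0" using \<beta> by (intro Gamma_real_pos) simp
  then have cpos: "c > 0" using c \<beta> by simp
  define g where "g = Gamma (1 - \<beta>)"
  have g: "g > 0" and cg: "c = g / \<beta>" using G c by (simp_all only: g_def)
  have inner: "(\<integral>\<^sup>+u. ennreal (indicator {0..l} u * (s * exp (- u * s))) \<partial>lborel) = ennreal (1 - exp (- s * l))" if "s > 0" for s
  proof -
    have "(\<integral>\<^sup>+u. ennreal (s * exp (- u * s)) * indicator {0..l} u \<partial>lborel) = ennreal (- exp (- l * s) - (- exp (- 0 * s)))"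
      by (rule nn_integral_FTC_Icc) (use that l in \<open>auto intro!: derivative_eq_intros\<close>)
    moreover have "(\<integral>\<^sup>+u. ennreal (indicator {0..l} u * (s * exp (- u * s))) \<partial>lborel)
      = (\<integral>\<^sup>+u. ennreal (s * exp (- u * s)) * indicator {0..l} u \<partial>lborel)"
      by (rule nn_integral_cong) (auto simp: indicator_def)
    ultimately show ?thesis by (simp add: mult.commute)
  qed
  have "(\<integral>\<^sup>+s. ennreal (sub_weight \<beta> s * (1 - exp (- s * l))) \<partial>lborel)
    = (\<integral>\<^sup>+s. (\<integral>\<^sup>+u. ?k s u \<partial>lborel) \<partial>lborel)"
  proof (rule nn_integral_cong)
    fix s :: real
    show "ennreal (sub_weight \<beta> s * (1 - exp (- s * l)))
      = (\<integral>\<^sup>+u. ?k s u \<partial>lborel)"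
    proof (cases "s > 0")
      case True
      have "(\<integral>\<^sup>+u. ?k s u \<partial>lborel)
        = (\<integral>\<^sup>+u. ennreal (s powr (- 1 - \<beta>) / c) * ennreal (indicator {0..l} u * (s * exp (- u * s))) \<partial>lborel)"
        using True cpos by (intro nn_integral_cong) (auto simp: indicator_def powr_diff powr_minus field_simps simp flip: ennreal_mult)
      also have "\<dots> = ennreal (s powr (- 1 - \<beta>) / c) * ennreal (1 - exp (- s * l))"
        by (subst nn_integral_cmult, simp, simp only: inner[OF True])
      finally show ?thesis using True cpos l by (simp add: sub_weight_def c_def flip: ennreal_mult)
    qed (simp add: sub_weight_def)
  qed
  also have "\<dots> = (\<integral>\<^sup>+u. (\<integral>\<^sup>+s. ?k s u \<partial>lborel) \<partial>lborel)"
    by (rule lborel_pair.Fubini') measurable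
  also have "\<dots> = (\<integral>\<^sup>+u. ennreal (\<beta> * (indicator {0..l} u * u powr (\<beta> - 1))) \<partial>lborel)"
  proof (rule nn_integral_cong_AE)
    have "AE u in lborel. u \<noteq> (0::real)" by (rule AE_lborel_singleton)
    then show "AE u in lborel. (\<integral>\<^sup>+s. ?k s u \<partial>lborel)
       = ennreal (\<beta> * (indicator {0..l} u * u powr (\<beta> - 1)))"
    proof eventually_elim
      fix u :: real assume "u \<noteq> 0"
      show "(\<integral>\<^sup>+s. ?k s u \<partial>lborel)
       = ennreal (\<beta> * (indicator {0..l} u * u powr (\<beta> - 1)))"
      proof (cases "u \<in> {0..l}")
        case True
        then have u: "u > 0" using \<open>u \<noteq> 0\<close> by auto
        have "(\<integral>\<^sup>+s. ?k s u \<partial>lborel)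
          = (\<integral>\<^sup>+s. ennreal (1 / c) * ennreal (indicator {0<..} s * s powr ((1 - \<beta>) - 1) * exp (- u * s)) \<partial>lborel)"
          using True cpos by (intro nn_integral_cong) (simp flip: ennreal_mult)
        also have "\<dots> = ennreal (1 / c) * ennreal (Gamma (1 - \<beta>) * u powr (- (1 - \<beta>)))"
          by (subst nn_integral_cmult, simp, subst Gamma_nn_integral_scaled) (use \<beta> u in auto)
        also have "\<dots> = ennreal (\<beta> * u powr (\<beta> - 1))"
          using cpos cg g \<beta> unfolding g_def[symmetric] by (simp flip: ennreal_mult)
        finally show ?thesis using True by simp
      qed simp
    qed
  qed
  also have "\<dots> = ennreal \<beta> * (\<integral>\<^sup>+u. ennreal (indicator {0..l} u * u powr (\<beta> - 1)) \<partial>lborel)"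
    using \<beta> by (subst nn_integral_cmult[symmetric]) (auto simp: ennreal_mult')
  also have "(\<integral>\<^sup>+u. ennreal (indicator {0..l} u * u powr (\<beta> - 1)) \<partial>lborel) = ennreal (l powr \<beta> / \<beta>)"
    using nn_integral_has_integral_lebesgue[OF _ has_integral_powr_from_0[of "\<beta> - 1" l]] \<beta> l by simp
  finally show ?thesis using \<beta> by (simp flip: ennreal_mult)
qed

text \<open>Variance \<open>2 * s\<close> in each coordinate: the semigroup of the Laplacian without
  the probabilistic factor 1/2, so that \<open>(norm \<xi>)\<^sup>2\<close> subordinates to exactly
  \<open>norm \<xi> powr \<alpha>\<close>.\<close>

definition heat_kernel :: "real \<Rightarrow> 'a::euclidean_space \<Rightarrow> real" where
  "heat_kernel s z = exp (- (norm z)\<^sup>2 / (4 * s)) / sqrt (4 * pi * s) ^ DIM('a)"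

lemma heat_kernel_measurable[measurable]: "(\<lambda>(s, z::'a::euclidean_space). heat_kernel s z) \<in> borel_measurable (borel \<Otimes>\<^sub>M borel)"
  unfolding heat_kernel_def by measurable

lemma heat_kernel_pos: "0 < s \<Longrightarrow> 0 < heat_kernel s z"
  by (simp add: heat_kernel_def)

lemma heat_kernel_fourier:
  fixes \<xi> :: "'a::euclidean_space"
  assumes s: "s > 0"
  shows "integrable lborel (heat_kernel s :: 'a \<Rightarrow> real)" and "cos_transform (heat_kernel s) \<xi> = exp (- s * (norm \<xi>)\<^sup>2)"
proof -
  have s': "1 / (4 * s) > 0" using s by simp
  have eq: "heat_kernel s = (\<lambda>z::'a. exp (- (1 / (4 * s)) * (norm z)\<^sup>2) / sqrt (4 * pi * s) ^ DIM('a))"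
    by (simp add: heat_kernel_def fun_eq_iff)
  show "integrable lborel (heat_kernel s :: 'a \<Rightarrow> real)"
    unfolding eq by (intro integrable_divide gaussian_fourier(1)[OF s'])
  have "cos_transform (heat_kernel s) \<xi> = (\<integral>z. exp (- (1 / (4 * s)) * (norm z)\<^sup>2) * cos (z \<bullet> \<xi>) \<partial>lborel) / sqrt (4 * pi * s) ^ DIM('a)"
    unfolding eq cos_transform_def by (simp add: inner_commute)
  also have "\<dots> = exp (- s * (norm \<xi>)\<^sup>2)"
    using s by (subst gaussian_fourier(2)[OF s']) (simp add: mult_ac)
  finally show "cos_transform (heat_kernel s) \<xi> = exp (- s * (norm \<xi>)\<^sup>2)" .
qed

definition levy_density :: "real \<Rightarrow> 'a::euclidean_space \<Rightarrow> real" where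
  "levy_density \<alpha> z = frac_const DIM('a) \<alpha> / norm z powr (real DIM('a) + \<alpha>)"

text \<open>Subordination exhibits the jump kernel of the fractional energy as a mixture of heat kernels.\<close>

lemma levy_density_mixture:
  fixes z :: "'a::euclidean_space"
  assumes \<alpha>: "0 < \<alpha>" and z: "z \<noteq> 0"
  shows "(\<integral>\<^sup>+s. ennreal (sub_weight (\<alpha> / 2) s * heat_kernel s z) \<partial>lborel) = ennreal (levy_density \<alpha> z)"
proof -
  define d where "d = real DIM('a)"
  \<comment> \<open>The exponents of s add up: \<open>- 1 - \<alpha> / 2\<close> from the
    subordinator and \<open>- d / 2\<close> from the heat kernel give \<open>- x - 1\<close>. The
    constant \<open>a\<close> is read off from the Gaussian exponent.\<close>
  define x where "x = (d + \<alpha>) / 2"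
  define a where "a = (norm z)\<^sup>2 / 4"
  define c where "c = \<bar>Gamma (- (\<alpha> / 2))\<bar>"
  have d: "d > 0" by (simp add: d_def)
  have x: "x > 0" using d \<alpha> by (simp add: x_def)
  have a: "a > 0" using z by (simp add: a_def)
  have c0: "c \<ge> 0" by (simp add: c_def)
  have sq: "sqrt t ^ DIM('a) = t powr (d / 2)" if "t > 0" for t :: real
    using that by (simp add: powr_half_sqrt[symmetric] powr_realpow[symmetric] powr_powr d_def)
  have "(\<integral>\<^sup>+s. ennreal (sub_weight (\<alpha> / 2) s * heat_kernel s z) \<partial>lborel)
    = (\<integral>\<^sup>+s. ennreal (1 / (c * (4 * pi) powr (d / 2))) * ennreal (indicator {0<..} s * s powr (- x - 1) * exp (- a / s)) \<partial>lborel)"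
  proof (rule nn_integral_cong)
    fix s :: real
    show "ennreal (sub_weight (\<alpha> / 2) s * heat_kernel s z)
      = ennreal (1 / (c * (4 * pi) powr (d / 2))) * ennreal (indicator {0<..} s * s powr (- x - 1) * exp (- a / s))"
    proof (cases "s > 0")
      case True
      have ratio: "A / B = C / D \<Longrightarrow> A / c * (e / B) = 1 / (c * D) * (C * e)" for A B C D e :: real
      proof -
        assume "A / B = C / D"
        then have "A / B * (e / c) = C / D * (e / c)" by simp
        then show ?thesis by (simp add: mult_ac)
      qed
      have "s powr (- 1 - \<alpha> / 2) / (4 * pi * s) powr (d / 2) = s powr (- x - 1) / (4 * pi) powr (d / 2)"
      proof -
        have "s powr (- 1 - \<alpha> / 2) = s powr (- x - 1) * s powr (d / 2)"
          unfolding powr_add[symmetric] by (rule arg_cong[where f="(powr) s"]) (simp add: x_def field_simps)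
        then show ?thesis using True by (simp add: powr_mult)
      qed
      then have "s powr (- 1 - \<alpha> / 2) / c * (exp (- a / s) / (4 * pi * s) powr (d / 2))
        = 1 / (c * (4 * pi) powr (d / 2)) * (s powr (- x - 1) * exp (- a / s))"
        using ratio[of "s powr (- 1 - \<alpha> / 2)"] by blast
      moreover have "heat_kernel s z = exp (- a / s) / (4 * pi * s) powr (d / 2)"
        using True by (simp add: heat_kernel_def sq a_def)
      moreover have "sub_weight (\<alpha> / 2) s = s powr (- 1 - \<alpha> / 2) / c"
        using True by (simp add: sub_weight_def c_def)
      ultimately show ?thesis using True c0 by (simp add: mult.assoc flip: ennreal_mult)
    qed (simp add: sub_weight_def)
  qed
  also have "\<dots> = ennreal (1 / (c * (4 * pi) powr (d / 2))) * ennreal (Gamma x * a powr (- x))"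
    by (subst nn_integral_cmult, simp, subst Gamma_nn_integral_inverse[OF x a]) simp
  also have "\<dots> = ennreal (1 / (c * (4 * pi) powr (d / 2)) * (Gamma x * a powr (- x)))"
    using c0 Gamma_real_pos[OF x] by (simp flip: ennreal_mult)
  also have "1 / (c * (4 * pi) powr (d / 2)) * (Gamma x * a powr (- x)) = levy_density \<alpha> z"
  proof -
    have n: "norm z > 0" using z by simp
    have "a = (norm z / 2) powr 2" using n by (simp add: a_def power_divide)
    then have "a powr (- x) = (norm z / 2) powr (2 * (- x))" by (simp only: powr_powr)
    also have "2 * (- x) = - (d + \<alpha>)" by (simp add: x_def field_simps)
    also have "(norm z / 2) powr (- (d + \<alpha>)) = 2 powr (d + \<alpha>) / norm z powr (d + \<alpha>)"
      unfolding powr_minus using n by (simp add: powr_divide)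
    finally have a': "a powr (- x) = 2 powr (d + \<alpha>) / norm z powr (d + \<alpha>)" .
    \<comment> \<open>The factor \<open>2 powr d\<close> cancels against
      \<open>2 powr (d + \<alpha>)\<close> from \<open>a'\<close>, leaving the
      \<open>2 powr \<alpha>\<close> of \<open>frac_const\<close>.\<close>
    have "(4 * pi) powr (d / 2) = 2 powr d * pi powr (d / 2)"
    proof -
      have "(4::real) powr (d / 2) = (2 powr 2) powr (d / 2)" by simp
      also have "\<dots> = 2 powr d" by (simp only: powr_powr) simp
      finally show ?thesis by (simp add: powr_mult)
    qed
    then show ?thesis
      unfolding a' by (simp add: levy_density_def frac_const_def powr_add c_def d_def[symmetric] x_def mult_ac)
  qed
  finally show ?thesis .
qed

section \<open>Integrability of the stable symbol\<close>

text \<open>A single term of the exponential series of order \<open>m\<close>, with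
  \<open>\<alpha> * m\<close> at least 2, already forces quadratic decay, which is compared with the
  Cauchy density.\<close>

lemma integrable_exp_abs_powr:
  fixes c \<alpha> :: real
  assumes c: "c > 0" and \<alpha>: "\<alpha> > 0"
  shows "integrable lborel (\<lambda>x::real. exp (- c * \<bar>x\<bar> powr \<alpha>))"
proof -
  obtain m :: nat where m: "2 / \<alpha> \<le> real m" using real_arch_simple by blast
  have m2: "2 \<le> \<alpha> * real m" using m \<alpha> by (simp add: field_simps)
  \<comment> \<open>The summand 2 covers \<open>|x| \<le> 1\<close>, where
    \<open>1 + x\<^sup>2\<close> is at most 2. The other one covers \<open>|x| > 1\<close>, where
    \<open>1 + x\<^sup>2\<close> is at most \<open>2 * x\<^sup>2\<close>.\<close>
  define M where "M = 2 + 2 * fact m / c ^ m"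
  have i: "integrable lborel (\<lambda>x::real. M * inverse (1 + x\<^sup>2))"
    using integrable_inverse_1_plus_square by (simp add: set_integrable_def)
  show ?thesis
  proof (rule Bochner_Integration.integrable_bound[OF i])
    have "exp (- c * \<bar>x\<bar> powr \<alpha>) \<le> M * inverse (1 + x\<^sup>2)" for x :: real
    proof (cases "\<bar>x\<bar> \<le> 1")
      case True
      then have "1 + x\<^sup>2 \<le> 2" by (simp add: abs_square_le_1)
      moreover have "M \<ge> 2" using c by (simp add: M_def)
      ultimately have "1 \<le> M * inverse (1 + x\<^sup>2)"
        by (simp add: pos_le_divide_eq add_pos_nonneg divide_inverse[symmetric])
      moreover have "exp (- c * \<bar>x\<bar> powr \<alpha>) \<le> 1" using c by simp
      ultimately show ?thesis by linarith
    next
      case False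
      define u where "u = c * \<bar>x\<bar> powr \<alpha>"
      have u: "u > 0" using False c by (simp add: u_def)
      have "u ^ m / fact m \<le> (\<Sum>n\<in>{m}. u ^ n /\<^sub>R fact n)" by (simp add: divide_inverse mult.commute)
      also have "\<dots> \<le> exp u"
        unfolding exp_def by (rule sum_le_suminf[OF summable_exp_generic]) (use u in auto)
      finally have "u ^ m / fact m \<le> exp u" .
      then have 1: "exp (- u) \<le> fact m / u ^ m" using u by (simp add: exp_minus field_simps)
      have "x\<^sup>2 = \<bar>x\<bar> powr 2" using False by simp
      also have "\<dots> \<le> \<bar>x\<bar> powr (\<alpha> * real m)" using False m2 by (intro powr_mono) auto
      also have "\<dots> = (\<bar>x\<bar> powr \<alpha>) ^ m" using False by (simp add: powr_powr[symmetric] powr_realpow)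
      finally have 2: "c ^ m * x\<^sup>2 \<le> u ^ m" using c by (simp add: u_def power_mult_distrib)
      have x1: "1 \<le> x\<^sup>2" using False one_le_power[of "\<bar>x\<bar>" 2] by simp
      have "fact m / u ^ m \<le> fact m / (c ^ m * x\<^sup>2)" using 2 c x1 u
        by (intro divide_left_mono mult_pos_pos) (auto intro: less_le_trans[OF zero_less_one])
      also have "\<dots> = fact m / c ^ m * inverse (x\<^sup>2)" by (simp add: field_simps)
      also have "\<dots> \<le> fact m / c ^ m * (2 * inverse (1 + x\<^sup>2))"
      proof (rule mult_left_mono)
        have "inverse (2 * x\<^sup>2) \<le> inverse (1 + x\<^sup>2)"
          using x1 by (intro le_imp_inverse_le) (linarith, simp add: add_pos_nonneg)
        then show "inverse (x\<^sup>2) \<le> 2 * inverse (1 + x\<^sup>2)" by simp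
      qed (use c in simp)
      also have "\<dots> \<le> M * inverse (1 + x\<^sup>2)"
      proof -
        have "2 * fact m / c ^ m * inverse (1 + x\<^sup>2) \<le> M * inverse (1 + x\<^sup>2)"
          unfolding M_def by (intro mult_right_mono) (simp_all add: add_nonneg_nonneg)
        then show ?thesis by (simp add: mult_ac)
      qed
      finally show ?thesis using 1 by (simp add: u_def)
    qed
    moreover have "M \<ge> 0" using c by (simp add: M_def)
    ultimately show "AE x in lborel. norm (exp (- c * \<bar>x\<bar> powr \<alpha>)) \<le> norm (M * inverse (1 + x\<^sup>2))"
      by (auto simp: abs_mult add_nonneg_pos)
  qed measurable
qed

text \<open>No coordinate exceeds the norm, so splitting t evenly among the coordinates bounds the
  exponential by a product of one-dimensional ones.\<close>

lemma integrable_exp_norm_powr: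
  fixes t \<alpha> :: real
  assumes t: "t > 0" and \<alpha>: "\<alpha> > 0"
  shows "integrable lborel (\<lambda>\<xi>::'a::euclidean_space. exp (- t * norm \<xi> powr \<alpha>))"
proof -
  define c where "c = t / real DIM('a)"
  have c: "c > 0" using t by (simp add: c_def)
  have i: "integrable lborel (\<lambda>\<xi>::'a. \<Prod>b\<in>Basis. exp (- c * \<bar>\<xi> \<bullet> b\<bar> powr \<alpha>))"
    by (rule lborel_integral_prod_Basis(1)) (rule integrable_exp_abs_powr[OF c \<alpha>])
  show ?thesis
  proof (rule Bochner_Integration.integrable_bound[OF i])
    have "exp (- t * norm \<xi> powr \<alpha>) \<le> (\<Prod>b\<in>Basis. exp (- c * \<bar>\<xi> \<bullet> b\<bar> powr \<alpha>))" for \<xi> :: 'a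
    proof -
      have "(\<Sum>b\<in>Basis. c * \<bar>\<xi> \<bullet> b\<bar> powr \<alpha>) \<le> (\<Sum>b\<in>(Basis::'a set). c * norm \<xi> powr \<alpha>)"
        using c \<alpha> by (intro sum_mono mult_left_mono powr_mono2) (auto simp: Basis_le_norm)
      also have "\<dots> = t * norm \<xi> powr \<alpha>" by (simp add: c_def)
      finally show ?thesis by (simp add: exp_sum[symmetric] sum_negf)
    qed
    then show "AE \<xi> in lborel. norm (exp (- t * norm (\<xi>::'a) powr \<alpha>)) \<le> norm (\<Prod>b\<in>Basis. exp (- c * \<bar>\<xi> \<bullet> b\<bar> powr \<alpha>))"
      by (auto simp: prod_nonneg)
  qed measurable
qed

lemma tail_integral_LIMSEQ:
  fixes f :: "real \<Rightarrow> real" and \<delta> :: "nat \<Rightarrow> real"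
  assumes f: "integrable lborel f" and pos: "\<And>n. \<delta> n > 0" and lim: "\<delta> \<longlonglongrightarrow> 0"
  shows "(\<lambda>n. \<integral>s. indicator {\<delta> n<..} s * f s \<partial>lborel) \<longlonglongrightarrow> (\<integral>s. indicator {0<..} s * f s \<partial>lborel)"
proof (rule integral_dominated_convergence[where w="\<lambda>s. \<bar>f s\<bar>"])
  have [measurable]: "f \<in> borel_measurable borel" using f by auto
  show "(\<lambda>s. indicator {0<..} s * f s) \<in> borel_measurable lborel"
    "(\<lambda>s. indicator {\<delta> n<..} s * f s) \<in> borel_measurable lborel" for n by measurable
  have "(\<lambda>n. indicator {\<delta> n<..} s * f s) \<longlonglongrightarrow> indicator {0<..} s * f s" for s
  proof (cases "s > 0")
    case True
    then have "eventually (\<lambda>n. \<delta> n < s) sequentially" using lim by (intro order_tendstoD) auto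
    then have "eventually (\<lambda>n. indicator {\<delta> n<..} s * f s = indicator {0<..} s * f s) sequentially"
      by eventually_elim (use True in simp)
    then show ?thesis by (rule tendsto_eventually)
  next
    case False
    then have "indicator {\<delta> n<..} s = (0::real)" for n using pos[of n] by simp
    then show ?thesis using False by simp
  qed
  then show "AE s in lborel. (\<lambda>n. indicator {\<delta> n<..} s * f s) \<longlonglongrightarrow> indicator {0<..} s * f s" by simp
qed (use f in \<open>auto simp: indicator_def\<close>)

section \<open>The Levy measure truncated in subordination time\<close>

text \<open>The singularity of the Levy measure at the origin comes from short subordination times.
  Discarding those below \<delta> makes the mass finite and keeps the jump density a mixture of heat
  kernels.\<close>

definition trunc_weight :: "real \<Rightarrow> real \<Rightarrow> real \<Rightarrow> real" where
  "trunc_weight \<alpha> \<delta> s = indicator {\<delta><..} s * sub_weight (\<alpha> / 2) s"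

definition trunc_levy :: "real \<Rightarrow> real \<Rightarrow> 'a::euclidean_space \<Rightarrow> real" where
  "trunc_levy \<alpha> \<delta> z = (\<integral>s. trunc_weight \<alpha> \<delta> s * heat_kernel s z \<partial>lborel)"

text \<open>For \<delta> > 0 and 0 < \<alpha> < 2 the first integral is also the mass of
  \<open>trunc_levy\<close>, so this is the integral of \<open>1 - cos (\<xi> \<bullet> z)\<close>
  against it: the exponent of a compound Poisson process.\<close>

definition trunc_exponent :: "real \<Rightarrow> real \<Rightarrow> 'a::euclidean_space \<Rightarrow> real" where
  "trunc_exponent \<alpha> \<delta> \<xi> = (\<integral>s. trunc_weight \<alpha> \<delta> s \<partial>lborel) - cos_transform (trunc_levy \<alpha> \<delta>) \<xi>"

definition stable_symbol :: "real \<Rightarrow> real \<Rightarrow> 'a::euclidean_space \<Rightarrow> real" where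
  "stable_symbol \<alpha> t \<xi> = exp (- t * norm \<xi> powr \<alpha>)"

text \<open>The stable symbol with the jumps of \<open>trunc_levy \<alpha> \<delta>\<close> removed.\<close>

definition remainder_symbol :: "real \<Rightarrow> real \<Rightarrow> real \<Rightarrow> 'a::euclidean_space \<Rightarrow> real" where
  "remainder_symbol \<alpha> \<delta> t \<xi> = exp (- t * (norm \<xi> powr \<alpha> - trunc_exponent \<alpha> \<delta> \<xi>))"

definition remainder_density :: "real \<Rightarrow> real \<Rightarrow> real \<Rightarrow> 'a::euclidean_space \<Rightarrow> real" where
  "remainder_density \<alpha> \<delta> t = inv_fourier (remainder_symbol \<alpha> \<delta> t)"

lemma trunc_weight_measurable[measurable]: "trunc_weight \<alpha> \<delta> \<in> borel_measurable borel"
  unfolding trunc_weight_def[abs_def] by measurable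

lemma trunc_weight_nonneg: "0 \<le> trunc_weight \<alpha> \<delta> s"
  by (simp add: trunc_weight_def sub_weight_nonneg)

lemma trunc_levy_measurable[measurable]:
  "(trunc_levy \<alpha> \<delta> :: 'a::euclidean_space \<Rightarrow> real) \<in> borel_measurable borel"
  unfolding trunc_levy_def[abs_def] by measurable

lemma trunc_levy_minus[simp]: "trunc_levy \<alpha> \<delta> (- z) = trunc_levy \<alpha> \<delta> z"
  by (simp add: trunc_levy_def heat_kernel_def)

lemma trunc_mixture_nonneg: "\<delta> > 0 \<Longrightarrow> 0 \<le> trunc_weight \<alpha> \<delta> s * heat_kernel s z"
  using heat_kernel_pos[of s z] trunc_weight_nonneg[of \<alpha> \<delta> s]
  by (cases "s > 0") (auto simp: trunc_weight_def sub_weight_def)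

lemma trunc_levy_nonneg: "\<delta> > 0 \<Longrightarrow> 0 \<le> trunc_levy \<alpha> \<delta> z"
  unfolding trunc_levy_def by (intro Bochner_Integration.integral_nonneg trunc_mixture_nonneg)

locale stable_index =
  fixes \<alpha> :: real
  assumes \<alpha>_pos: "0 < \<alpha>" and \<alpha>_less: "\<alpha> < 2"
begin

lemma weight_exponent:
  fixes l :: real
  assumes l: "l \<ge> 0"
  shows "integrable lborel (\<lambda>s. sub_weight (\<alpha> / 2) s * (1 - exp (- s * l)))"
    and "(\<integral>s. indicator {0<..} s * (sub_weight (\<alpha> / 2) s * (1 - exp (- s * l))) \<partial>lborel) = l powr (\<alpha> / 2)"
proof -
  let ?f = "\<lambda>s. sub_weight (\<alpha> / 2) s * (1 - exp (- s * l))"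
  have nonneg: "0 \<le> ?f s" for s
    using l by (cases "s > 0") (auto simp: sub_weight_def)
  have "has_bochner_integral lborel (\<lambda>s. ?f s) (l powr (\<alpha> / 2))"
    by (rule has_bochner_integral_nn_integral)
       (use nonneg subordinator_exponent[of "\<alpha> / 2" l] l \<alpha>_pos \<alpha>_less in auto)
  then show "integrable lborel (\<lambda>s. ?f s)"
    and "(\<integral>s. indicator {0<..} s * (?f s) \<partial>lborel) = l powr (\<alpha> / 2)"
    by (auto simp: has_bochner_integral_iff sub_weight_def indicator_def
        intro!: Bochner_Integration.integral_cong elim!: trans[rotated])
qed

context
  fixes \<delta> :: real
  assumes \<delta>: "\<delta> > 0"
begin

text \<open>Beyond \<delta> the factor \<open>1 - exp (- s)\<close> is at least
  \<open>1 - exp (- \<delta>)\<close>, so the finite exponent at \<open>l = 1\<close> controls the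
  mass.\<close>

lemma trunc_weight_integrable: "integrable lborel (trunc_weight \<alpha> \<delta>)"
proof -
  let ?f = "\<lambda>s. sub_weight (\<alpha> / 2) s * (1 - exp (- s * 1))"
  define c where "c = 1 - exp (- \<delta>)"
  have c: "c > 0" using \<delta> by (simp add: c_def)
  have "integrable lborel (\<lambda>s. ?f s / c)"
    by (intro integrable_divide weight_exponent) simp
  then show ?thesis
  proof (rule Bochner_Integration.integrable_bound)
    have "trunc_weight \<alpha> \<delta> s \<le> ?f s / c" for s
    proof (cases "s > \<delta>")
      case True
      then have "sub_weight (\<alpha> / 2) s * c \<le> ?f s"
        by (intro mult_left_mono sub_weight_nonneg) (simp add: c_def)
      then show ?thesis using True c by (simp add: trunc_weight_def field_simps)
    next
      case False
      have "0 \<le> ?f s"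
        by (cases "s > 0") (auto simp: sub_weight_def)
      with False c show ?thesis by (simp add: trunc_weight_def)
    qed
    then show "AE s in lborel. norm (trunc_weight \<alpha> \<delta> s) \<le> norm (?f s / c)"
      using trunc_weight_nonneg by (intro AE_I2) (smt (verit) real_norm_def)
  qed simp
qed

lemma trunc_mixture_integrable:
  fixes z :: "'a::euclidean_space"
  shows "integrable lborel (\<lambda>s. trunc_weight \<alpha> \<delta> s * heat_kernel s z)"
proof -
  have "integrable lborel (\<lambda>s. trunc_weight \<alpha> \<delta> s * (indicator {\<delta><..} s * heat_kernel s z))"
  proof (rule integrable_mult_bounded[OF trunc_weight_integrable])
    show "\<bar>indicator {\<delta><..} s * heat_kernel s z\<bar> \<le> 1 / sqrt (4 * pi * \<delta>) ^ DIM('a)" for s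
    proof (cases "s > \<delta>")
      case True
      have "exp (- (norm z)\<^sup>2 / (4 * s)) / sqrt (4 * pi * s) ^ DIM('a) \<le> 1 / sqrt (4 * pi * \<delta>) ^ DIM('a)"
        using True \<delta> by (intro frac_le power_mono) (auto)
      then show ?thesis using True \<delta> by (simp add: heat_kernel_def)
    qed (use \<delta> in simp)
  qed simp
  moreover have "trunc_weight \<alpha> \<delta> s * (indicator {\<delta><..} s * heat_kernel s z) = trunc_weight \<alpha> \<delta> s * heat_kernel s z" for s
    by (simp add: trunc_weight_def indicator_def)
  ultimately show ?thesis by simp
qed

lemma trunc_mixture_pair_integrable:
  "integrable (lborel \<Otimes>\<^sub>M lborel) (\<lambda>(s, z::'a::euclidean_space). trunc_weight \<alpha> \<delta> s * heat_kernel s z)"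
proof (rule lborel_pair.Fubini_integrable)
  have hi: "integrable lborel (\<lambda>z::'a. trunc_weight \<alpha> \<delta> s * heat_kernel s z)" for s
    using heat_kernel_fourier(1)[of s] \<delta>
    by (cases "s > 0") (auto simp: trunc_weight_def sub_weight_def)
  have "(\<integral>z. norm (trunc_weight \<alpha> \<delta> s * heat_kernel s (z::'a)) \<partial>lborel) = trunc_weight \<alpha> \<delta> s" for s
  proof (cases "s > 0")
    case True
    have "(\<integral>z. norm (trunc_weight \<alpha> \<delta> s * heat_kernel s (z::'a)) \<partial>lborel)
      = trunc_weight \<alpha> \<delta> s * cos_transform (heat_kernel s) (0::'a)"
      by (simp add: cos_transform_def abs_of_nonneg[OF trunc_mixture_nonneg[OF \<delta>]])
    with heat_kernel_fourier(2)[OF True, of "0::'a"] show ?thesis by simp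
  qed (simp add: trunc_weight_def sub_weight_def)
  then show "integrable lborel (\<lambda>x. \<integral>y. norm (case (x, y) of (s, z::'a) \<Rightarrow> trunc_weight \<alpha> \<delta> s * heat_kernel s z) \<partial>lborel)"
    using trunc_weight_integrable by simp
  show "AE x in lborel. integrable lborel (\<lambda>y. case (x, y) of (s, z::'a) \<Rightarrow> trunc_weight \<alpha> \<delta> s * heat_kernel s z)"
    using hi by simp
qed measurable

lemma trunc_levy_integrable: "integrable lborel (trunc_levy \<alpha> \<delta> :: 'a::euclidean_space \<Rightarrow> real)"
proof -
  have "integrable lborel (\<lambda>z::'a. \<integral>s. trunc_weight \<alpha> \<delta> s * heat_kernel s z \<partial>lborel)"
    by (rule lborel_pair.integrable_snd[OF trunc_mixture_pair_integrable])
  then show ?thesis by (simp add: trunc_levy_def[abs_def])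
qed

lemma trunc_levy_cos_transform:
  fixes \<xi> :: "'a::euclidean_space"
  shows "cos_transform (trunc_levy \<alpha> \<delta>) \<xi> = (\<integral>s. trunc_weight \<alpha> \<delta> s * exp (- s * (norm \<xi>)\<^sup>2) \<partial>lborel)"
proof -
  have i: "integrable (lborel \<Otimes>\<^sub>M lborel) (\<lambda>(s, z). trunc_weight \<alpha> \<delta> s * heat_kernel s z * cos (\<xi> \<bullet> z))"
  proof (rule Bochner_Integration.integrable_bound[OF trunc_mixture_pair_integrable])
    have "\<bar>x * cos c\<bar> \<le> \<bar>x\<bar>" for x c :: real by (simp add: abs_mult mult_left_le)
    then show "AE x in lborel \<Otimes>\<^sub>M lborel. norm (case x of (s, z) \<Rightarrow> trunc_weight \<alpha> \<delta> s * heat_kernel s z * cos (\<xi> \<bullet> z))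
        \<le> norm (case x of (s, z) \<Rightarrow> trunc_weight \<alpha> \<delta> s * heat_kernel s z)"
      by auto
  qed measurable
  have "cos_transform (trunc_levy \<alpha> \<delta>) \<xi> = (\<integral>z. (\<integral>s. trunc_weight \<alpha> \<delta> s * heat_kernel s z * cos (\<xi> \<bullet> z) \<partial>lborel) \<partial>lborel)"
    by (simp add: cos_transform_def trunc_levy_def)
  also have "\<dots> = (\<integral>s. (\<integral>z. trunc_weight \<alpha> \<delta> s * heat_kernel s z * cos (\<xi> \<bullet> z) \<partial>lborel) \<partial>lborel)"
    by (rule lborel_pair.Fubini_integral[OF i])
  also have "\<dots> = (\<integral>s. trunc_weight \<alpha> \<delta> s * exp (- s * (norm \<xi>)\<^sup>2) \<partial>lborel)"
  proof (rule Bochner_Integration.integral_cong)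
    fix s :: real
    have "(\<integral>z. trunc_weight \<alpha> \<delta> s * heat_kernel s z * cos (\<xi> \<bullet> z) \<partial>lborel)
      = trunc_weight \<alpha> \<delta> s * cos_transform (heat_kernel s) \<xi>"
      by (simp add: cos_transform_def mult.assoc)
    also have "\<dots> = trunc_weight \<alpha> \<delta> s * exp (- s * (norm \<xi>)\<^sup>2)"
      using heat_kernel_fourier(2)[of s \<xi>] by (cases "s > 0") (auto simp: trunc_weight_def sub_weight_def)
    finally show "(\<integral>z. trunc_weight \<alpha> \<delta> s * heat_kernel s z * cos (\<xi> \<bullet> z) \<partial>lborel) = \<dots>" .
  qed simp
  finally show ?thesis .
qed

lemma trunc_levy_mass:
  "integral\<^sup>L lborel (trunc_levy \<alpha> \<delta> :: 'a::euclidean_space \<Rightarrow> real) = (\<integral>s. trunc_weight \<alpha> \<delta> s \<partial>lborel)"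
  using trunc_levy_cos_transform[of "0::'a"] by (simp add: cos_transform_def)

text \<open>Strict positivity everywhere is what later makes stable densities strictly
  positive.\<close>

lemma trunc_levy_pos: "0 < trunc_levy \<alpha> \<delta> (z::'a::euclidean_space)"
proof -
  have "trunc_levy \<alpha> \<delta> z \<noteq> 0"
  proof
    assume "trunc_levy \<alpha> \<delta> z = 0"
    then have "AE s in lborel. trunc_weight \<alpha> \<delta> s * heat_kernel s z = 0"
      unfolding trunc_levy_def
      by (subst (asm) integral_nonneg_eq_0_iff_AE[OF trunc_mixture_integrable])
         (auto intro!: trunc_mixture_nonneg \<delta>)
    \<comment> \<open>\<open>sub_weight\<close> divides by this Gamma value; were it zero, the
      convention for division would make the whole weight vanish.\<close>
    moreover have "Gamma (1 - \<alpha> / 2) / (\<alpha> / 2) > 0"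
      using \<alpha>_pos \<alpha>_less by (intro divide_pos_pos Gamma_real_pos) auto
    then have "\<bar>Gamma (- (\<alpha> / 2))\<bar> > 0" using \<alpha>_pos \<alpha>_less by (subst abs_Gamma_uminus) auto
    then have "trunc_weight \<alpha> \<delta> s * heat_kernel s z \<noteq> 0" if "s > \<delta>" for s
      using that \<delta> heat_kernel_pos[of s z]
      by (auto simp: trunc_weight_def sub_weight_def)
    ultimately have "AE s in lborel. s \<notin> {\<delta><..\<delta> + 1}" by (auto elim!: eventually_mono)
    then have "emeasure lborel {\<delta><..\<delta> + 1} = 0" by (subst (asm) AE_iff_measurable[of "{\<delta><..\<delta> + 1}"]) auto
    then show False by simp
  qed
  with trunc_levy_nonneg[OF \<delta>, of \<alpha> z] show ?thesis by simp
qed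

lemma trunc_exponent_eq:
  fixes \<xi> :: "'a::euclidean_space"
  shows "trunc_exponent \<alpha> \<delta> \<xi> = (\<integral>s. indicator {\<delta><..} s * (sub_weight (\<alpha> / 2) s * (1 - exp (- s * (norm \<xi>)\<^sup>2))) \<partial>lborel)"
proof -
  have "integrable lborel (\<lambda>s. trunc_weight \<alpha> \<delta> s * (indicator {0<..} s * exp (- s * (norm \<xi>)\<^sup>2)))"
    by (rule integrable_mult_bounded[OF trunc_weight_integrable, where B=1]) (auto simp: indicator_def)
  also have "(\<lambda>s. trunc_weight \<alpha> \<delta> s * (indicator {0<..} s * exp (- s * (norm \<xi>)\<^sup>2))) = (\<lambda>s. trunc_weight \<alpha> \<delta> s * exp (- s * (norm \<xi>)\<^sup>2))"
    by (auto simp: trunc_weight_def sub_weight_def indicator_def fun_eq_iff)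
  finally show ?thesis
    unfolding trunc_exponent_def trunc_levy_cos_transform
    by (subst Bochner_Integration.integral_diff[symmetric])
       (auto simp: trunc_weight_integrable trunc_weight_def algebra_simps intro!: Bochner_Integration.integral_cong)
qed

text \<open>A mixture of Gaussians has a nonnegative transform. Consequently taking out the
  truncated jumps enlarges the stable symbol by at most a constant factor, so the remainder symbol
  stays integrable.\<close>

lemma trunc_exponent_le_mass:
  "trunc_exponent \<alpha> \<delta> (\<xi>::'a::euclidean_space) \<le> (\<integral>s. trunc_weight \<alpha> \<delta> s \<partial>lborel)"
proof -
  have "0 \<le> cos_transform (trunc_levy \<alpha> \<delta>) \<xi>"
    unfolding trunc_levy_cos_transform
    by (intro Bochner_Integration.integral_nonneg mult_nonneg_nonneg trunc_weight_nonneg) simp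
  then show ?thesis by (simp add: trunc_exponent_def)
qed

lemma trunc_exponent_minus[simp]: "trunc_exponent \<alpha> \<delta> (- \<xi>) = trunc_exponent \<alpha> \<delta> (\<xi>::'a::euclidean_space)"
  by (simp add: trunc_exponent_def)

lemma trunc_exponent_zero[simp]: "trunc_exponent \<alpha> \<delta> (0::'a::euclidean_space) = 0"
  by (simp add: trunc_exponent_eq)

end

text \<open>Lets the difference of two truncations serve as a jump density in its own right.\<close>

lemma trunc_levy_antimono:
  fixes z :: "'a::euclidean_space"
  assumes "0 < \<delta>'" "\<delta>' \<le> \<delta>"
  shows "trunc_levy \<alpha> \<delta> z \<le> trunc_levy \<alpha> \<delta>' z"
  unfolding trunc_levy_def
proof (rule integral_mono)
  show "trunc_weight \<alpha> \<delta> s * heat_kernel s z \<le> trunc_weight \<alpha> \<delta>' s * heat_kernel s z" for s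
    using assms trunc_mixture_nonneg[of \<delta>' \<alpha> s z]
    by (cases "s > \<delta>") (auto simp: trunc_weight_def)
qed (use assms in \<open>auto intro!: trunc_mixture_integrable\<close>)

lemma trunc_levy_LIMSEQ:
  fixes z :: "'a::euclidean_space"
  assumes z: "z \<noteq> 0" and pos: "\<And>n. \<delta> n > 0" and lim: "\<delta> \<longlonglongrightarrow> 0"
  shows "(\<lambda>n. trunc_levy \<alpha> (\<delta> n) z) \<longlonglongrightarrow> levy_density \<alpha> z"
proof -
  let ?f = "\<lambda>s. sub_weight (\<alpha> / 2) s * heat_kernel s z"
  have nonneg: "0 \<le> ?f s" for s
    using heat_kernel_pos[of s z] by (cases "s > 0") (auto simp: sub_weight_def)
  have "Gamma ((real DIM('a) + \<alpha>) / 2) > 0" using \<alpha>_pos by (intro Gamma_real_pos) (simp add: add_nonneg_pos)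
  then have "0 \<le> levy_density \<alpha> z" by (simp add: levy_density_def frac_const_def)
  then have "has_bochner_integral lborel ?f (levy_density \<alpha> z)"
    by (intro has_bochner_integral_nn_integral) (use nonneg levy_density_mixture[OF \<alpha>_pos z] in auto)
  then have f: "integrable lborel ?f" "(\<integral>s. ?f s \<partial>lborel) = levy_density \<alpha> z" by (auto simp: has_bochner_integral_iff)
  have "(\<integral>s. indicator {0<..} s * ?f s \<partial>lborel) = (\<integral>s. ?f s \<partial>lborel)"
    by (rule Bochner_Integration.integral_cong) (auto simp: sub_weight_def indicator_def)
  with tail_integral_LIMSEQ[OF f(1) pos lim] f(2) show ?thesis
    by (simp add: trunc_levy_def trunc_weight_def mult.assoc)
qed

lemma trunc_exponent_LIMSEQ:
  fixes \<xi> :: "'a::euclidean_space"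
  assumes pos: "\<And>n. \<delta> n > 0" and lim: "\<delta> \<longlonglongrightarrow> 0"
  shows "(\<lambda>n. trunc_exponent \<alpha> (\<delta> n) \<xi>) \<longlonglongrightarrow> norm \<xi> powr \<alpha>"
proof -
  have "((norm \<xi>)\<^sup>2) powr (\<alpha> / 2) = norm \<xi> powr \<alpha>"
    by (cases "\<xi> = 0") (auto simp: powr_powr powr_numeral[symmetric] simp del: powr_numeral)
  then show ?thesis
    using tail_integral_LIMSEQ[OF weight_exponent(1)[of "(norm \<xi>)\<^sup>2"] pos lim] weight_exponent(2)[of "(norm \<xi>)\<^sup>2"]
    by (simp add: trunc_exponent_eq[OF pos])
qed

end

section \<open>Stable densities\<close>

lemma continuous_norm_powr: "0 < \<alpha> \<Longrightarrow> continuous_on UNIV (\<lambda>\<xi>::'a::euclidean_space. norm \<xi> powr \<alpha>)"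
  by (intro continuous_on_powr' continuous_intros) auto

lemma prob_densityI:
  fixes f :: "'a::euclidean_space \<Rightarrow> real"
  assumes "integrable lborel f" "\<And>x. 0 \<le> f x" "(\<integral>x. f x \<partial>lborel) = 1"
  shows "prob_density f"
  using assms by (auto simp: prob_density_def nn_integral_eq_integral)

lemma prob_densityD:
  fixes f :: "'a::euclidean_space \<Rightarrow> real"
  assumes "prob_density f"
  shows "integrable lborel f" "(\<integral>x. f x \<partial>lborel) = 1" "f \<in> borel_measurable borel" "0 \<le> f x"
  using assms nn_integral_eq_integrable[of f lborel 1] by (auto simp: prob_density_def)

text \<open>The instance of Bochner's theorem applied to both the stable and the remainder symbol;
  the total mass is the symbol at zero.\<close>

lemma inv_fourier_prob_density:
  fixes \<phi> :: "'a::euclidean_space \<Rightarrow> real"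
  assumes int: "integrable lborel \<phi>" and pd: "pos_def \<phi>" and even: "\<And>\<xi>. \<phi> (- \<xi>) = \<phi> \<xi>"
    and cont: "continuous_on UNIV \<phi>" and one: "\<phi> 0 = 1"
  shows "prob_density (inv_fourier \<phi>)" and "cos_transform (inv_fourier \<phi>) \<xi> = \<phi> \<xi>"
proof -
  from pd obtain B where B: "\<And>\<xi>. \<bar>\<phi> \<xi>\<bar> \<le> B" by (auto simp: pos_def_def)
  note inv = fourier_inversion[OF int even cont B pos_def_imp_inv_fourier_nonneg[OF pd int]]
  show "cos_transform (inv_fourier \<phi>) \<xi> = \<phi> \<xi>" by (rule inv)
  have "(\<integral>x. inv_fourier \<phi> x \<partial>lborel) = 1" using inv(2)[of 0] one by (simp add: cos_transform_def)
  then show "prob_density (inv_fourier \<phi>)"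
    by (intro prob_densityI inv pos_def_imp_inv_fourier_nonneg[OF pd int])
qed

lemma stable_density_eq:
  fixes y :: "'a::euclidean_space"
  assumes t: "t > 0" and \<alpha>: "\<alpha> > 0"
  shows "stable_density \<alpha> t y = inv_fourier (stable_symbol \<alpha> t) y"
proof -
  let ?f = "\<lambda>\<xi>::'a. complex_of_real (exp (- t * norm \<xi> powr \<alpha>)) * exp (- \<i> * complex_of_real (\<xi> \<bullet> y))"
  have i: "integrable lborel ?f"
    by (rule Bochner_Integration.integrable_bound[OF integrable_exp_norm_powr[OF t \<alpha>]]) (auto simp: norm_mult norm_exp_eq_Re)
  have "Re (\<integral>\<xi>. ?f \<xi> \<partial>lborel) = (\<integral>\<xi>. Re (?f \<xi>) \<partial>lborel)" by (rule integral_Re[OF i, symmetric])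
  also have "\<dots> = cos_transform (stable_symbol \<alpha> t) y"
    unfolding cos_transform_def stable_symbol_def
    by (rule Bochner_Integration.integral_cong) (auto simp: Re_exp inner_commute)
  finally have "Re (\<integral>\<xi>. ?f \<xi> \<partial>lborel) = cos_transform (stable_symbol \<alpha> t) y" .
  moreover have "Re (complex_of_real c * w) = c * Re w" for c w by simp
  ultimately show ?thesis
    unfolding stable_density_def inv_fourier_def by (simp only:)
qed

context stable_index begin

lemma stable_symbol_integrable: "t > 0 \<Longrightarrow> integrable lborel (stable_symbol \<alpha> t :: 'a::euclidean_space \<Rightarrow> real)"
  unfolding stable_symbol_def[abs_def] by (rule integrable_exp_norm_powr[OF _ \<alpha>_pos])

lemma stable_symbol_continuous: "continuous_on UNIV (stable_symbol \<alpha> t :: 'a::euclidean_space \<Rightarrow> real)"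
  unfolding stable_symbol_def[abs_def] by (intro continuous_intros continuous_norm_powr \<alpha>_pos)

section \<open>The stable symbol with the truncated jumps taken out\<close>

context
  fixes \<delta> t :: real
  assumes \<delta>: "\<delta> > 0" and t: "t > 0"
begin

lemma remainder_symbol_continuous: "continuous_on UNIV (remainder_symbol \<alpha> \<delta> t :: 'a::euclidean_space \<Rightarrow> real)"
  unfolding remainder_symbol_def[abs_def] trunc_exponent_def[abs_def]
  by (intro continuous_intros continuous_norm_powr \<alpha>_pos continuous_cos_transform trunc_levy_integrable \<delta>)

lemma remainder_symbol_measurable[measurable]: "(remainder_symbol \<alpha> \<delta> t :: 'a::euclidean_space \<Rightarrow> real) \<in> borel_measurable borel"
  by (rule borel_measurable_continuous_onI[OF remainder_symbol_continuous])

text \<open>A stable jump is an independent sum of the remainder and a compound Poisson variable.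
  Expanding the last exponential sorts by the number of truncated jumps, and
  \<open>exp (- t * m)\<close> is the probability of none.\<close>

lemma stable_symbol_factorization:
  fixes \<xi> :: "'a::euclidean_space"
  defines "m \<equiv> (\<integral>s. trunc_weight \<alpha> \<delta> s \<partial>lborel)"
  shows "stable_symbol \<alpha> t \<xi> = exp (- t * m) * (remainder_symbol \<alpha> \<delta> t \<xi> * exp (t * cos_transform (trunc_levy \<alpha> \<delta>) \<xi>))"
  unfolding stable_symbol_def remainder_symbol_def trunc_exponent_def m_def
  by (simp add: exp_add[symmetric] algebra_simps)

lemma remainder_symbol_integrable: "integrable lborel (remainder_symbol \<alpha> \<delta> t :: 'a::euclidean_space \<Rightarrow> real)"
proof -
  define m where "m = (\<integral>s. trunc_weight \<alpha> \<delta> s \<partial>lborel)"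
  have "integrable lborel (\<lambda>\<xi>::'a. exp (t * m) * stable_symbol \<alpha> t \<xi>)"
    using stable_symbol_integrable[OF t] by (rule integrable_mult_right)
  then show ?thesis
  proof (rule Bochner_Integration.integrable_bound)
    have "remainder_symbol \<alpha> \<delta> t \<xi> \<le> exp (t * m) * stable_symbol \<alpha> t \<xi>" for \<xi> :: 'a
      using trunc_exponent_le_mass[OF \<delta>, of \<xi>] t
      by (simp add: remainder_symbol_def stable_symbol_def m_def algebra_simps exp_add[symmetric])
    then show "AE \<xi> in lborel. norm (remainder_symbol \<alpha> \<delta> t (\<xi>::'a)) \<le> norm (exp (t * m) * stable_symbol \<alpha> t \<xi>)"
      by (simp add: remainder_symbol_def stable_symbol_def)
  qed simp
qed

text \<open>
  Removing further jumps from below leaves compound Poisson symbols, whose positivity is visible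
  from the exponential series.
\<close>

lemma remainder_symbol_pos_def: "pos_def (remainder_symbol \<alpha> \<delta> t :: 'a::euclidean_space \<Rightarrow> real)"
proof (rule pos_def_limit)
  define \<delta>' where "\<delta>' n = \<delta> * inverse (real (Suc n))" for n
  have \<delta>'_pos: "\<delta>' n > 0" for n using \<delta> by (simp add: \<delta>'_def)
  have \<delta>'_le: "\<delta>' n \<le> \<delta>" for n using \<delta> by (simp add: \<delta>'_def field_simps)
  have "\<delta>' \<longlonglongrightarrow> \<delta> * 0"
    unfolding \<delta>'_def[abs_def] by (intro tendsto_intros LIMSEQ_inverse_real_of_nat)
  then have \<delta>'_lim: "\<delta>' \<longlonglongrightarrow> 0" by simp
  \<comment> \<open>The compound Poisson symbol whose jumps have subordination times between
    \<open>\<delta>' n\<close> and \<open>\<delta>\<close>; its jump density is \<open>D n\<close>,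
    nonnegative because \<open>\<delta>' n \<le> \<delta>\<close>.\<close>
  define f where "f n \<xi> = exp (- t * (trunc_exponent \<alpha> (\<delta>' n) \<xi> - trunc_exponent \<alpha> \<delta> \<xi>))" for n and \<xi> :: 'a
  define D where "D n z = trunc_levy \<alpha> (\<delta>' n) z - trunc_levy \<alpha> \<delta> z" for n and z :: 'a
  define m where "m n = (\<integral>z. D n z \<partial>lborel)" for n
  have Di: "integrable lborel (D n)" for n
    unfolding D_def[abs_def] by (intro Bochner_Integration.integrable_diff trunc_levy_integrable \<delta> \<delta>'_pos)
  have D0: "D n z \<ge> 0" for n z
    using trunc_levy_antimono[OF \<delta>'_pos \<delta>'_le] by (simp add: D_def)
  have Deven: "D n (- z) = D n z" for n z by (simp add: D_def)
  have Dcos: "cos_transform (D n) \<xi> = cos_transform (trunc_levy \<alpha> (\<delta>' n)) \<xi> - cos_transform (trunc_levy \<alpha> \<delta>) \<xi>" for n \<xi>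
    unfolding cos_transform_def D_def left_diff_distrib
    by (intro Bochner_Integration.integral_diff integrable_mult_cos trunc_levy_integrable \<delta> \<delta>'_pos)
  have m: "m n = (\<integral>s. trunc_weight \<alpha> (\<delta>' n) s \<partial>lborel) - (\<integral>s. trunc_weight \<alpha> \<delta> s \<partial>lborel)" for n
    unfolding m_def D_def trunc_levy_mass[OF \<delta>'_pos, symmetric, where 'a='a] trunc_levy_mass[OF \<delta>, symmetric, where 'a='a]
    by (intro Bochner_Integration.integral_diff trunc_levy_integrable \<delta> \<delta>'_pos)
  have f_eq: "f n \<xi> = exp (- t * m n) * (1 * (\<Sum>k. t ^ k / fact k * cos_transform (D n) \<xi> ^ k))" for n \<xi>
  proof -
    have "f n \<xi> = exp (- t * m n) * exp (t * cos_transform (D n) \<xi>)"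
      by (simp add: f_def trunc_exponent_def m Dcos algebra_simps flip: exp_add)
    also have "exp (t * cos_transform (D n) \<xi>) = (\<Sum>k. t ^ k / fact k * cos_transform (D n) \<xi> ^ k)"
      by (simp add: exp_def power_mult_distrib field_simps)
    finally show ?thesis by simp
  qed
  show "pos_def (f n)" for n
    unfolding f_eq[abs_def]
  proof (rule pos_def_cmult, rule pos_def_mult_power_series[OF pos_def_1 Di Deven D0])
    show "summable (\<lambda>k. t ^ k / fact k * (\<integral>z. D n z \<partial>lborel) ^ k)"
      using summable_exp[of "t * m n"] by (simp add: power_mult_distrib m_def field_simps)
  qed (use t in auto)
  show "\<bar>f n \<xi>\<bar> \<le> 1" for n \<xi>
  proof -
    have "cos_transform (D n) \<xi> \<le> m n"
      using abs_cos_transform_le[OF Di, of n \<xi>] D0[of n] by (simp add: m_def)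
    then have "trunc_exponent \<alpha> \<delta> \<xi> \<le> trunc_exponent \<alpha> (\<delta>' n) \<xi>"
      by (simp add: trunc_exponent_def Dcos m)
    then show ?thesis using t by (simp add: f_def)
  qed
  show "(\<lambda>n. f n \<xi>) \<longlonglongrightarrow> remainder_symbol \<alpha> \<delta> t \<xi>" for \<xi>
    unfolding f_def remainder_symbol_def
    by (intro tendsto_intros trunc_exponent_LIMSEQ \<delta>'_pos \<delta>'_lim)
qed

lemma remainder_prob_density: "prob_density (remainder_density \<alpha> \<delta> t :: 'a::euclidean_space \<Rightarrow> real)"
  unfolding remainder_density_def
  by (rule inv_fourier_prob_density[OF remainder_symbol_integrable remainder_symbol_pos_def _ remainder_symbol_continuous])
     (use \<delta> \<alpha>_pos in \<open>auto simp: remainder_symbol_def\<close>)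

text \<open>The coefficients are left open because two choices occur: the full exponential series,
  and the series with the terms for no jump and one jump deleted.\<close>

lemma remainder_mult_series_pos_def:
  assumes a: "\<And>n. 0 \<le> a n" "\<And>n. a n \<le> t ^ n / fact n"
  shows "pos_def (\<lambda>\<xi>::'a::euclidean_space. remainder_symbol \<alpha> \<delta> t \<xi> * (\<Sum>n. a n * cos_transform (trunc_levy \<alpha> \<delta>) \<xi> ^ n))"
proof (rule pos_def_mult_power_series[OF remainder_symbol_pos_def trunc_levy_integrable[OF \<delta>]])
  let ?m = "integral\<^sup>L lborel (trunc_levy \<alpha> \<delta> :: 'a \<Rightarrow> real)"
  have m: "0 \<le> ?m" by (intro Bochner_Integration.integral_nonneg trunc_levy_nonneg \<delta>)
  show "summable (\<lambda>n. a n * ?m ^ n)"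
  proof (rule summable_comparison_test'[of _ 0])
    show "summable (\<lambda>n. t ^ n / fact n * ?m ^ n)"
      using summable_exp[of "t * ?m"] by (simp add: power_mult_distrib field_simps)
    show "norm (a n * ?m ^ n) \<le> t ^ n / fact n * ?m ^ n" for n
      using mult_right_mono[OF a(2)[of n] zero_le_power[OF m, of n]] a(1)[of n] m by (simp add: abs_mult power_abs)
  qed
qed (use a \<delta> in \<open>auto intro: trunc_levy_nonneg\<close>)

text \<open>The full exponential series puts the removed jumps back, at whatever level \<delta> they
  were removed.\<close>

lemma stable_symbol_pos_def: "pos_def (stable_symbol \<alpha> t :: 'a::euclidean_space \<Rightarrow> real)"
proof -
  define m where "m = (\<integral>s. trunc_weight \<alpha> \<delta> s \<partial>lborel)"
  have "exp (t * c) = (\<Sum>n. t ^ n / fact n * c ^ n)" for c :: real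
    by (simp add: exp_def power_mult_distrib field_simps)
  then have eq: "stable_symbol \<alpha> t \<xi> = exp (- t * m) * (remainder_symbol \<alpha> \<delta> t \<xi> * (\<Sum>n. t ^ n / fact n * cos_transform (trunc_levy \<alpha> \<delta>) \<xi> ^ n))" for \<xi> :: 'a
    using stable_symbol_factorization[of \<xi>] by (simp add: m_def)
  show ?thesis
    unfolding eq[abs_def] by (intro pos_def_cmult remainder_mult_series_pos_def) (use t in auto)
qed

text \<open>The jump-free and the one-jump part of the exponential series.\<close>

lemma stable_density_ge:
  fixes y :: "'a::euclidean_space"
  defines "m \<equiv> (\<integral>s. trunc_weight \<alpha> \<delta> s \<partial>lborel)"
  shows "exp (- t * m) * (remainder_density \<alpha> \<delta> t y
      + t * (\<integral>z. trunc_levy \<alpha> \<delta> z * remainder_density \<alpha> \<delta> t (y - z) \<partial>lborel)) \<le> stable_density \<alpha> t y"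
proof -
  let ?L = "cos_transform (trunc_levy \<alpha> \<delta>) :: 'a \<Rightarrow> real"
  let ?R = "remainder_symbol \<alpha> \<delta> t :: 'a \<Rightarrow> real"
  let ?S = "\<lambda>\<xi>. stable_symbol \<alpha> t \<xi> - exp (- t * m) * (?R \<xi> + t * (?R \<xi> * ?L \<xi>))"
  \<comment> \<open>The coefficients of \<open>exp (t * c) - 1 - t * c\<close>: the paths with at
    least two jumps, whose contribution to the density is nonnegative and is dropped.\<close>
  define a where "a n = (if n < 2 then 0 else t ^ n / fact n)" for n :: nat
  have L: "integrable lborel (trunc_levy \<alpha> \<delta> :: 'a \<Rightarrow> real)" by (rule trunc_levy_integrable[OF \<delta>])
  have RL: "integrable lborel (\<lambda>\<xi>. ?R \<xi> * ?L \<xi>)"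
    by (rule integrable_mult_bounded[OF remainder_symbol_integrable _ abs_cos_transform_le[OF L]]) simp
  have Si: "integrable lborel ?S"
    by (intro Bochner_Integration.integrable_diff integrable_mult_right Bochner_Integration.integrable_add
        RL remainder_symbol_integrable stable_symbol_integrable t)
  have series: "exp (t * c) - 1 - t * c = (\<Sum>n. a n * c ^ n)" for c :: real
  proof -
    have "(\<lambda>n. t ^ n / fact n * c ^ n) sums exp (t * c)"
      using exp_converges[of "t * c"] by (simp add: power_mult_distrib field_simps)
    moreover have "(\<lambda>n. if n \<in> {0, 1} then t ^ n / fact n * c ^ n else 0) sums (\<Sum>n\<in>{0, 1}. t ^ n / fact n * c ^ n)"
      by (rule sums_If_finite_set) simp
    ultimately have "(\<lambda>n. t ^ n / fact n * c ^ n - (if n \<in> {0, 1} then t ^ n / fact n * c ^ n else 0)) sums (exp (t * c) - (\<Sum>n\<in>{0, 1}. t ^ n / fact n * c ^ n))"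
      by (rule sums_diff)
    also have "(\<lambda>n. t ^ n / fact n * c ^ n - (if n \<in> {0, 1} then t ^ n / fact n * c ^ n else 0)) = (\<lambda>n. a n * c ^ n)"
      by (auto simp: a_def fun_eq_iff less_2_cases_iff)
    finally show ?thesis by (simp add: sums_iff)
  qed
  have "?S \<xi> = exp (- t * m) * (?R \<xi> * (exp (t * ?L \<xi>) - 1 - t * ?L \<xi>))" for \<xi>
    unfolding stable_symbol_factorization[of \<xi>] m_def[symmetric] by (simp add: algebra_simps)
  then have S: "?S \<xi> = exp (- t * m) * (?R \<xi> * (\<Sum>n. a n * ?L \<xi> ^ n))" for \<xi>
    by (simp only: series)
  have "pos_def ?S"
    unfolding S by (intro pos_def_cmult remainder_mult_series_pos_def) (use t in \<open>auto simp: a_def\<close>)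
  then have "0 \<le> inv_fourier ?S y" by (rule pos_def_imp_inv_fourier_nonneg[OF _ Si])
  also have "inv_fourier ?S y = inv_fourier (stable_symbol \<alpha> t) y - exp (- t * m) * (inv_fourier ?R y + t * inv_fourier (\<lambda>\<xi>. ?R \<xi> * ?L \<xi>) y)"
  proof -
    have "cos_transform ?S y = (\<integral>\<xi>. stable_symbol \<alpha> t \<xi> * cos (y \<bullet> \<xi>) - exp (- t * m) * (?R \<xi> * cos (y \<bullet> \<xi>) + t * (?R \<xi> * ?L \<xi> * cos (y \<bullet> \<xi>))) \<partial>lborel)"
      unfolding cos_transform_def by (rule Bochner_Integration.integral_cong) (auto simp: algebra_simps)
    also have "\<dots> = cos_transform (stable_symbol \<alpha> t) y - exp (- t * m) * (cos_transform ?R y + t * cos_transform (\<lambda>\<xi>. ?R \<xi> * ?L \<xi>) y)"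
    proof -
      have "integrable lborel (\<lambda>\<xi>. ?R \<xi> * cos (y \<bullet> \<xi>))" "integrable lborel (\<lambda>\<xi>. stable_symbol \<alpha> t \<xi> * cos (y \<bullet> \<xi>))"
        "integrable lborel (\<lambda>\<xi>. ?R \<xi> * ?L \<xi> * cos (y \<bullet> \<xi>))"
        by (intro integrable_mult_cos RL remainder_symbol_integrable stable_symbol_integrable t)+
      then show ?thesis by (simp add: cos_transform_def[where \<xi>=y])
    qed
    finally show ?thesis unfolding inv_fourier_def by (simp add: right_diff_distrib distrib_left mult_ac)
  qed
  also have "inv_fourier (\<lambda>\<xi>. ?R \<xi> * ?L \<xi>) y = (\<integral>z. trunc_levy \<alpha> \<delta> z * remainder_density \<alpha> \<delta> t (y - z) \<partial>lborel)"
    unfolding remainder_density_def by (rule convolution_inv_fourier[OF remainder_symbol_integrable L, symmetric]) simp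
  finally show ?thesis
    by (simp add: stable_density_eq[OF t \<alpha>_pos] remainder_density_def)
qed

end

section \<open>Stable densities: mass, strict positivity, semigroup law\<close>

lemma stable_prob_density:
  assumes t: "t > 0"
  shows "prob_density (stable_density \<alpha> t :: 'a::euclidean_space \<Rightarrow> real)"
    and "cos_transform (stable_density \<alpha> t) (\<xi> :: 'a) = stable_symbol \<alpha> t \<xi>"
proof -
  have eq: "stable_density \<alpha> t = (inv_fourier (stable_symbol \<alpha> t) :: 'a \<Rightarrow> real)"
    by (simp add: stable_density_eq[OF t \<alpha>_pos] fun_eq_iff)
  have even: "stable_symbol \<alpha> t (- \<xi>) = stable_symbol \<alpha> t \<xi>" "stable_symbol \<alpha> t (0 :: 'a) = 1" for \<xi> :: 'a
    using \<alpha>_pos by (simp_all add: stable_symbol_def)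
  show "prob_density (stable_density \<alpha> t :: 'a \<Rightarrow> real)" "cos_transform (stable_density \<alpha> t) (\<xi> :: 'a) = stable_symbol \<alpha> t \<xi>"
    unfolding eq
    by (rule inv_fourier_prob_density[OF stable_symbol_integrable[OF t] stable_symbol_pos_def[OF zero_less_one t]
          even(1) stable_symbol_continuous even(2)])+
qed

lemma stable_density_minus: "t > 0 \<Longrightarrow> stable_density \<alpha> t (- y) = stable_density \<alpha> t (y :: 'a::euclidean_space)"
  by (simp add: stable_density_eq \<alpha>_pos)

lemma stable_density_bounded:
  assumes t: "t > 0"
  obtains B where "\<And>y :: 'a::euclidean_space. stable_density \<alpha> t y \<le> B"
  using abs_inv_fourier_le[OF stable_symbol_integrable[OF t], where 'a='a]
  by (metis abs_le_D1 stable_density_eq[OF t \<alpha>_pos])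

text \<open>The one-jump part alone suffices: it convolves the strictly positive
  \<open>trunc_levy\<close> with a probability density. The truncation level 1 is an arbitrary
  choice.\<close>

lemma stable_density_pos:
  fixes y :: "'a::euclidean_space"
  assumes t: "t > 0"
  shows "0 < stable_density \<alpha> t y"
proof -
  have r: "prob_density (remainder_density \<alpha> 1 t :: 'a \<Rightarrow> real)" by (rule remainder_prob_density[OF _ t]) simp
  note r' = prob_densityD[OF r]
  have [measurable]: "(remainder_density \<alpha> 1 t :: 'a \<Rightarrow> real) \<in> borel_measurable borel" by (rule r')
  let ?f = "\<lambda>z. trunc_levy \<alpha> 1 z * remainder_density \<alpha> 1 t (y - z)"
  have nonneg: "0 \<le> ?f z" for z using r'(4) trunc_levy_nonneg[of 1 \<alpha> z] by simp
  have "\<bar>remainder_density \<alpha> 1 t (y - z)\<bar> \<le> 1 / (2 * pi) ^ DIM('a) * (\<integral>z. \<bar>remainder_symbol \<alpha> 1 t (z::'a)\<bar> \<partial>lborel)" for z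
    unfolding remainder_density_def by (rule abs_inv_fourier_le[OF remainder_symbol_integrable[OF _ t]]) simp
  then have fi: "integrable lborel ?f"
    by (rule integrable_mult_bounded[OF trunc_levy_integrable, rotated 2]) auto
  have "(\<integral>z. ?f z \<partial>lborel) \<noteq> 0"
  proof
    assume "(\<integral>z. ?f z \<partial>lborel) = 0"
    then have "AE z in lborel. ?f z = 0" by (subst (asm) integral_nonneg_eq_0_iff_AE[OF fi]) (use nonneg in auto)
    moreover have "trunc_levy \<alpha> 1 z \<noteq> 0" for z :: 'a using trunc_levy_pos[of 1 z] by simp
    ultimately have "AE z in lborel. remainder_density \<alpha> 1 t (y - z) = 0" by simp
    then have "(\<integral>z. remainder_density \<alpha> 1 t (y - z) \<partial>lborel) = 0"
      by (subst integral_cong_AE[where g="\<lambda>_. 0"]) auto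
    then show False using r'(2) by (simp add: lborel_integral_minus(1))
  qed
  moreover have "0 \<le> (\<integral>z. ?f z \<partial>lborel)" by (rule Bochner_Integration.integral_nonneg) (rule nonneg)
  ultimately have *: "0 < (\<integral>z. ?f z \<partial>lborel)" by simp
  have "0 < exp (- t * (\<integral>s. trunc_weight \<alpha> 1 s \<partial>lborel)) * (remainder_density \<alpha> 1 t y + t * (\<integral>z. ?f z \<partial>lborel))"
    using * t r'(4)[of y] by (intro mult_pos_pos add_nonneg_pos) auto
  also have "\<dots> \<le> stable_density \<alpha> t y" by (rule stable_density_ge[OF _ t]) simp
  finally show ?thesis .
qed

lemma stable_density_semigroup:
  fixes y :: "'a::euclidean_space"
  assumes s: "s > 0" and t: "t > 0"
  shows "(\<integral>z. stable_density \<alpha> s z * stable_density \<alpha> t (y - z) \<partial>lborel) = stable_density \<alpha> (s + t) y"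
proof -
  have "(\<integral>z. stable_density \<alpha> s z * stable_density \<alpha> t (y - z) \<partial>lborel)
    = (\<integral>z. stable_density \<alpha> s z * inv_fourier (stable_symbol \<alpha> t) (y - z) \<partial>lborel)"
    by (simp add: stable_density_eq[OF t \<alpha>_pos])
  also have "\<dots> = inv_fourier (\<lambda>\<xi>. stable_symbol \<alpha> t \<xi> * cos_transform (stable_density \<alpha> s) \<xi>) y"
    by (rule convolution_inv_fourier[OF stable_symbol_integrable[OF t] prob_densityD(1)[OF stable_prob_density(1)[OF s]]])
       (rule stable_density_minus[OF s])
  also have "(\<lambda>\<xi>::'a. stable_symbol \<alpha> t \<xi> * cos_transform (stable_density \<alpha> s) \<xi>) = stable_symbol \<alpha> (s + t)"
    by (simp add: stable_prob_density(2)[OF s] fun_eq_iff) (simp add: stable_symbol_def algebra_simps flip: exp_add)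
  finally show ?thesis using s t by (simp add: stable_density_eq \<alpha>_pos)
qed

end

section \<open>The reverse local Poincare inequality\<close>

text \<open>The expectation of \<open>u (x + Y)\<close> for \<open>Y\<close> with density
  \<open>f\<close>. With a stable density this is the semigroup P; at \<open>x = 0\<close> it is the
  plain integral of \<open>u\<close> against \<open>f\<close>, so the same lemmas serve for
  variances under the target and under the law of y.\<close>

definition avg :: "('a::euclidean_space \<Rightarrow> real) \<Rightarrow> ('a \<Rightarrow> real) \<Rightarrow> 'a \<Rightarrow> real" where
  "avg f u x = (\<integral>y. f y * u (x + y) \<partial>lborel)"

definition avg_var :: "('a::euclidean_space \<Rightarrow> real) \<Rightarrow> ('a \<Rightarrow> real) \<Rightarrow> 'a \<Rightarrow> real" where
  "avg_var f u x = avg f (\<lambda>y. (u y)\<^sup>2) x - (avg f u x)\<^sup>2"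

definition bounded_measurable :: "('a::euclidean_space \<Rightarrow> real) \<Rightarrow> real \<Rightarrow> bool" where
  "bounded_measurable u B \<longleftrightarrow> u \<in> borel_measurable borel \<and> (\<forall>x. \<bar>u x\<bar> \<le> B)"

lemma bounded_measurableD:
  assumes "bounded_measurable u B"
  shows "u \<in> borel_measurable borel" "\<bar>u x\<bar> \<le> B"
  using assms by (auto simp: bounded_measurable_def)

lemma bounded_measurable_nonneg: "bounded_measurable u B \<Longrightarrow> 0 \<le> B"
  using bounded_measurableD(2)[of u B 0] by linarith

lemma bounded_measurable_power2_diff:
  assumes "bounded_measurable u B"
  shows "bounded_measurable (\<lambda>y. (u y - c)\<^sup>2) ((B + \<bar>c\<bar>)\<^sup>2)"
proof -
  have [measurable]: "u \<in> borel_measurable borel" by (rule bounded_measurableD[OF assms])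
  have "\<bar>u y - c\<bar> \<le> B + \<bar>c\<bar>" for y using bounded_measurableD(2)[OF assms, of y] by linarith
  then have "\<bar>u y - c\<bar>\<^sup>2 \<le> (B + \<bar>c\<bar>)\<^sup>2" for y by (intro power_mono) auto
  then show ?thesis by (auto simp: bounded_measurable_def)
qed

lemma bounded_measurable_power2: "bounded_measurable u B \<Longrightarrow> bounded_measurable (\<lambda>y. (u y)\<^sup>2) (B\<^sup>2)"
  using bounded_measurable_power2_diff[of u B 0] by simp

lemma avg_integrable:
  assumes f: "integrable lborel f" and u: "bounded_measurable u B"
  shows "integrable lborel (\<lambda>y. f y * u (x + y))"
proof -
  have [measurable]: "u \<in> borel_measurable borel" by (rule bounded_measurableD[OF u])
  show ?thesis by (rule integrable_mult_bounded[OF f]) (use bounded_measurableD(2)[OF u] in auto)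
qed

lemma avg_measurable:
  assumes [measurable]: "f \<in> borel_measurable borel" "u \<in> borel_measurable borel"
  shows "avg f u \<in> borel_measurable borel"
  unfolding avg_def[abs_def] by measurable

lemma avg_bounded_measurable:
  assumes f: "prob_density f" and u: "bounded_measurable u B"
  shows "bounded_measurable (avg f u) B"
proof -
  note f' = prob_densityD[OF f]
  have "\<bar>avg f u x\<bar> \<le> B" for x
  proof -
    have "\<bar>avg f u x\<bar> \<le> (\<integral>y. \<bar>f y * u (x + y)\<bar> \<partial>lborel)" unfolding avg_def by (rule integral_abs_bound)
    also have "\<dots> \<le> (\<integral>y. f y * B \<partial>lborel)"
    proof (rule integral_mono)
      show "\<bar>f y * u (x + y)\<bar> \<le> f y * B" for y
        using f'(4)[of y] bounded_measurableD(2)[OF u, of "x + y"] by (simp add: abs_mult mult_left_mono)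
      show "integrable lborel (\<lambda>y. f y * B)" using f'(1) by simp
    qed (intro integrable_abs avg_integrable[OF f'(1) u])
    also have "\<dots> = B" using f'(2) by simp
    finally show ?thesis .
  qed
  then show ?thesis
    using avg_measurable[OF f'(3) bounded_measurableD(1)[OF u]] by (simp add: bounded_measurable_def)
qed

lemma avg_diff:
  assumes "integrable lborel f" "bounded_measurable u B" "bounded_measurable v C"
  shows "avg f (\<lambda>y. u y - v y) x = avg f u x - avg f v x"
  unfolding avg_def right_diff_distrib
  by (rule Bochner_Integration.integral_diff) (rule avg_integrable[OF assms(1,2)], rule avg_integrable[OF assms(1,3)])

text \<open>The bias-variance decomposition. Nonnegativity of the variance, Jensen's inequality and
  the comparison of a variance with the second moment about 1 are all read off from it.\<close>

lemma avg_power2_diff: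
  assumes f: "prob_density f" and u: "bounded_measurable u B"
  shows "avg f (\<lambda>y. (u y - c)\<^sup>2) x = avg_var f u x + (avg f u x - c)\<^sup>2"
proof -
  note f' = prob_densityD[OF f]
  note i = avg_integrable[OF f'(1) u] avg_integrable[OF f'(1) bounded_measurable_power2[OF u]]
  have "avg f (\<lambda>y. (u y - c)\<^sup>2) x = (\<integral>y. f y * (u (x + y))\<^sup>2 - 2 * c * (f y * u (x + y)) + c\<^sup>2 * f y \<partial>lborel)"
    unfolding avg_def by (rule Bochner_Integration.integral_cong) (auto simp: power2_diff algebra_simps)
  also have "\<dots> = avg f (\<lambda>y. (u y)\<^sup>2) x - 2 * c * avg f u x + c\<^sup>2"
    using i f'(1,2) by (simp add: avg_def)
  finally show ?thesis by (simp add: avg_var_def power2_diff algebra_simps)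
qed

lemma avg_nonneg: "(\<And>y. 0 \<le> f y) \<Longrightarrow> (\<And>y. 0 \<le> u y) \<Longrightarrow> 0 \<le> avg f u x"
  unfolding avg_def by (intro Bochner_Integration.integral_nonneg mult_nonneg_nonneg)

lemma avg_var_eq:
  assumes f: "prob_density f" and u: "bounded_measurable u B"
  shows "avg_var f u x = avg f (\<lambda>y. (u y - avg f u x)\<^sup>2) x"
  by (simp add: avg_power2_diff[OF f u])

lemma avg_var_nonneg:
  assumes f: "prob_density f" and u: "bounded_measurable u B"
  shows "0 \<le> avg_var f u x"
  unfolding avg_var_eq[OF f u] by (rule avg_nonneg) (use prob_densityD[OF f] in auto)

lemma avg_jensen:
  assumes f: "prob_density f" and u: "bounded_measurable u B"
  shows "(avg f u x - c)\<^sup>2 \<le> avg f (\<lambda>y. (u y - c)\<^sup>2) x"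
  using avg_power2_diff[OF f u] avg_var_nonneg[OF f u, of x] by simp

lemma avg_avg_swap:
  assumes f: "integrable lborel f" and g: "integrable lborel g" and u: "bounded_measurable u B"
  shows "avg f (avg g u) x = avg g (avg f u) x"
proof -
  have [measurable]: "u \<in> borel_measurable borel" by (rule bounded_measurableD[OF u])
  have "(\<integral>w. f w * (\<integral>y. g y * u (x + w + y) \<partial>lborel) \<partial>lborel) = (\<integral>y. g y * (\<integral>w. f w * u (x + w + y) \<partial>lborel) \<partial>lborel)"
    by (rule lborel_pair.integrable_mult_bounded_kernel(2)[OF f g _ bounded_measurableD(2)[OF u]]) measurable
  then show ?thesis by (simp add: avg_def add_ac)
qed

lemma avg_convolution:
  fixes f g :: "'a::euclidean_space \<Rightarrow> real"
  assumes f: "integrable lborel f" and g: "integrable lborel g" and u: "bounded_measurable u B"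
  shows "integrable lborel (\<lambda>y. (\<integral>w. f w * g (y - w) \<partial>lborel) * u (x + y))"
    and "avg (\<lambda>y. \<integral>w. f w * g (y - w) \<partial>lborel) u x = avg f (avg g u) x"
proof -
  have [measurable]: "f \<in> borel_measurable borel" "g \<in> borel_measurable borel" "u \<in> borel_measurable borel"
    using f g bounded_measurableD(1)[OF u] by auto
  have gs: "integrable lborel (\<lambda>y. g (y - w))" for w
    using lborel_integral_plus(2)[of g "- w"] g by simp
  have i: "integrable (lborel \<Otimes>\<^sub>M lborel) (\<lambda>(w, y). f w * (g (y - w) * u (x + y)))"
  proof (rule lborel_pair.Fubini_integrable)
    have bound: "\<bar>\<integral>y. \<bar>g (y - w) * u (x + y)\<bar> \<partial>lborel\<bar> \<le> B * (\<integral>y. \<bar>g y\<bar> \<partial>lborel)" for w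
    proof -
      have "\<bar>\<integral>y. \<bar>g (y - w) * u (x + y)\<bar> \<partial>lborel\<bar> = (\<integral>y. \<bar>g (y - w) * u (x + y)\<bar> \<partial>lborel)"
        by (rule abs_of_nonneg, rule Bochner_Integration.integral_nonneg) simp
      also have "\<dots> \<le> (\<integral>y. B * \<bar>g (y - w)\<bar> \<partial>lborel)"
      proof (rule integral_mono)
        show "\<bar>g (y - w) * u (x + y)\<bar> \<le> B * \<bar>g (y - w)\<bar>" for y
          using mult_right_mono[OF bounded_measurableD(2)[OF u, of "x + y"] abs_ge_zero[of "g (y - w)"]]
          by (simp add: abs_mult mult.commute)
        show "integrable lborel (\<lambda>y. \<bar>g (y - w) * u (x + y)\<bar>)"
          by (intro integrable_abs avg_integrable[OF gs u])
      qed (use gs in simp)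
      also have "\<dots> = B * (\<integral>y. \<bar>g y\<bar> \<partial>lborel)"
        using lborel_integral_plus(1)[of "\<lambda>y. \<bar>g y\<bar>" "- w"] by simp
      finally show ?thesis .
    qed
    have "integrable lborel (\<lambda>w. \<bar>f w\<bar> * (\<integral>y. \<bar>g (y - w) * u (x + y)\<bar> \<partial>lborel))"
      by (rule integrable_mult_bounded[OF integrable_abs[OF f] _ bound]) measurable
    then show "integrable lborel (\<lambda>w. \<integral>y. norm (case (w, y) of (w, y) \<Rightarrow> f w * (g (y - w) * u (x + y))) \<partial>lborel)"
      by (simp add: abs_mult)
    show "AE w in lborel. integrable lborel (\<lambda>y. case (w, y) of (w, y) \<Rightarrow> f w * (g (y - w) * u (x + y)))"
      by (auto intro!: avg_integrable[OF gs u])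
  qed measurable
  have eq: "(\<integral>w. f w * (g (y - w) * u (x + y)) \<partial>lborel) = (\<integral>w. f w * g (y - w) \<partial>lborel) * u (x + y)" for y
    by (subst integral_mult_left_zero[symmetric]) (simp add: mult.assoc)
  show "integrable lborel (\<lambda>y. (\<integral>w. f w * g (y - w) \<partial>lborel) * u (x + y))"
    using lborel_pair.integrable_snd[OF i] by (simp add: eq)
  have "avg f (avg g u) x = (\<integral>w. f w * (\<integral>y. g (y - w) * u (x + y) \<partial>lborel) \<partial>lborel)"
  proof -
    have "(\<integral>y. g (y - w) * u (x + y) \<partial>lborel) = (\<integral>y. g y * u (x + w + y) \<partial>lborel)" for w
      using lborel_integral_plus(1)[of "\<lambda>y. g (y - w) * u (x + y)" w] by (simp add: add_ac)
    then show ?thesis by (simp add: avg_def)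
  qed
  also have "\<dots> = (\<integral>w. (\<integral>y. f w * (g (y - w) * u (x + y)) \<partial>lborel) \<partial>lborel)" by simp
  also have "\<dots> = (\<integral>y. (\<integral>w. f w * (g (y - w) * u (x + y)) \<partial>lborel) \<partial>lborel)"
    by (rule lborel_pair.Fubini_integral[OF i, symmetric])
  finally show "avg (\<lambda>y. \<integral>w. f w * g (y - w) \<partial>lborel) u x = avg f (avg g u) x"
    by (simp add: eq avg_def)
qed

text \<open>The law of total variance, combined with convexity of the variance functional in \<open>u\<close>.\<close>

lemma avg_var_superadditive:
  fixes f g h :: "'a::euclidean_space \<Rightarrow> real"
  assumes f: "prob_density f" and g: "prob_density g" and u: "bounded_measurable u B"
    and h: "\<And>y. h y = (\<integral>w. f w * g (y - w) \<partial>lborel)"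
  shows "avg_var f (avg g u) x + avg_var g (avg f u) x \<le> avg_var h u x"
proof -
  note f' = prob_densityD[OF f] and g' = prob_densityD[OF g]
  have [measurable]: "u \<in> borel_measurable borel" "f \<in> borel_measurable borel" "g \<in> borel_measurable borel"
    "avg g u \<in> borel_measurable borel"
    using f'(3) g'(3) bounded_measurableD(1)[OF u] avg_measurable by auto
  note u2 = bounded_measurable_power2[OF u]
  note gu = avg_bounded_measurable[OF g u] and fu = avg_bounded_measurable[OF f u]
  note gu2 = avg_bounded_measurable[OF g u2]
  have h_avg: "avg h v x = avg f (avg g v) x" if "bounded_measurable v C" for v C
    using avg_convolution(2)[OF f'(1) g'(1) that] by (simp add: h[abs_def])
  \<comment> \<open>The law of total variance for first an \<open>f\<close>-step, then a
    \<open>g\<close>-step.\<close>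
  have var: "avg_var h u x = avg f (avg_var g u) x + avg_var f (avg g u) x"
    unfolding avg_var_def[abs_def] h_avg[OF u] h_avg[OF u2]
    using avg_diff[OF f'(1) gu2 bounded_measurable_power2[OF gu]] by simp
  \<comment> \<open>The expected conditional variance is a double integral of squares. Integrating
    over \<open>w\<close> inside, Jensen bounds the mean of squares below by the square of the mean;
    by \<open>avg_avg_swap\<close> that mean is \<open>avg f u (x + y)\<close> minus its own
    \<open>g\<close>-average, and the outer integral becomes the second variance.\<close>
  define k where "k w y = (u (x + w + y) - avg g u (x + w))\<^sup>2" for w y
  have k_meas: "(\<lambda>(w, y). k w y) \<in> borel_measurable (lborel \<Otimes>\<^sub>M lborel)"
    unfolding k_def by measurable
  have k_le: "\<bar>k w y\<bar> \<le> (2 * B)\<^sup>2" for w y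
  proof -
    have "\<bar>u (x + w + y) - avg g u (x + w)\<bar> \<le> 2 * B"
      using bounded_measurableD(2)[OF u, of "x + w + y"] bounded_measurableD(2)[OF gu, of "x + w"] by linarith
    then have "\<bar>u (x + w + y) - avg g u (x + w)\<bar>\<^sup>2 \<le> (2 * B)\<^sup>2" by (intro power_mono) auto
    then show ?thesis by (simp add: k_def)
  qed
  have "avg f (avg_var g u) x = (\<integral>w. f w * (\<integral>y. g y * k w y \<partial>lborel) \<partial>lborel)"
    by (simp add: avg_def[of f] avg_var_eq[OF g u]) (simp add: avg_def k_def)
  also have "\<dots> = (\<integral>y. g y * (\<integral>w. f w * k w y \<partial>lborel) \<partial>lborel)"
    by (rule lborel_pair.integrable_mult_bounded_kernel(2)[OF f'(1) g'(1) k_meas k_le])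
  also have "\<dots> \<ge> (\<integral>y. g y * (avg f u (x + y) - avg g (avg f u) x)\<^sup>2 \<partial>lborel)"
  proof (rule integral_mono)
    show "integrable lborel (\<lambda>y. g y * (avg f u (x + y) - avg g (avg f u) x)\<^sup>2)"
      by (rule avg_integrable[OF g'(1) bounded_measurable_power2_diff[OF fu]])
    have "integrable (lborel \<Otimes>\<^sub>M lborel) (\<lambda>(w, y). f w * g y * k w y)"
      by (rule lborel_pair.integrable_mult_bounded_kernel(1)[OF f'(1) g'(1) k_meas k_le])
    from lborel_pair.integrable_snd[OF this]
    have "integrable lborel (\<lambda>y. \<integral>w. f w * g y * k w y \<partial>lborel)" .
    moreover have "(\<integral>w. f w * g y * k w y \<partial>lborel) = g y * (\<integral>w. f w * k w y \<partial>lborel)" for y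
      by (subst integral_mult_right_zero[symmetric]) (simp only: mult_ac)
    ultimately show "integrable lborel (\<lambda>y. g y * (\<integral>w. f w * k w y \<partial>lborel))" by simp
    fix y
    define v where "v w = u (w + y) - avg g u w" for w
    have v: "bounded_measurable v (2 * B)"
      unfolding bounded_measurable_def
    proof
      show "v \<in> borel_measurable borel" unfolding v_def[abs_def] by measurable
      show "\<forall>w. \<bar>v w\<bar> \<le> 2 * B"
      proof
        fix w show "\<bar>v w\<bar> \<le> 2 * B"
          using bounded_measurableD(2)[OF u, of "w + y"] bounded_measurableD(2)[OF gu, of w] by (simp add: v_def)
      qed
    qed
    have us: "bounded_measurable (\<lambda>w. u (w + y)) B"
      using u by (auto simp: bounded_measurable_def)
    have "avg f v x = avg f (\<lambda>w. u (w + y)) x - avg f (avg g u) x"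
      unfolding v_def[abs_def] by (rule avg_diff[OF f'(1) us gu])
    also have "avg f (\<lambda>w. u (w + y)) x = avg f u (x + y)" by (simp add: avg_def add_ac)
    also have "avg f (avg g u) x = avg g (avg f u) x" by (rule avg_avg_swap[OF f'(1) g'(1) u])
    finally have "(avg f u (x + y) - avg g (avg f u) x)\<^sup>2 \<le> avg f (\<lambda>w. (v w)\<^sup>2) x"
      using avg_jensen[OF f v, of x 0] by simp
    also have "avg f (\<lambda>w. (v w)\<^sup>2) x = (\<integral>w. f w * k w y \<partial>lborel)" by (simp add: avg_def v_def k_def add_ac)
    finally show "g y * (avg f u (x + y) - avg g (avg f u) x)\<^sup>2 \<le> g y * (\<integral>w. f w * k w y \<partial>lborel)"
      using g'(4)[of y] by (rule mult_left_mono)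
  qed
  also have "(\<integral>y. g y * (avg f u (x + y) - avg g (avg f u) x)\<^sup>2 \<partial>lborel) = avg_var g (avg f u) x"
    unfolding avg_var_eq[OF g fu] by (simp add: avg_def[of g "\<lambda>y. (avg f u y - avg g (avg f u) x)\<^sup>2"])
  finally show ?thesis using var by simp
qed

text \<open>Young's inequality. It is used with \<open>\<epsilon> = h * m\<close>, for which
  \<open>h * (1 + 1 / \<epsilon>) * m\<close> equals \<open>1 + \<epsilon>\<close>: after
  integration against a measure of mass \<open>m\<close> both terms carry the same factor.\<close>

lemma weighted_square_le:
  fixes a b c \<epsilon> :: real
  assumes "\<epsilon> > 0"
  shows "(b - a)\<^sup>2 \<le> (1 + \<epsilon>) * (b - c)\<^sup>2 + (1 + 1 / \<epsilon>) * (a - c)\<^sup>2"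
proof -
  have "0 \<le> (\<epsilon> * (b - c) + (a - c))\<^sup>2 / \<epsilon>" using assms by simp
  also have "\<dots> = \<epsilon> * (b - c)\<^sup>2 + 2 * (b - c) * (a - c) + (a - c)\<^sup>2 / \<epsilon>"
    using assms by (simp add: field_simps power2_eq_square)
  also have "\<dots> = (1 + \<epsilon>) * (b - c)\<^sup>2 + (1 + 1 / \<epsilon>) * (a - c)\<^sup>2 - (b - a)\<^sup>2"
    using assms by (simp add: field_simps power2_eq_square)
  finally show ?thesis by simp
qed

context stable_index begin

abbreviation stable_avg :: "real \<Rightarrow> ('a::euclidean_space \<Rightarrow> real) \<Rightarrow> 'a \<Rightarrow> real" where
  "stable_avg t \<equiv> avg (stable_density \<alpha> t)"

abbreviation stable_var :: "real \<Rightarrow> ('a::euclidean_space \<Rightarrow> real) \<Rightarrow> 'a \<Rightarrow> real" where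
  "stable_var t \<equiv> avg_var (stable_density \<alpha> t)"

lemma stable_avg_semigroup:
  assumes "s > 0" "t > 0" and u: "bounded_measurable u B"
  shows "stable_avg s (stable_avg t u) = stable_avg (s + t) u"
  using avg_convolution(2)[OF prob_densityD(1)[OF stable_prob_density(1)[OF assms(1)]]
      prob_densityD(1)[OF stable_prob_density(1)[OF assms(2)]] u]
  by (simp add: stable_density_semigroup[OF assms(1,2)] fun_eq_iff)

lemma stable_var_double:
  assumes s: "s > 0" and u: "bounded_measurable u B"
  shows "2 * stable_var s (stable_avg s u) x \<le> stable_var (s + s) u x"
  using avg_var_superadditive[OF stable_prob_density(1)[OF s] stable_prob_density(1)[OF s] u
      stable_density_semigroup[OF s s, symmetric], of x] by simp

text \<open>Each induction step halves the time step by \<open>stable_var_double\<close> and passes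
  one half to the semigroup. The exponent starts at one because the semigroup is used at positive
  times only.\<close>

lemma stable_var_dyadic:
  assumes t: "t > 0" and u: "bounded_measurable u B"
  shows "2 ^ Suc n * stable_var (t / 2 ^ Suc n) (stable_avg (t - t / 2 ^ Suc n) u) x \<le> stable_var t u x"
proof (induction n)
  case 0
  then show ?case using stable_var_double[of "t / 2" u B x] t u by simp
next
  case (Suc n)
  define s where "s = t / 2 ^ Suc (Suc n)"
  have s: "s > 0" using t by (simp add: s_def)
  have ss: "t / 2 ^ Suc n = s + s" by (simp add: s_def)
  have "s + s \<le> t / 2"
    unfolding ss[symmetric] using t by (intro divide_left_mono) auto
  then have ts: "t - (s + s) > 0" using t by linarith
  have sum: "s + (t - (s + s)) = t - s" by simp
  note v = avg_bounded_measurable[OF stable_prob_density(1)[OF ts] u]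
  have "2 ^ Suc (Suc n) * stable_var s (stable_avg (t - s) u) x = 2 ^ Suc n * (2 * stable_var s (stable_avg (t - s) u) x)"
    by simp
  also have "\<dots> \<le> 2 ^ Suc n * stable_var (s + s) (stable_avg (t - (s + s)) u) x"
    using stable_var_double[OF s v, of x] unfolding stable_avg_semigroup[OF s ts u] sum by simp
  also have "\<dots> \<le> stable_var t u x" using Suc.IH unfolding ss .
  finally show ?case unfolding s_def .
qed

section \<open>The variance over a short time, bounded below by a single jump\<close>

context
  fixes \<delta> h :: real
  assumes \<delta>: "\<delta> > 0" and h: "h > 0"
begin

lemma trunc_mass_pos: "0 < (\<integral>s. trunc_weight \<alpha> \<delta> s \<partial>lborel)"
proof -
  \<comment> \<open>The mass does not depend on the dimension, so its positivity can be checked on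
    the real line.\<close>
  let ?L = "trunc_levy \<alpha> \<delta> :: real \<Rightarrow> real"
  have "integral\<^sup>L lborel ?L \<noteq> 0"
  proof
    assume "integral\<^sup>L lborel ?L = 0"
    then have "AE z in lborel. ?L z = 0"
      by (subst (asm) integral_nonneg_eq_0_iff_AE[OF trunc_levy_integrable[OF \<delta>]])
         (auto intro: trunc_levy_nonneg[OF \<delta>])
    then have "AE z in lborel. z \<notin> {0<..1::real}"
      by eventually_elim (metis less_irrefl trunc_levy_pos[OF \<delta>])
    then have "emeasure lborel {0<..1::real} = 0" by (subst (asm) AE_iff_measurable[of "{0<..1}"]) auto
    then show False by simp
  qed
  moreover have "0 \<le> integral\<^sup>L lborel ?L"
    by (intro Bochner_Integration.integral_nonneg trunc_levy_nonneg \<delta>)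
  ultimately show ?thesis unfolding trunc_levy_mass[OF \<delta>, where 'a=real] by simp
qed

text \<open>Inserting the lower bound for the density, Jensen removes the remainder averages. The
  jump-free part then contributes \<open>(R x - c)\<^sup>2\<close> and the one-jump part the squares
  of \<open>R (x + z) - c\<close>; together they pay for recentring from the mean \<open>c\<close>
  to \<open>R x\<close>.\<close>

lemma stable_var_ge_jump:
  fixes x :: "'a::euclidean_space" and u :: "'a \<Rightarrow> real"
  assumes u: "bounded_measurable u B"
  defines "m \<equiv> (\<integral>s. trunc_weight \<alpha> \<delta> s \<partial>lborel)"
    and "R \<equiv> avg (remainder_density \<alpha> \<delta> h) u"
  shows "exp (- h * m) / (1 + h * m) * (h * (\<integral>z. trunc_levy \<alpha> \<delta> z * (R (x + z) - R x)\<^sup>2 \<partial>lborel)) \<le> stable_var h u x"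
proof -
  let ?p = "stable_density \<alpha> h :: 'a \<Rightarrow> real" and ?r = "remainder_density \<alpha> \<delta> h :: 'a \<Rightarrow> real"
  let ?L = "trunc_levy \<alpha> \<delta> :: 'a \<Rightarrow> real"
  \<comment> \<open>With the mean frozen as a constant, the variance is the integral of the
    nonnegative \<open>q\<close> against the density, hence monotone in the density.\<close>
  define c where "c = avg ?p u x"
  let ?Ic = "\<integral>z. ?L z * (R (x + z) - c)\<^sup>2 \<partial>lborel"
  let ?Ia = "\<integral>z. ?L z * (R (x + z) - R x)\<^sup>2 \<partial>lborel"
  define q where "q y = (u y - c)\<^sup>2" for y
  have p: "prob_density ?p" by (rule stable_prob_density[OF h])
  have r: "prob_density ?r" by (rule remainder_prob_density[OF \<delta> h])
  note p' = prob_densityD[OF p] and r' = prob_densityD[OF r]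
  have L: "integrable lborel ?L" by (rule trunc_levy_integrable[OF \<delta>])
  have q: "bounded_measurable q ((B + \<bar>c\<bar>)\<^sup>2)"
    unfolding q_def[abs_def] by (rule bounded_measurable_power2_diff[OF u])
  have m: "m > 0" unfolding m_def by (rule trunc_mass_pos)
  have Lm: "(\<integral>z. ?L z \<partial>lborel) = m" unfolding m_def by (rule trunc_levy_mass[OF \<delta>])
  have R: "bounded_measurable R B" unfolding R_def by (rule avg_bounded_measurable[OF r u])
  note RLi = avg_integrable[OF L bounded_measurable_power2_diff[OF R]]
  have hm: "h * m > 0" using h m by simp
  let ?conv = "\<lambda>y. \<integral>z. ?L z * ?r (y - z) \<partial>lborel"
  have "exp (- h * m) * ((R x - c)\<^sup>2 + h * (?Ic))
      \<le> exp (- h * m) * (avg ?r q x + h * avg ?conv q x)"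
  proof (intro mult_left_mono add_mono)
    show "(R x - c)\<^sup>2 \<le> avg ?r q x"
      unfolding R_def q_def by (rule avg_jensen[OF r u])
    have "(?Ic) \<le> (\<integral>z. ?L z * avg ?r q (x + z) \<partial>lborel)"
    proof (rule integral_mono)
      show "integrable lborel (\<lambda>z. ?L z * avg ?r q (x + z))"
        by (rule avg_integrable[OF L avg_bounded_measurable[OF r q]])
      show "?L z * (R (x + z) - c)\<^sup>2 \<le> ?L z * avg ?r q (x + z)" for z
        unfolding R_def q_def by (intro mult_left_mono avg_jensen[OF r u] trunc_levy_nonneg \<delta>)
    qed (rule RLi)
    also have "\<dots> = avg ?conv q x"
      using avg_convolution(2)[OF L r'(1) q, of x] by (simp add: avg_def[of ?L])
    finally show "(?Ic) \<le> avg ?conv q x" .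
  qed (use h in auto)
  also have "\<dots> = (\<integral>y. exp (- h * m) * (?r y + h * ?conv y) * q (x + y) \<partial>lborel)"
  proof -
    have "(\<integral>y. exp (- h * m) * (?r y + h * ?conv y) * q (x + y) \<partial>lborel)
      = (\<integral>y. exp (- h * m) * (?r y * q (x + y) + h * (?conv y * q (x + y))) \<partial>lborel)"
      by (simp add: algebra_simps)
    then show ?thesis
      using avg_convolution(1)[OF L r'(1) q, of x] avg_integrable[OF r'(1) q, of x] by (simp add: avg_def)
  qed
  also have "\<dots> \<le> (\<integral>y. ?p y * q (x + y) \<partial>lborel)"
  proof (rule integral_mono)
    show "exp (- h * m) * (?r y + h * ?conv y) * q (x + y) \<le> ?p y * q (x + y)" for y
      unfolding m_def by (rule mult_right_mono[OF stable_density_ge[OF \<delta> h]]) (simp add: q_def)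
    have "integrable lborel (\<lambda>y. exp (- h * m) * (?r y * q (x + y) + h * (?conv y * q (x + y))))"
      by (intro integrable_mult_right Bochner_Integration.integrable_add avg_convolution(1)[OF L r'(1) q] avg_integrable[OF r'(1) q])
    then show "integrable lborel (\<lambda>y. exp (- h * m) * (?r y + h * ?conv y) * q (x + y))"
      by (simp add: algebra_simps)
  qed (rule avg_integrable[OF p'(1) q])
  also have "\<dots> = stable_var h u x"
  proof -
    have "avg_var ?p u x = avg ?p q x" unfolding avg_var_eq[OF p u] q_def[abs_def] c_def ..
    then show ?thesis by (simp add: avg_def[of ?p q])
  qed
  finally have 1: "exp (- h * m) * ((R x - c)\<^sup>2 + h * (?Ic)) \<le> stable_var h u x" .
  \<comment> \<open>Recentring by Young's inequality at \<open>\<epsilon> = h * m\<close>; the total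
    cost is the factor \<open>1 + h * m\<close>, which disappears as h tends to 0.\<close>
  have "(?Ia)
      \<le> (\<integral>z. (1 + h * m) * (?L z * (R (x + z) - c)\<^sup>2) + (1 + 1 / (h * m)) * (R x - c)\<^sup>2 * ?L z \<partial>lborel)"
  proof (rule integral_mono)
    show "?L z * (R (x + z) - R x)\<^sup>2 \<le> (1 + h * m) * (?L z * (R (x + z) - c)\<^sup>2) + (1 + 1 / (h * m)) * (R x - c)\<^sup>2 * ?L z" for z
      using mult_left_mono[OF weighted_square_le[OF hm, of "R (x + z)" "R x" c] trunc_levy_nonneg[OF \<delta>, of \<alpha> z]]
      by (simp add: distrib_left mult_ac)
    show "integrable lborel (\<lambda>z. (1 + h * m) * (?L z * (R (x + z) - c)\<^sup>2) + (1 + 1 / (h * m)) * (R x - c)\<^sup>2 * ?L z)"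
      by (intro Bochner_Integration.integrable_add integrable_mult_right RLi L)
  qed (rule RLi)
  also have "\<dots> = (1 + h * m) * (?Ic) + (1 + 1 / (h * m)) * (R x - c)\<^sup>2 * m"
    using RLi[of x c] L by (simp add: Lm)
  finally have "h * (?Ia)
      \<le> h * ((1 + h * m) * (?Ic) + (1 + 1 / (h * m)) * (R x - c)\<^sup>2 * m)"
    using h by (intro mult_left_mono) auto
  also have "\<dots> = (1 + h * m) * ((R x - c)\<^sup>2 + h * (?Ic))"
    using h m by (simp add: field_simps)
  finally have 2: "h * (?Ia) / (1 + h * m)
      \<le> (R x - c)\<^sup>2 + h * (?Ic)"
    using hm by (subst pos_divide_le_eq) (auto simp: mult.commute)
  have "exp (- h * m) * (h * (?Ia) / (1 + h * m))
      \<le> exp (- h * m) * ((R x - c)\<^sup>2 + h * (?Ic))"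
    by (rule mult_left_mono[OF 2]) simp
  with 1 show ?thesis by simp
qed

text \<open>The stable density dominates \<open>exp (- h * m)\<close> times the remainder density.
  As both have mass one, their L1 distance is at most
  \<open>2 * (1 - exp (- h * m))\<close>.\<close>

lemma remainder_avg_diff_le:
  fixes x :: "'a::euclidean_space"
  assumes u: "bounded_measurable u B"
  defines "m \<equiv> (\<integral>s. trunc_weight \<alpha> \<delta> s \<partial>lborel)"
  shows "\<bar>avg (remainder_density \<alpha> \<delta> h) u x - stable_avg h u x\<bar> \<le> 2 * B * (1 - exp (- h * m))"
proof -
  let ?p = "stable_density \<alpha> h :: 'a \<Rightarrow> real" and ?r = "remainder_density \<alpha> \<delta> h :: 'a \<Rightarrow> real"
  define e where "e = exp (- h * m)"
  have p: "prob_density ?p" by (rule stable_prob_density[OF h])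
  have r: "prob_density ?r" by (rule remainder_prob_density[OF \<delta> h])
  note p' = prob_densityD[OF p] and r' = prob_densityD[OF r]
  have B: "0 \<le> B" by (rule bounded_measurable_nonneg[OF u])
  have m: "m > 0" unfolding m_def by (rule trunc_mass_pos)
  have e: "0 < e" "e \<le> 1" using h m by (auto simp: e_def)
  have ge: "e * ?r y \<le> ?p y" for y
  proof -
    have "0 \<le> (\<integral>z. trunc_levy \<alpha> \<delta> z * ?r (y - z) \<partial>lborel)"
      by (intro Bochner_Integration.integral_nonneg mult_nonneg_nonneg trunc_levy_nonneg \<delta> r'(4))
    then have "e * ?r y \<le> e * (?r y + h * (\<integral>z. trunc_levy \<alpha> \<delta> z * ?r (y - z) \<partial>lborel))"
      using e h by (intro mult_left_mono) auto
    also have "\<dots> \<le> ?p y" unfolding e_def m_def by (rule stable_density_ge[OF \<delta> h])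
    finally show ?thesis .
  qed
  have "avg ?r u x - avg ?p u x = (\<integral>y. (?r y - ?p y) * u (x + y) \<partial>lborel)"
    unfolding avg_def left_diff_distrib
    by (rule Bochner_Integration.integral_diff[symmetric]) (intro avg_integrable[OF _ u] p' r')+
  also have "\<bar>\<dots>\<bar> \<le> (\<integral>y. \<bar>(?r y - ?p y) * u (x + y)\<bar> \<partial>lborel)" by (rule integral_abs_bound)
  also have "\<dots> \<le> (\<integral>y. ((?p y - e * ?r y) + (1 - e) * ?r y) * B \<partial>lborel)"
  proof (rule integral_mono)
    have i: "integrable lborel (\<lambda>y. ?r y - ?p y)" using p' r' by simp
    show "integrable lborel (\<lambda>y. \<bar>(?r y - ?p y) * u (x + y)\<bar>)" by (intro integrable_abs avg_integrable[OF i u])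
    show "integrable lborel (\<lambda>y. ((?p y - e * ?r y) + (1 - e) * ?r y) * B)" using p' r' by simp
    fix y
    have "0 \<le> (1 - e) * ?r y" using e r'(4) by simp
    then have "\<bar>?r y - ?p y\<bar> \<le> (?p y - e * ?r y) + (1 - e) * ?r y"
      using ge[of y] by (simp add: algebra_simps abs_le_iff)
    then show "\<bar>(?r y - ?p y) * u (x + y)\<bar> \<le> ((?p y - e * ?r y) + (1 - e) * ?r y) * B"
      unfolding abs_mult using bounded_measurableD(2)[OF u] by (intro mult_mono) auto
  qed
  also have "\<dots> = 2 * B * (1 - e)" using p' r' by (simp add: algebra_simps)
  finally show ?thesis unfolding e_def .
qed

end

section \<open>Passage to the limit: short times, then small jumps\<close>

text \<open>The number of pieces times their length is \<open>t\<close>, so the factor h of the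
  one-jump bound adds up to \<open>t\<close>. With \<delta> fixed, \<open>h n * m\<close> tends to
  0; hence the loss factor tends to 1, and the remainder average of P_(t-h) u approaches P_h P_(t-h)
  u, which is P_t u.\<close>

lemma stable_var_ge_truncated:
  fixes x :: "'a::euclidean_space" and u :: "'a \<Rightarrow> real"
  assumes \<delta>: "\<delta> > 0" and t: "t > 0" and u: "bounded_measurable u B"
  shows "t * (\<integral>z. trunc_levy \<alpha> \<delta> z * (stable_avg t u (x + z) - stable_avg t u x)\<^sup>2 \<partial>lborel) \<le> stable_var t u x"
proof -
  define m where "m = (\<integral>s. trunc_weight \<alpha> \<delta> s \<partial>lborel)"
  define h where "h n = t / 2 ^ Suc n" for n
  define F where "F n = avg (remainder_density \<alpha> \<delta> (h n)) (stable_avg (t - h n) u)" for n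
  let ?I = "\<lambda>n. \<integral>z. trunc_levy \<alpha> \<delta> z * (F n (x + z) - F n x)\<^sup>2 \<partial>lborel"
  let ?J = "\<integral>z. trunc_levy \<alpha> \<delta> z * (stable_avg t u (x + z) - stable_avg t u x)\<^sup>2 \<partial>lborel"
  have h: "h n > 0" for n using t by (simp add: h_def)
  have h_le: "h n \<le> t / 2" for n unfolding h_def using t by (intro divide_left_mono) auto
  have th: "t - h n > 0" for n using t h_le[of n] by linarith
  have "(\<lambda>n. inverse (2 ^ n :: real)) \<longlonglongrightarrow> 0" by (rule LIMSEQ_inverse_realpow_zero) simp
  from tendsto_mult_left[OF this, of "t / 2"]
  have "(\<lambda>n. t / 2 * inverse (2 ^ n)) \<longlonglongrightarrow> 0" by (simp only: mult_zero_right)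
  moreover have "t / 2 * inverse (2 ^ n) = h n" for n unfolding h_def by (simp add: field_simps)
  ultimately have h_lim: "h \<longlonglongrightarrow> 0" by (simp only:)
  note v = avg_bounded_measurable[OF stable_prob_density(1)[OF th] u]
  have Fb: "bounded_measurable (F n) B" for n
    unfolding F_def by (rule avg_bounded_measurable[OF remainder_prob_density[OF \<delta> h] v])
  have L: "integrable lborel (trunc_levy \<alpha> \<delta> :: 'a \<Rightarrow> real)" by (rule trunc_levy_integrable[OF \<delta>])
  have B: "0 \<le> B" by (rule bounded_measurable_nonneg[OF u])
  have t_eq: "t * (A * I) = 2 ^ Suc n * (A * (h n * I))" for n and A I :: real
  proof -
    have "2 ^ Suc n * (A * (h n * I)) = (2 ^ Suc n * h n) * (A * I)" by (simp only: mult_ac)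
    then show ?thesis by (simp add: h_def)
  qed
  have step: "t * (exp (- h n * m) / (1 + h n * m) * (?I n)) \<le> stable_var t u x" for n
  proof -
    have "2 ^ Suc n * (exp (- h n * m) / (1 + h n * m) * (h n * (?I n)))
      \<le> 2 ^ Suc n * stable_var (h n) (stable_avg (t - h n) u) x"
      unfolding F_def m_def by (intro mult_left_mono stable_var_ge_jump[OF \<delta> h v]) simp
    also have "\<dots> \<le> stable_var t u x" unfolding h_def by (rule stable_var_dyadic[OF t u])
    finally show ?thesis unfolding t_eq[of _ _ n] .
  qed
  have F_lim: "(\<lambda>n. F n y) \<longlonglongrightarrow> stable_avg t u y" for y
  proof -
    have "\<bar>F n y - stable_avg t u y\<bar> \<le> 2 * B * (1 - exp (- h n * m))" for n
      using remainder_avg_diff_le[OF \<delta> h[of n] v[of n], of y] stable_avg_semigroup[OF h[of n] th[of n] u]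
      by (simp add: F_def m_def)
    moreover have "(\<lambda>n. 2 * B * (1 - exp (- h n * m))) \<longlonglongrightarrow> 2 * B * (1 - exp (- 0 * m))"
      by (intro tendsto_intros h_lim)
    then have "(\<lambda>n. 2 * B * (1 - exp (- h n * m))) \<longlonglongrightarrow> 0" by simp
    ultimately have "(\<lambda>n. F n y - stable_avg t u y) \<longlonglongrightarrow> 0"
      by - (rule Lim_null_comparison[where g="\<lambda>n. 2 * B * (1 - exp (- h n * m))"], simp_all)
    then show ?thesis by (simp add: LIM_zero_iff)
  qed
  have [measurable]: "F n \<in> borel_measurable borel" for n by (rule bounded_measurableD[OF Fb])
  have [measurable]: "stable_avg t u \<in> borel_measurable borel"
    by (rule bounded_measurableD[OF avg_bounded_measurable[OF stable_prob_density(1)[OF t] u]])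
  have "(\<lambda>n. ?I n)
    \<longlonglongrightarrow> (?J)"
  proof (rule integral_dominated_convergence[where w="\<lambda>z. trunc_levy \<alpha> \<delta> z * (2 * B)\<^sup>2"])
    have "(F n (x + z) - F n x)\<^sup>2 \<le> (2 * B)\<^sup>2" for n z
    proof -
      have "\<bar>F n (x + z) - F n x\<bar> \<le> 2 * B"
        using bounded_measurableD(2)[OF Fb, of n "x + z"] bounded_measurableD(2)[OF Fb, of n x] by linarith
      then have "\<bar>F n (x + z) - F n x\<bar>\<^sup>2 \<le> (2 * B)\<^sup>2" by (intro power_mono) auto
      then show ?thesis by simp
    qed
    then show "AE z in lborel. norm (trunc_levy \<alpha> \<delta> z * (F n (x + z) - F n x)\<^sup>2) \<le> trunc_levy \<alpha> \<delta> z * (2 * B)\<^sup>2" for n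
      by (intro AE_I2) (simp add: abs_mult abs_of_nonneg[OF trunc_levy_nonneg[OF \<delta>]] mult_left_mono trunc_levy_nonneg[OF \<delta>])
    show "AE z in lborel. (\<lambda>n. trunc_levy \<alpha> \<delta> z * (F n (x + z) - F n x)\<^sup>2)
      \<longlonglongrightarrow> trunc_levy \<alpha> \<delta> z * (stable_avg t u (x + z) - stable_avg t u x)\<^sup>2"
      by (intro AE_I2 tendsto_intros F_lim)
  qed (use L in auto)
  then have "(\<lambda>n. t * (exp (- h n * m) / (1 + h n * m) * (?I n)))
    \<longlonglongrightarrow> t * (exp (- 0 * m) / (1 + 0 * m) * (?J))"
    by (intro tendsto_intros h_lim) auto
  then have "t * (exp (- 0 * m) / (1 + 0 * m) * (?J)) \<le> stable_var t u x"
    by (rule LIMSEQ_le_const2) (use step in auto)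
  then show ?thesis by simp
qed

text \<open>Only now does \<delta> tend to 0. The truncated forms are bounded uniformly by the
  variance, so Fatou's lemma suffices; working in \<open>ennreal\<close> makes finiteness of the
  jump form part of the conclusion.\<close>

lemma stable_var_ge_energy:
  fixes x :: "'a::euclidean_space" and u :: "'a \<Rightarrow> real"
  assumes t: "t > 0" and u: "bounded_measurable u B"
  shows "ennreal t * (\<integral>\<^sup>+z. ennreal (levy_density \<alpha> z * (stable_avg t u (x + z) - stable_avg t u x)\<^sup>2) \<partial>lborel)
    \<le> ennreal (stable_var t u x)"
proof -
  define \<delta> where "\<delta> n = inverse (real (Suc n))" for n
  have \<delta>: "\<delta> n > 0" for n by (simp add: \<delta>_def)
  have \<delta>_lim: "\<delta> \<longlonglongrightarrow> 0" unfolding \<delta>_def[abs_def] by (rule LIMSEQ_inverse_real_of_nat)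
  define D where "D z = (stable_avg t u (x + z) - stable_avg t u x)\<^sup>2" for z
  note Pb = avg_bounded_measurable[OF stable_prob_density(1)[OF t] u]
  have [measurable]: "stable_avg t u \<in> borel_measurable borel" by (rule bounded_measurableD[OF Pb])
  have [measurable]: "D \<in> borel_measurable borel" unfolding D_def[abs_def] by measurable
  have lim: "AE z in lborel. liminf (\<lambda>n. ennreal (trunc_levy \<alpha> (\<delta> n) z * D z)) = ennreal (levy_density \<alpha> z * D z)"
  proof -
    have "AE z in lborel. z \<noteq> (0::'a)" by (rule AE_lborel_singleton)
    then show ?thesis
    proof eventually_elim
      fix z :: 'a assume "z \<noteq> 0"
      then have "(\<lambda>n. ennreal (trunc_levy \<alpha> (\<delta> n) z * D z)) \<longlonglongrightarrow> ennreal (levy_density \<alpha> z * D z)"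
        by (intro tendsto_ennrealI tendsto_intros trunc_levy_LIMSEQ \<delta> \<delta>_lim)
      then show "liminf (\<lambda>n. ennreal (trunc_levy \<alpha> (\<delta> n) z * D z)) = ennreal (levy_density \<alpha> z * D z)"
        by (intro lim_imp_Liminf) auto
    qed
  qed
  have le: "(\<integral>\<^sup>+z. ennreal (trunc_levy \<alpha> (\<delta> n) z * D z) \<partial>lborel) \<le> ennreal (stable_var t u x / t)" for n
  proof -
    have i: "integrable lborel (\<lambda>z. trunc_levy \<alpha> (\<delta> n) z * D z)"
      unfolding D_def by (rule avg_integrable[OF trunc_levy_integrable[OF \<delta>] bounded_measurable_power2_diff[OF Pb]])
    have "(\<integral>\<^sup>+z. ennreal (trunc_levy \<alpha> (\<delta> n) z * D z) \<partial>lborel) = ennreal (\<integral>z. trunc_levy \<alpha> (\<delta> n) z * D z \<partial>lborel)"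
      by (rule nn_integral_eq_integral[OF i]) (auto simp: D_def intro!: mult_nonneg_nonneg trunc_levy_nonneg \<delta>)
    also have "\<dots> \<le> ennreal (stable_var t u x / t)"
      using stable_var_ge_truncated[OF \<delta> t u, of n x] t by (intro ennreal_leI) (simp add: D_def field_simps)
    finally show ?thesis .
  qed
  have "(\<integral>\<^sup>+z. ennreal (levy_density \<alpha> z * D z) \<partial>lborel) = (\<integral>\<^sup>+z. liminf (\<lambda>n. ennreal (trunc_levy \<alpha> (\<delta> n) z * D z)) \<partial>lborel)"
    by (rule nn_integral_cong_AE) (use lim in \<open>auto elim: eventually_mono\<close>)
  also have "\<dots> \<le> liminf (\<lambda>n. \<integral>\<^sup>+z. ennreal (trunc_levy \<alpha> (\<delta> n) z * D z) \<partial>lborel)"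
    by (rule nn_integral_liminf) measurable
  also have "\<dots> \<le> liminf (\<lambda>n. ennreal (stable_var t u x / t))"
    by (rule Liminf_mono) (use le in auto)
  also have "\<dots> = ennreal (stable_var t u x / t)" by (simp add: Liminf_const)
  finally have "ennreal t * (\<integral>\<^sup>+z. ennreal (levy_density \<alpha> z * D z) \<partial>lborel) \<le> ennreal t * ennreal (stable_var t u x / t)"
    by (rule mult_left_mono) simp
  also have "\<dots> = ennreal (stable_var t u x)" using t by (simp flip: ennreal_mult')
  finally show ?thesis by (simp add: D_def)
qed

end

section \<open>Contraction of the chi-squared divergence\<close>

lemma bind_density_density:
  fixes r :: "'a::euclidean_space \<Rightarrow> ennreal" and k :: "'a \<Rightarrow> 'a \<Rightarrow> ennreal"
  assumes [measurable]: "r \<in> borel_measurable borel" "(\<lambda>(x, y). k x y) \<in> borel_measurable (borel \<Otimes>\<^sub>M borel)"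
    and k: "\<And>x. (\<integral>\<^sup>+y. k x y \<partial>lborel) = 1"
  shows "Giry_Monad.bind (density lborel r) (\<lambda>x. density lborel (k x)) = density lborel (\<lambda>y. \<integral>\<^sup>+x. r x * k x y \<partial>lborel)"
proof -
  let ?B = "Giry_Monad.bind (density lborel r) (\<lambda>x. density lborel (k x))"
  have k_meas: "k x \<in> borel_measurable borel" for x by measurable
  have kernel: "(\<lambda>x. density lborel (k x)) \<in> measurable (density lborel r) (subprob_algebra borel)"
  proof (rule measurable_subprob_algebra)
    show "subprob_space (density lborel (k x))" for x
      by (rule prob_space_imp_subprob_space, rule prob_spaceI) (use k in \<open>simp add: emeasure_density\<close>)
    show "(\<lambda>x. emeasure (density lborel (k x)) A) \<in> borel_measurable (density lborel r)" if "A \<in> sets borel" for A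
      using that by (simp add: emeasure_density)
  qed simp
  show ?thesis
  proof (rule measure_eqI)
    show "sets (?B) = sets (density lborel (\<lambda>y. \<integral>\<^sup>+x. r x * k x y \<partial>lborel))"
      by (subst sets_bind[where N=borel]) auto
    fix A assume "A \<in> sets (?B)"
    then have A[measurable]: "A \<in> sets borel" by (subst (asm) sets_bind[where N=borel]) auto
    have "emeasure (?B) A
      = (\<integral>\<^sup>+x. emeasure (density lborel (k x)) A \<partial>density lborel r)"
      by (rule emeasure_bind[OF _ kernel A]) simp
    also have "\<dots> = (\<integral>\<^sup>+x. (\<integral>\<^sup>+y. r x * (k x y * indicator A y) \<partial>lborel) \<partial>lborel)"
      by (subst nn_integral_density) (auto simp: emeasure_density nn_integral_cmult)
    also have "\<dots> = (\<integral>\<^sup>+y. (\<integral>\<^sup>+x. r x * (k x y * indicator A y) \<partial>lborel) \<partial>lborel)"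
      by (rule lborel_pair.Fubini') measurable
    also have "\<dots> = (\<integral>\<^sup>+y. (\<integral>\<^sup>+x. r x * k x y \<partial>lborel) * indicator A y \<partial>lborel)"
      by (simp add: nn_integral_multc mult.assoc[symmetric])
    also have "\<dots> = emeasure (density lborel (\<lambda>y. \<integral>\<^sup>+x. r x * k x y \<partial>lborel)) A"
      by (simp add: emeasure_density)
    finally show "emeasure (?B) A
      = emeasure (density lborel (\<lambda>y. \<integral>\<^sup>+x. r x * k x y \<partial>lborel)) A" .
  qed
qed

context stable_index begin

lemma stable_density_measurable[measurable]: "t > 0 \<Longrightarrow> (stable_density \<alpha> t :: 'a::euclidean_space \<Rightarrow> real) \<in> borel_measurable borel"
  by (rule prob_densityD(3)[OF stable_prob_density(1)])

lemma stable_nn_integral: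
  assumes t: "t > 0"
  shows "(\<integral>\<^sup>+y. ennreal (stable_density \<alpha> t (y - x)) \<partial>(lborel :: 'a::euclidean_space measure)) = 1"
proof -
  have [measurable]: "(stable_density \<alpha> t :: 'a \<Rightarrow> real) \<in> borel_measurable borel" using t by measurable
  have "(\<integral>\<^sup>+y. ennreal (stable_density \<alpha> t (- x + y)) \<partial>lborel) = (\<integral>\<^sup>+y. ennreal (stable_density \<alpha> t y) \<partial>(lborel :: 'a measure))"
    by (rule nn_integral_lborel_plus) measurable
  also have "\<dots> = 1" using stable_prob_density(1)[OF t, where 'a='a] by (simp add: prob_density_def)
  finally show ?thesis by simp
qed

text \<open>The law of y when x has density \<open>f\<close>. For the target it is also the
  normalizing constant in \<open>target_given\<close>.\<close>

definition evolved :: "real \<Rightarrow> ('a::euclidean_space \<Rightarrow> real) \<Rightarrow> 'a \<Rightarrow> real" where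
  "evolved t f y = (\<integral>x. f x * stable_density \<alpha> t (y - x) \<partial>lborel)"

context
  fixes t :: real and f :: "'a::euclidean_space \<Rightarrow> real"
  assumes t: "t > 0" and f: "prob_density f"
begin

lemma evolved_integrable: "integrable lborel (\<lambda>x. f x * stable_density \<alpha> t (y - x))"
proof -
  obtain B where B: "\<And>y :: 'a. stable_density \<alpha> t y \<le> B" by (rule stable_density_bounded[OF t]) blast
  have [measurable]: "(stable_density \<alpha> t :: 'a \<Rightarrow> real) \<in> borel_measurable borel" using t by measurable
  show ?thesis
    by (rule integrable_mult_bounded[OF prob_densityD(1)[OF f], where B=B])
       (use B stable_density_pos[OF t, where 'a='a] in \<open>auto simp: abs_of_pos\<close>)
qed

lemma evolved_nn_integral: "(\<integral>\<^sup>+x. ennreal (f x * stable_density \<alpha> t (y - x)) \<partial>lborel) = ennreal (evolved t f y)"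
  unfolding evolved_def
  by (rule nn_integral_eq_integral[OF evolved_integrable])
     (intro AE_I2 mult_nonneg_nonneg prob_densityD(4)[OF f] less_imp_le[OF stable_density_pos[OF t]])

text \<open>Strict positivity keeps the quotients by the law of y clear of the convention for
  division by zero.\<close>

lemma evolved_pos: "0 < evolved t f y"
proof -
  have nonneg: "0 \<le> f x * stable_density \<alpha> t (y - x)" for x
    using prob_densityD(4)[OF f] stable_density_pos[OF t, of "y - x"] by simp
  have "evolved t f y \<noteq> 0"
  proof
    assume "evolved t f y = 0"
    then have "AE x in lborel. f x * stable_density \<alpha> t (y - x) = 0"
      unfolding evolved_def by (subst (asm) integral_nonneg_eq_0_iff_AE[OF evolved_integrable]) (use nonneg in auto)
    moreover have "stable_density \<alpha> t (y - x) \<noteq> 0" for x using stable_density_pos[OF t, of "y - x"] by simp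
    ultimately have "AE x in lborel. f x = 0" by simp
    then have "(\<integral>x. f x \<partial>lborel) = 0"
      using prob_densityD(3)[OF f] by (subst integral_cong_AE[where g="\<lambda>_. 0"]) auto
    then show False using prob_densityD(2)[OF f] by simp
  qed
  moreover have "0 \<le> evolved t f y" unfolding evolved_def by (rule Bochner_Integration.integral_nonneg) (rule nonneg)
  ultimately show ?thesis by simp
qed

lemma evolved_prob_density: "prob_density (evolved t f)"
  unfolding prob_density_def
proof (intro conjI allI)
  have [measurable]: "(stable_density \<alpha> t :: 'a \<Rightarrow> real) \<in> borel_measurable borel" using t by measurable
  have [measurable]: "f \<in> borel_measurable borel" by (rule prob_densityD[OF f])
  show "evolved t f \<in> borel_measurable borel" unfolding evolved_def[abs_def] by measurable
  show "0 \<le> evolved t f x" for x using evolved_pos[of x] by simp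
  have "(\<integral>\<^sup>+y. ennreal (evolved t f y) \<partial>lborel) = (\<integral>\<^sup>+y. (\<integral>\<^sup>+x. ennreal (f x * stable_density \<alpha> t (y - x)) \<partial>lborel) \<partial>lborel)"
    by (simp add: evolved_nn_integral)
  also have "\<dots> = (\<integral>\<^sup>+x. (\<integral>\<^sup>+y. ennreal (f x * stable_density \<alpha> t (y - x)) \<partial>lborel) \<partial>lborel)"
    by (rule lborel_pair.Fubini') measurable
  also have "\<dots> = (\<integral>\<^sup>+x. ennreal (f x) \<partial>lborel)"
    using prob_densityD(4)[OF f] by (simp add: ennreal_mult' nn_integral_cmult stable_nn_integral[OF t])
  also have "\<dots> = 1" using f by (simp add: prob_density_def)
  finally show "(\<integral>\<^sup>+y. ennreal (evolved t f y) \<partial>lborel) = 1" .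
qed

lemma avg_evolved:
  assumes u: "bounded_measurable u B"
  shows "avg (evolved t f) u 0 = avg f (stable_avg t u) 0"
  using avg_convolution(2)[OF prob_densityD(1)[OF f] prob_densityD(1)[OF stable_prob_density(1)[OF t]] u, of 0]
  by (simp add: evolved_def[abs_def])

text \<open>The law of total variance for a starting point with density \<open>f\<close> followed by
  a stable jump.\<close>

lemma avg_var_evolved:
  assumes u: "bounded_measurable u B"
  shows "avg_var (evolved t f) u 0 = avg_var f (stable_avg t u) 0 + avg f (stable_var t u) 0"
  unfolding avg_var_def[abs_def] avg_evolved[OF u] avg_evolved[OF bounded_measurable_power2[OF u]]
  using avg_diff[OF prob_densityD(1)[OF f]
      avg_bounded_measurable[OF stable_prob_density(1)[OF t] bounded_measurable_power2[OF u]]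
      bounded_measurable_power2[OF avg_bounded_measurable[OF stable_prob_density(1)[OF t] u]], of 0] by simp

end

section \<open>Variance contraction, and the divergence under the forward step\<close>

lemma frac_energy_eq:
  fixes \<pi> \<phi> :: "'a::euclidean_space \<Rightarrow> real"
  assumes [measurable]: "\<phi> \<in> borel_measurable borel" "\<pi> \<in> borel_measurable borel"
  shows "frac_energy \<alpha> \<pi> \<phi> = (\<integral>\<^sup>+y. (\<integral>\<^sup>+z. ennreal (levy_density \<alpha> z * (\<phi> (y + z) - \<phi> y)\<^sup>2) \<partial>lborel) * ennreal (\<pi> y) \<partial>lborel)"
proof -
  let ?c = "frac_const DIM('a) \<alpha>"
  have c: "0 \<le> ?c"
    using Gamma_real_pos[of "(real DIM('a) + \<alpha>) / 2"] \<alpha>_pos by (simp add: frac_const_def add_nonneg_pos)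
  let ?k = "\<lambda>y x. if x = y then 0 else ennreal ((\<phi> x - \<phi> y)\<^sup>2 / norm (x - y) powr (real DIM('a) + \<alpha>))"
  have inner: "ennreal ?c * (\<integral>\<^sup>+x. ?k y x \<partial>lborel) = (\<integral>\<^sup>+z. ennreal (levy_density \<alpha> z * (\<phi> (y + z) - \<phi> y)\<^sup>2) \<partial>lborel)" for y
  proof -
    have "(\<integral>\<^sup>+x. ?k y x \<partial>lborel) = (\<integral>\<^sup>+z. ?k y (y + z) \<partial>lborel)"
      by (rule nn_integral_lborel_plus[symmetric]) measurable
    then have "ennreal ?c * (\<integral>\<^sup>+x. ?k y x \<partial>lborel) = (\<integral>\<^sup>+z. ennreal ?c * ?k y (y + z) \<partial>lborel)"
      by (simp only:) (rule nn_integral_cmult[symmetric], measurable)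
    also have "\<dots> = (\<integral>\<^sup>+z. ennreal (levy_density \<alpha> z * (\<phi> (y + z) - \<phi> y)\<^sup>2) \<partial>lborel)"
      using c by (intro nn_integral_cong) (auto simp: levy_density_def simp flip: ennreal_mult)
    finally show ?thesis .
  qed
  have "frac_energy \<alpha> \<pi> \<phi> = (\<integral>\<^sup>+y. ennreal ?c * ((\<integral>\<^sup>+x. ?k y x \<partial>lborel) * ennreal (\<pi> y)) \<partial>lborel)"
    unfolding frac_energy_def by (rule nn_integral_cmult[symmetric]) measurable
  also have "\<dots> = (\<integral>\<^sup>+y. (\<integral>\<^sup>+z. ennreal (levy_density \<alpha> z * (\<phi> (y + z) - \<phi> y)\<^sup>2) \<partial>lborel) * ennreal (\<pi> y) \<partial>lborel)"
    by (simp only: inner mult.assoc[symmetric])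
  finally show ?thesis .
qed

text \<open>The fractional Poincare inequality enters only here, for the test function \<open>stable_avg \<eta> u\<close>.\<close>

lemma variance_contraction:
  fixes \<pi> u :: "'a::euclidean_space \<Rightarrow> real"
  assumes \<pi>: "prob_density \<pi>" and fpi: "frac_poincare \<alpha> \<pi> C" and \<eta>: "\<eta> > 0" and u: "bounded_measurable u B"
  shows "(C + \<eta>) * avg_var \<pi> (stable_avg \<eta> u) 0 \<le> C * avg_var (evolved \<eta> \<pi>) u 0"
proof -
  let ?P = "stable_avg \<eta> u" and ?V = "stable_var \<eta> u"
  \<comment> \<open>The expected conditional variance of \<open>u (y)\<close> given x. By the
    reverse inequality it dominates \<open>\<eta>\<close> times the energy of
    \<open>?P\<close>.\<close>
  define E where "E = avg \<pi> ?V 0"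
  note \<pi>' = prob_densityD[OF \<pi>]
  have p: "prob_density (stable_density \<alpha> \<eta> :: 'a \<Rightarrow> real)" by (rule stable_prob_density[OF \<eta>])
  have C: "C > 0" using fpi by (simp add: frac_poincare_def)
  note Pb = avg_bounded_measurable[OF p u]
  have [measurable]: "?P \<in> borel_measurable borel" "\<pi> \<in> borel_measurable borel"
    by (rule bounded_measurableD[OF Pb], rule \<pi>')
  have V: "0 \<le> ?V y" for y by (rule avg_var_nonneg[OF p u])
  have Vb: "bounded_measurable ?V (B\<^sup>2)"
    unfolding bounded_measurable_def
  proof
    have [measurable]: "avg (stable_density \<alpha> \<eta>) (\<lambda>y. (u y)\<^sup>2) \<in> borel_measurable borel"
      by (rule bounded_measurableD[OF avg_bounded_measurable[OF p bounded_measurable_power2[OF u]]])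
    show "?V \<in> borel_measurable borel" unfolding avg_var_def[abs_def] by measurable
    show "\<forall>y. \<bar>?V y\<bar> \<le> B\<^sup>2"
      using V bounded_measurableD(2)[OF avg_bounded_measurable[OF p bounded_measurable_power2[OF u]]]
      by (auto simp: avg_var_def abs_le_iff intro: order_trans[OF diff_right_mono] dest: spec)
         (smt (verit) zero_le_power2)+
  qed
  have [measurable]: "?V \<in> borel_measurable borel" by (rule bounded_measurableD[OF Vb])
  have E0: "0 \<le> E" unfolding E_def by (rule avg_nonneg) (use \<pi>' V in auto)
  have "ennreal \<eta> * frac_energy \<alpha> \<pi> ?P
     = (\<integral>\<^sup>+y. ennreal \<eta> * (\<integral>\<^sup>+z. ennreal (levy_density \<alpha> z * (?P (y + z) - ?P y)\<^sup>2) \<partial>lborel) * ennreal (\<pi> y) \<partial>lborel)"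
    by (subst frac_energy_eq, simp, simp, subst nn_integral_cmult[symmetric])
       (auto simp: mult.assoc levy_density_def)
  also have "\<dots> \<le> (\<integral>\<^sup>+y. ennreal (?V y) * ennreal (\<pi> y) \<partial>lborel)"
    by (intro nn_integral_mono mult_right_mono stable_var_ge_energy[OF \<eta> u]) simp
  also have "\<dots> = (\<integral>\<^sup>+y. ennreal (\<pi> y * ?V (0 + y)) \<partial>lborel)"
    using V \<pi>'(4) by (simp add: mult.commute flip: ennreal_mult)
  also have "\<dots> = ennreal E"
    unfolding E_def avg_def[of \<pi>]
    by (rule nn_integral_eq_integral[OF avg_integrable[OF \<pi>'(1) Vb]]) (use V \<pi>'(4) in auto)
  finally have en: "ennreal \<eta> * frac_energy \<alpha> \<pi> ?P \<le> ennreal E" .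
  have "frac_energy \<alpha> \<pi> ?P = ennreal (1 / \<eta>) * (ennreal \<eta> * frac_energy \<alpha> \<pi> ?P)"
    using \<eta> by (simp add: mult.assoc[symmetric] flip: ennreal_mult)
  also have "\<dots> \<le> ennreal (1 / \<eta>) * ennreal E" by (intro mult_left_mono en) simp
  also have "\<dots> = ennreal (E / \<eta>)" using \<eta> E0 by (simp flip: ennreal_mult)
  finally have energy: "frac_energy \<alpha> \<pi> ?P \<le> ennreal (E / \<eta>)" .
  let ?M = "density lborel (\<lambda>x. ennreal (\<pi> x))"
  have int: "(\<integral>x. g x \<partial>?M) = avg \<pi> g 0" if [measurable]: "g \<in> borel_measurable borel" for g :: "'a \<Rightarrow> real"
    using \<pi>'(4) by (simp add: integral_density avg_def)
  have var: "(\<integral>x. (?P x - (\<integral>x. ?P x \<partial>?M))\<^sup>2 \<partial>?M) = avg_var \<pi> ?P 0"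
    unfolding avg_var_eq[OF \<pi> Pb] by (subst int, measurable) (simp only: int[of ?P, simplified])
  have "?P \<in> frac_domain \<alpha> \<pi>"
  proof -
    have "integrable ?M (\<lambda>x. (?P x)\<^sup>2)"
      using avg_integrable[OF \<pi>'(1) bounded_measurable_power2[OF Pb], of 0] \<pi>'(4) by (simp add: integrable_density)
    moreover have "frac_energy \<alpha> \<pi> ?P < \<infinity>" using energy by (rule le_less_trans) simp
    ultimately show ?thesis by (simp add: frac_domain_def)
  qed
  then have "ennreal (avg_var \<pi> ?P 0) \<le> ennreal C * frac_energy \<alpha> \<pi> ?P"
    using fpi unfolding frac_poincare_def var[symmetric] by blast
  also have "\<dots> \<le> ennreal C * ennreal (E / \<eta>)" by (intro mult_left_mono energy) simp
  also have "\<dots> = ennreal (C * (E / \<eta>))" using C E0 \<eta> by (simp flip: ennreal_mult)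
  finally have "avg_var \<pi> ?P 0 \<le> C * (E / \<eta>)" using C E0 \<eta> by simp
  then have "\<eta> * avg_var \<pi> ?P 0 \<le> C * E" using \<eta> by (simp add: field_simps)
  \<comment> \<open>Adding \<open>C\<close> times the variance of \<open>?P\<close> to both sides of
    the previous inequality makes total variance appear on the right.\<close>
  moreover have "avg_var (evolved \<eta> \<pi>) u 0 = avg_var \<pi> ?P 0 + E"
    unfolding E_def by (rule avg_var_evolved[OF \<eta> \<pi> u])
  ultimately show ?thesis by (simp add: algebra_simps)
qed

text \<open>Jensen's inequality enters through the tangent line bound \<open>h\<^sup>2 \<ge> 2 * c * h - c\<^sup>2\<close>.\<close>

lemma chi2_forward:
  fixes \<pi> \<rho> :: "'a::euclidean_space \<Rightarrow> real"
  assumes \<pi>: "prob_density \<pi>" and \<rho>: "prob_density \<rho>" and \<eta>: "\<eta> > 0"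
  shows "(\<integral>\<^sup>+y. ennreal ((evolved \<eta> \<rho> y / evolved \<eta> \<pi> y - 1)\<^sup>2 * evolved \<eta> \<pi> y) \<partial>lborel) \<le> chi2 \<rho> \<pi>"
proof (cases "chi2 \<rho> \<pi> = \<infinity>")
  case False
  let ?p = "stable_density \<alpha> \<eta> :: 'a \<Rightarrow> real"
  note \<pi>' = prob_densityD[OF \<pi>] and \<rho>' = prob_densityD[OF \<rho>]
  have [measurable]: "?p \<in> borel_measurable borel" "\<pi> \<in> borel_measurable borel" "\<rho> \<in> borel_measurable borel"
    using \<eta> \<pi>'(3) \<rho>'(3) by auto
  have p0: "0 \<le> ?p x" for x using stable_density_pos[OF \<eta>, of x] by simp
  define h where "h x = \<rho> x / \<pi> x - 1" for x
  have [measurable]: "h \<in> borel_measurable borel" unfolding h_def[abs_def] by measurable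
  let ?H = "\<lambda>y. \<integral>\<^sup>+x. ennreal ((h x)\<^sup>2 * \<pi> x * ?p (y - x)) \<partial>lborel"
  let ?X = "\<lambda>c y x. 2 * c * (\<rho> x * ?p (y - x) - \<pi> x * ?p (y - x)) - c\<^sup>2 * (\<pi> x * ?p (y - x))"
  define T where "T x = (if \<pi> x = 0 then (if \<rho> x = 0 then 0 else \<infinity>) else ennreal ((\<rho> x / \<pi> x - 1)\<^sup>2 * \<pi> x))" for x
  have [measurable]: "T \<in> borel_measurable borel" unfolding T_def[abs_def] by measurable
  have "(\<integral>\<^sup>+x. T x \<partial>lborel) \<noteq> \<infinity>" using False by (simp add: chi2_def T_def)
  then have "AE x in lborel. T x \<noteq> \<infinity>" by (intro nn_integral_PInf_AE) auto
  \<comment> \<open>Finite divergence forces \<rho> to vanish almost everywhere where \<pi> does;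
    there both sides are zero whatever the value of \<open>h\<close>.\<close>
  then have ac: "AE x in lborel. \<rho> x - \<pi> x = h x * \<pi> x"
    by eventually_elim (auto simp: T_def h_def field_simps split: if_splits)
  have point: "ennreal ((evolved \<eta> \<rho> y / evolved \<eta> \<pi> y - 1)\<^sup>2 * evolved \<eta> \<pi> y)
      \<le> (?H y)" for y
  proof (cases "(?H y) = \<infinity>")
    case finite: False
    define q where "q = evolved \<eta> \<pi> y"
    \<comment> \<open>The tangent point: as the mean of \<open>h\<close> given y, it turns the
      integrated bound \<open>2 * c * (c * q) - c\<^sup>2 * q\<close> into
      \<open>c\<^sup>2 * q\<close>.\<close>
    define c where "c = evolved \<eta> \<rho> y / q - 1"
    have q: "q > 0" unfolding q_def by (rule evolved_pos[OF \<eta> \<pi>])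
    have cq: "evolved \<eta> \<rho> y - q = c * q" using q by (simp add: c_def field_simps)
    note i\<rho> = evolved_integrable[OF \<eta> \<rho>, of y] and i\<pi> = evolved_integrable[OF \<eta> \<pi>, of y]
    have i2: "integrable lborel (\<lambda>x. (h x)\<^sup>2 * \<pi> x * ?p (y - x))"
      by (rule integrableI_nonneg) (use finite \<pi>'(4) p0 in \<open>auto simp: less_top\<close>)
    have "2 * c * (c * q) - c\<^sup>2 * q
      = (\<integral>x. ?X c y x \<partial>lborel)"
      using i\<rho> i\<pi> cq by (simp add: evolved_def[symmetric] q_def[symmetric])
    also have "\<dots> \<le> (\<integral>x. (h x)\<^sup>2 * \<pi> x * ?p (y - x) \<partial>lborel)"
    proof (rule integral_mono_AE)
      show "integrable lborel (\<lambda>x. ?X c y x)"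
        using i\<rho> i\<pi> by simp
      show "AE x in lborel. ?X c y x \<le> (h x)\<^sup>2 * \<pi> x * ?p (y - x)"
        using ac
      proof eventually_elim
        fix x assume "\<rho> x - \<pi> x = h x * \<pi> x"
        then have "(h x)\<^sup>2 * \<pi> x * ?p (y - x) - (?X c y x)
          = (h x)\<^sup>2 * \<pi> x * ?p (y - x) - (2 * c * (h x * \<pi> x * ?p (y - x)) - c\<^sup>2 * (\<pi> x * ?p (y - x)))"
          by (simp only: left_diff_distrib[symmetric])
        also have "\<dots> = (h x - c)\<^sup>2 * (\<pi> x * ?p (y - x))" by (simp add: power2_diff algebra_simps)
        also have "\<dots> \<ge> 0" using \<pi>'(4)[of x] p0[of "y - x"] by simp
        finally show "?X c y x \<le> (h x)\<^sup>2 * \<pi> x * ?p (y - x)" by simp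
      qed
    qed (rule i2)
    finally have "c\<^sup>2 * q \<le> (\<integral>x. (h x)\<^sup>2 * \<pi> x * ?p (y - x) \<partial>lborel)" by (simp add: power2_eq_square)
    then have "ennreal (c\<^sup>2 * q) \<le> ennreal (\<integral>x. (h x)\<^sup>2 * \<pi> x * ?p (y - x) \<partial>lborel)" by (rule ennreal_leI)
    also have "\<dots> = (?H y)"
      by (rule nn_integral_eq_integral[OF i2, symmetric]) (use \<pi>'(4) p0 in auto)
    finally show ?thesis by (simp add: c_def q_def)
  qed simp
  have "(\<integral>\<^sup>+y. ennreal ((evolved \<eta> \<rho> y / evolved \<eta> \<pi> y - 1)\<^sup>2 * evolved \<eta> \<pi> y) \<partial>lborel)
    \<le> (\<integral>\<^sup>+y. (?H y) \<partial>lborel)"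
    by (intro nn_integral_mono point)
  also have "\<dots> = (\<integral>\<^sup>+x. (\<integral>\<^sup>+y. ennreal ((h x)\<^sup>2 * \<pi> x * ?p (y - x)) \<partial>lborel) \<partial>lborel)"
    by (rule lborel_pair.Fubini') measurable
  also have "\<dots> = (\<integral>\<^sup>+x. ennreal ((h x)\<^sup>2 * \<pi> x) \<partial>lborel)"
  proof (rule nn_integral_cong)
    fix x
    have "(\<integral>\<^sup>+y. ennreal ((h x)\<^sup>2 * \<pi> x * ?p (y - x)) \<partial>lborel) = (\<integral>\<^sup>+y. ennreal ((h x)\<^sup>2 * \<pi> x) * ennreal (?p (y - x)) \<partial>lborel)"
      using \<pi>'(4) p0 by (intro nn_integral_cong) (auto simp: ennreal_mult)
    also have "\<dots> = ennreal ((h x)\<^sup>2 * \<pi> x)"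
      by (subst nn_integral_cmult) (auto simp: stable_nn_integral[OF \<eta>])
    finally show "(\<integral>\<^sup>+y. ennreal ((h x)\<^sup>2 * \<pi> x * ?p (y - x)) \<partial>lborel) = ennreal ((h x)\<^sup>2 * \<pi> x)" .
  qed
  also have "\<dots> \<le> chi2 \<rho> \<pi>"
    unfolding chi2_def by (intro nn_integral_mono) (auto simp: h_def)
  finally show ?thesis .
qed simp

end

section \<open>One iteration of the sampler\<close>

context stable_index begin

text \<open>
  The density ratio of the next iterate to the target; extended real valued because it may be
  infinite on a null set.
\<close>

definition next_ratio :: "real \<Rightarrow> ('a::euclidean_space \<Rightarrow> real) \<Rightarrow> ('a \<Rightarrow> real) \<Rightarrow> 'a \<Rightarrow> ennreal" where
  "next_ratio \<eta> \<pi> \<rho> x = (\<integral>\<^sup>+y. ennreal (stable_density \<alpha> \<eta> (y - x) * (evolved \<eta> \<rho> y / evolved \<eta> \<pi> y)) \<partial>lborel)"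

text \<open>\<open>enn2real\<close> sends infinity to 0. By \<open>next_ratio_finite\<close> this
  alters the density on a null set only.\<close>

definition next_density :: "real \<Rightarrow> ('a::euclidean_space \<Rightarrow> real) \<Rightarrow> ('a \<Rightarrow> real) \<Rightarrow> 'a \<Rightarrow> real" where
  "next_density \<eta> \<pi> \<rho> x = \<pi> x * enn2real (next_ratio \<eta> \<pi> \<rho> x)"

context
  fixes \<eta> :: real and \<pi> \<rho> :: "'a::euclidean_space \<Rightarrow> real"
  assumes \<eta>: "\<eta> > 0" and \<pi>: "prob_density \<pi>" and \<rho>: "prob_density \<rho>"
begin

lemma sampler_step_measurable:
  "(stable_density \<alpha> \<eta> :: 'a \<Rightarrow> real) \<in> borel_measurable borel" "\<pi> \<in> borel_measurable borel" "\<rho> \<in> borel_measurable borel"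
  "evolved \<eta> \<pi> \<in> borel_measurable borel" "evolved \<eta> \<rho> \<in> borel_measurable borel"
  "next_ratio \<eta> \<pi> \<rho> \<in> borel_measurable borel"
proof -
  show [measurable]: "(stable_density \<alpha> \<eta> :: 'a \<Rightarrow> real) \<in> borel_measurable borel" using \<eta> by measurable
  show "\<pi> \<in> borel_measurable borel" "\<rho> \<in> borel_measurable borel"
    by (rule prob_densityD(3), fact)+
  show [measurable]: "evolved \<eta> \<pi> \<in> borel_measurable borel" "evolved \<eta> \<rho> \<in> borel_measurable borel"
    by (rule prob_densityD(3)[OF evolved_prob_density[OF \<eta>]], fact)+
  show "next_ratio \<eta> \<pi> \<rho> \<in> borel_measurable borel"
    unfolding next_ratio_def[abs_def] by measurable
qed

text \<open>Bayes' rule: the normalizing constant of the backward kernel divides the current law of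
  y, so relative to \<pi> the new density is P applied to the ratio of the two laws of y.\<close>

lemma sampler_step_bind:
  "Giry_Monad.bind (Giry_Monad.bind (density lborel (\<lambda>x. ennreal (\<rho> x))) (forward_kernel \<alpha> \<eta>)) (backward_kernel \<alpha> \<eta> \<pi>)
    = density lborel (\<lambda>x. ennreal (\<pi> x) * next_ratio \<eta> \<pi> \<rho> x)"
proof -
  note [measurable] = sampler_step_measurable
  let ?p = "stable_density \<alpha> \<eta> :: 'a \<Rightarrow> real"
  let ?T = "\<lambda>y x. \<pi> x * ?p (y - x) / evolved \<eta> \<pi> y"
  let ?S = "Giry_Monad.bind (density lborel (\<lambda>x. ennreal (\<rho> x))) (forward_kernel \<alpha> \<eta>)"
  note \<pi>' = prob_densityD[OF \<pi>] and \<rho>' = prob_densityD[OF \<rho>]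
  have p0: "0 \<le> ?p x" for x using stable_density_pos[OF \<eta>, of x] by simp
  have q: "0 < evolved \<eta> \<pi> y" "0 < evolved \<eta> \<rho> y" for y
    by (rule evolved_pos[OF \<eta> \<pi>], rule evolved_pos[OF \<eta> \<rho>])
  have "?S
    = density lborel (\<lambda>y. \<integral>\<^sup>+x. ennreal (\<rho> x) * ennreal (?p (y - x)) \<partial>lborel)"
    unfolding forward_kernel_def[abs_def] stable_transition_def
    by (rule bind_density_density) (simp_all add: stable_nn_integral[OF \<eta>])
  also have "(\<lambda>y. \<integral>\<^sup>+x. ennreal (\<rho> x) * ennreal (?p (y - x)) \<partial>lborel) = (\<lambda>y. ennreal (evolved \<eta> \<rho> y))"
    using \<rho>'(4) by (simp add: evolved_nn_integral[OF \<eta> \<rho>, symmetric] ennreal_mult')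
  finally have 1: "?S = density lborel (\<lambda>y. ennreal (evolved \<eta> \<rho> y))" .
  have tg: "target_given \<alpha> \<eta> \<pi> y x = ?T y x" for x y
    by (simp add: target_given_def stable_transition_def evolved_def)
  have "Giry_Monad.bind (density lborel (\<lambda>y. ennreal (evolved \<eta> \<rho> y))) (backward_kernel \<alpha> \<eta> \<pi>)
    = density lborel (\<lambda>x. \<integral>\<^sup>+y. ennreal (evolved \<eta> \<rho> y) * ennreal (?T y x) \<partial>lborel)"
    unfolding backward_kernel_def[abs_def] tg
  proof (rule bind_density_density)
    fix y
    have "(\<integral>\<^sup>+x. ennreal (?T y x) \<partial>lborel)
      = (\<integral>\<^sup>+x. ennreal (\<pi> x * ?p (y - x)) * ennreal (1 / evolved \<eta> \<pi> y) \<partial>lborel)"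
      using \<pi>'(4) p0 q(1)[of y] by (intro nn_integral_cong) (simp flip: ennreal_mult)
    also have "\<dots> = ennreal (evolved \<eta> \<pi> y) * ennreal (1 / evolved \<eta> \<pi> y)"
      by (subst nn_integral_multc) (auto simp: evolved_nn_integral[OF \<eta> \<pi>])
    also have "\<dots> = 1" using q(1)[of y] by (simp flip: ennreal_mult)
    finally show "(\<integral>\<^sup>+x. ennreal (?T y x) \<partial>lborel) = 1" .
  qed measurable
  also have "(\<lambda>x. \<integral>\<^sup>+y. ennreal (evolved \<eta> \<rho> y) * ennreal (?T y x) \<partial>lborel)
    = (\<lambda>x. ennreal (\<pi> x) * next_ratio \<eta> \<pi> \<rho> x)"
  proof
    fix x
    have "(\<integral>\<^sup>+y. ennreal (evolved \<eta> \<rho> y) * ennreal (?T y x) \<partial>lborel)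
      = (\<integral>\<^sup>+y. ennreal (\<pi> x) * ennreal (?p (y - x) * (evolved \<eta> \<rho> y / evolved \<eta> \<pi> y)) \<partial>lborel)"
    proof (rule nn_integral_cong)
      fix y
      show "ennreal (evolved \<eta> \<rho> y) * ennreal (?T y x)
        = ennreal (\<pi> x) * ennreal (?p (y - x) * (evolved \<eta> \<rho> y / evolved \<eta> \<pi> y))"
        using \<pi>'(4)[of x] p0[of "y - x"] q[of y] by (simp add: mult_ac flip: ennreal_mult)
    qed
    also have "\<dots> = ennreal (\<pi> x) * next_ratio \<eta> \<pi> \<rho> x"
      unfolding next_ratio_def by (rule nn_integral_cmult) measurable
    finally show "(\<integral>\<^sup>+y. ennreal (evolved \<eta> \<rho> y) * ennreal (?T y x) \<partial>lborel) = ennreal (\<pi> x) * next_ratio \<eta> \<pi> \<rho> x" .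
  qed
  finally show ?thesis unfolding 1 .
qed

lemma next_ratio_mass: "(\<integral>\<^sup>+x. ennreal (\<pi> x) * next_ratio \<eta> \<pi> \<rho> x \<partial>lborel) = 1"
proof -
  note [measurable] = sampler_step_measurable
  let ?p = "stable_density \<alpha> \<eta> :: 'a \<Rightarrow> real"
  note \<pi>' = prob_densityD[OF \<pi>]
  have p0: "0 \<le> ?p x" for x using stable_density_pos[OF \<eta>, of x] by simp
  have q: "0 < evolved \<eta> \<pi> y" "0 < evolved \<eta> \<rho> y" for y
    by (rule evolved_pos[OF \<eta> \<pi>], rule evolved_pos[OF \<eta> \<rho>])
  let ?g = "\<lambda>y. evolved \<eta> \<rho> y / evolved \<eta> \<pi> y"
  have "(\<integral>\<^sup>+x. ennreal (\<pi> x) * next_ratio \<eta> \<pi> \<rho> x \<partial>lborel)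
    = (\<integral>\<^sup>+x. (\<integral>\<^sup>+y. ennreal (\<pi> x) * ennreal (?p (y - x) * ?g y) \<partial>lborel) \<partial>lborel)"
    unfolding next_ratio_def by (intro nn_integral_cong nn_integral_cmult[symmetric]) measurable
  also have "\<dots> = (\<integral>\<^sup>+y. (\<integral>\<^sup>+x. ennreal (\<pi> x) * ennreal (?p (y - x) * ?g y) \<partial>lborel) \<partial>lborel)"
    by (rule lborel_pair.Fubini') measurable
  also have "\<dots> = (\<integral>\<^sup>+y. ennreal (evolved \<eta> \<rho> y) \<partial>lborel)"
  proof (rule nn_integral_cong)
    fix y
    have "(\<integral>\<^sup>+x. ennreal (\<pi> x) * ennreal (?p (y - x) * ?g y) \<partial>lborel) = (\<integral>\<^sup>+x. ennreal (\<pi> x * ?p (y - x)) * ennreal (?g y) \<partial>lborel)"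
      using \<pi>'(4) p0 q[of y] by (intro nn_integral_cong) (simp add: mult.assoc less_imp_le flip: ennreal_mult)
    also have "\<dots> = ennreal (evolved \<eta> \<pi> y) * ennreal (?g y)"
      by (subst nn_integral_multc) (auto simp: evolved_nn_integral[OF \<eta> \<pi>])
    also have "\<dots> = ennreal (evolved \<eta> \<rho> y)" using q[of y] by (simp add: less_imp_le flip: ennreal_mult)
    finally show "(\<integral>\<^sup>+x. ennreal (\<pi> x) * ennreal (?p (y - x) * ?g y) \<partial>lborel) = ennreal (evolved \<eta> \<rho> y)" .
  qed
  also have "\<dots> = 1" using evolved_prob_density[OF \<eta> \<rho>] by (simp add: prob_density_def)
  finally show ?thesis .
qed

text \<open>Unit total mass excludes infinite values outside a null set.\<close>

lemma next_ratio_finite: "AE x in lborel. \<pi> x \<noteq> 0 \<longrightarrow> next_ratio \<eta> \<pi> \<rho> x \<noteq> \<infinity>"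
proof -
  note [measurable] = sampler_step_measurable
  have "AE x in lborel. ennreal (\<pi> x) * next_ratio \<eta> \<pi> \<rho> x \<noteq> \<infinity>"
    by (rule nn_integral_PInf_AE) (auto simp: next_ratio_mass)
  then show ?thesis
    by eventually_elim (use prob_densityD(4)[OF \<pi>] in \<open>auto simp: ennreal_mult_eq_top_iff ennreal_eq_0_iff order.antisym\<close>)
qed

lemma next_density_ennreal: "AE x in lborel. ennreal (next_density \<eta> \<pi> \<rho> x) = ennreal (\<pi> x) * next_ratio \<eta> \<pi> \<rho> x"
  using next_ratio_finite
  by eventually_elim
     (use prob_densityD(4)[OF \<pi>] in \<open>auto simp: next_density_def ennreal_mult' less_top\<close>)

lemma next_density_prob_density: "prob_density (next_density \<eta> \<pi> \<rho>)"
  unfolding prob_density_def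
proof (intro conjI allI)
  note [measurable] = sampler_step_measurable
  show "next_density \<eta> \<pi> \<rho> \<in> borel_measurable borel" unfolding next_density_def[abs_def] by measurable
  show "0 \<le> next_density \<eta> \<pi> \<rho> x" for x using prob_densityD(4)[OF \<pi>] by (simp add: next_density_def)
  have "(\<integral>\<^sup>+x. ennreal (next_density \<eta> \<pi> \<rho> x) \<partial>lborel) = (\<integral>\<^sup>+x. ennreal (\<pi> x) * next_ratio \<eta> \<pi> \<rho> x \<partial>lborel)"
    by (rule nn_integral_cong_AE) (rule next_density_ennreal)
  then show "(\<integral>\<^sup>+x. ennreal (next_density \<eta> \<pi> \<rho> x) \<partial>lborel) = 1" by (simp add: next_ratio_mass)
qed

lemma next_density_law:
  "Giry_Monad.bind (Giry_Monad.bind (density lborel (\<lambda>x. ennreal (\<rho> x))) (forward_kernel \<alpha> \<eta>)) (backward_kernel \<alpha> \<eta> \<pi>)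
    = density lborel (\<lambda>x. ennreal (next_density \<eta> \<pi> \<rho> x))"
proof -
  note [measurable] = sampler_step_measurable
  have [measurable]: "next_density \<eta> \<pi> \<rho> \<in> borel_measurable borel" unfolding next_density_def[abs_def] by measurable
  show ?thesis
    unfolding sampler_step_bind
    by (rule density_cong) (use next_density_ennreal in \<open>auto elim: eventually_mono\<close>)
qed

text \<open>
  The ratio \<open>g\<close> of the two evolved densities may be unbounded, so the variance contraction is
  applied to its truncations and transferred by Fatou's lemma.
\<close>

lemma chi2_next_density:
  assumes fpi: "frac_poincare \<alpha> \<pi> C"
  shows "chi2 (next_density \<eta> \<pi> \<rho>) \<pi> \<le> ennreal (C / (C + \<eta>)) * chi2 \<rho> \<pi>"
proof -
  note [measurable] = sampler_step_measurable
  let ?p = "stable_density \<alpha> \<eta> :: 'a \<Rightarrow> real" and ?q = "evolved \<eta> \<pi>"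
  note \<pi>' = prob_densityD[OF \<pi>]
  have C: "C > 0" using fpi by (simp add: frac_poincare_def)
  have qd: "prob_density ?q" by (rule evolved_prob_density[OF \<eta> \<pi>])
  have pd: "prob_density ?p" by (rule stable_prob_density[OF \<eta>])
  note q' = prob_densityD[OF qd] and p' = prob_densityD[OF pd]
  have q: "0 < ?q y" "0 < evolved \<eta> \<rho> y" for y
    by (rule evolved_pos[OF \<eta> \<pi>], rule evolved_pos[OF \<eta> \<rho>])
  define g where "g y = evolved \<eta> \<rho> y / ?q y" for y
  have g0: "0 \<le> g y" for y using q[of y] by (simp add: g_def)
  have [measurable]: "g \<in> borel_measurable borel" unfolding g_def[abs_def] by measurable
  define gn where "gn n y = min (g y) (real n)" for n y
  have gn0: "0 \<le> gn n y" for n y using g0 by (simp add: gn_def)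
  have gb: "bounded_measurable (gn n) (real n)" for n
    unfolding bounded_measurable_def
  proof
    show "gn n \<in> borel_measurable borel" unfolding gn_def[abs_def] by measurable
    show "\<forall>x. \<bar>gn n x\<bar> \<le> real n" using gn0 by (auto simp: gn_def abs_of_nonneg)
  qed
  have [measurable]: "gn n \<in> borel_measurable borel" for n by (rule bounded_measurableD[OF gb])
  have gn_lim: "(\<lambda>n. gn n y) \<longlonglongrightarrow> g y" for y
  proof (rule tendsto_eventually)
    obtain N :: nat where "g y \<le> real N" using real_arch_simple by blast
    then show "eventually (\<lambda>n. gn n y = g y) sequentially"
      by (intro eventually_sequentiallyI[of N]) (auto simp: gn_def)
  qed
  define F where "F n = avg ?p (gn n)" for n
  have Fb: "bounded_measurable (F n) (real n)" for n unfolding F_def by (rule avg_bounded_measurable[OF pd gb])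
  have [measurable]: "F n \<in> borel_measurable borel" for n by (rule bounded_measurableD[OF Fb])
  \<comment> \<open>Truncation may lower the mean of the ratio below one, so the variance of
    \<open>F n\<close> is centred at \<open>m n\<close>, which tends to 1.\<close>
  define m where "m n = avg ?q (gn n) 0" for n
  have F_lim: "(\<lambda>n. F n x) \<longlonglongrightarrow> enn2real (next_ratio \<eta> \<pi> \<rho> x)" if fin: "next_ratio \<eta> \<pi> \<rho> x \<noteq> \<infinity>" for x
  proof -
    have ratio: "next_ratio \<eta> \<pi> \<rho> x = (\<integral>\<^sup>+y. ennreal (?p y * g (x + y)) \<partial>lborel)"
      unfolding next_ratio_def g_def[symmetric]
      by (subst nn_integral_lborel_plus[where c=x, symmetric]) simp_all
    have i: "integrable lborel (\<lambda>y. ?p y * g (x + y))"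
      by (rule integrableI_nonneg) (use fin g0 p' in \<open>auto simp: ratio less_top\<close>)
    have "(\<lambda>n. F n x) \<longlonglongrightarrow> (\<integral>y. ?p y * g (x + y) \<partial>lborel)"
      unfolding F_def avg_def
    proof (rule integral_dominated_convergence[where w="\<lambda>y. ?p y * g (x + y)"])
      show "AE y in lborel. (\<lambda>n. ?p y * gn n (x + y)) \<longlonglongrightarrow> ?p y * g (x + y)"
        by (intro AE_I2 tendsto_intros gn_lim)
      show "AE y in lborel. norm (?p y * gn n (x + y)) \<le> ?p y * g (x + y)" for n
        using p'(4) gn0 by (intro AE_I2) (auto simp: abs_mult gn_def intro!: mult_left_mono)
    qed (use i in auto)
    also have "(\<integral>y. ?p y * g (x + y) \<partial>lborel) = enn2real (next_ratio \<eta> \<pi> \<rho> x)"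
      unfolding ratio by (rule integral_eq_nn_integral) (use g0 p' in auto)
    finally show ?thesis .
  qed
  have m_lim: "m \<longlonglongrightarrow> 1"
  proof -
    have qg: "?q y * g y = evolved \<eta> \<rho> y" for y using q(1)[of y] by (simp add: g_def)
    note r' = prob_densityD[OF evolved_prob_density[OF \<eta> \<rho>]]
    have "(\<lambda>n. \<integral>y. ?q y * gn n (0 + y) \<partial>lborel) \<longlonglongrightarrow> (\<integral>y. ?q y * g y \<partial>lborel)"
    proof (rule integral_dominated_convergence[where w="\<lambda>y. ?q y * g y"])
      show "AE y in lborel. (\<lambda>n. ?q y * gn n (0 + y)) \<longlonglongrightarrow> ?q y * g y"
        by (simp, intro AE_I2 tendsto_intros gn_lim)
      show "AE y in lborel. norm (?q y * gn n (0 + y)) \<le> ?q y * g y" for n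
        using q'(4) gn0 by (intro AE_I2) (auto simp: abs_mult gn_def intro!: mult_left_mono)
    qed (use r' in \<open>auto simp: qg\<close>)
    then show ?thesis using r'(2) by (simp add: m_def[abs_def] avg_def qg)
  qed
  define R where "R x = ennreal ((enn2real (next_ratio \<eta> \<pi> \<rho> x) - 1)\<^sup>2 * \<pi> x)" for x
  have chi: "chi2 (next_density \<eta> \<pi> \<rho>) \<pi> = (\<integral>\<^sup>+x. R x \<partial>lborel)"
    unfolding chi2_def R_def by (rule nn_integral_cong) (auto simp: next_density_def)
  have lim: "AE x in lborel. liminf (\<lambda>n. ennreal (\<pi> x * (F n x - m n)\<^sup>2)) = R x"
    using next_ratio_finite
  proof eventually_elim
    fix x assume fin: "\<pi> x \<noteq> 0 \<longrightarrow> next_ratio \<eta> \<pi> \<rho> x \<noteq> \<infinity>"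
    show "liminf (\<lambda>n. ennreal (\<pi> x * (F n x - m n)\<^sup>2)) = R x"
    proof (cases "\<pi> x = 0")
      case False
      then have "(\<lambda>n. ennreal (\<pi> x * (F n x - m n)\<^sup>2)) \<longlonglongrightarrow> ennreal (\<pi> x * (enn2real (next_ratio \<eta> \<pi> \<rho> x) - 1)\<^sup>2)"
        using fin by (intro tendsto_ennrealI tendsto_intros F_lim m_lim) auto
      then show ?thesis unfolding R_def by (subst mult.commute) (intro lim_imp_Liminf, auto)
    qed (simp add: R_def Liminf_const)
  qed
  \<comment> \<open>For \<open>n \<ge> 1\<close>, capping the ratio at \<open>n\<close> cannot move
    it away from 1. The variance is first replaced by the larger second moment about 1, and the cap
    is then removed monotonically.\<close>
  have bound: "(\<integral>\<^sup>+x. ennreal (\<pi> x * (F n x - m n)\<^sup>2) \<partial>lborel) \<le> ennreal (C / (C + \<eta>)) * chi2 \<rho> \<pi>" if n: "n \<ge> 1" for n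
  proof -
    have mF: "m n = avg \<pi> (F n) 0" unfolding m_def F_def by (rule avg_evolved[OF \<eta> \<pi> gb])
    have "(\<integral>\<^sup>+x. ennreal (\<pi> x * (F n x - m n)\<^sup>2) \<partial>lborel) = ennreal (avg_var \<pi> (F n) 0)"
      unfolding avg_var_eq[OF \<pi> Fb] mF[symmetric]
      using avg_integrable[OF \<pi>'(1) bounded_measurable_power2_diff[OF Fb[of n], of "m n"], of 0] \<pi>'(4)
      by (subst nn_integral_eq_integral) (simp_all add: avg_def)
    also have "\<dots> \<le> ennreal (C / (C + \<eta>) * avg_var ?q (gn n) 0)"
      using variance_contraction[OF \<pi> fpi \<eta> gb[of n]] C \<eta> by (intro ennreal_leI) (simp add: F_def field_simps)
    also have "\<dots> \<le> ennreal (C / (C + \<eta>) * avg ?q (\<lambda>y. (gn n y - 1)\<^sup>2) 0)"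
      using C \<eta> by (intro ennreal_leI mult_left_mono) (simp_all add: avg_power2_diff[OF qd gb])
    also have "\<dots> = ennreal (C / (C + \<eta>)) * ennreal (avg ?q (\<lambda>y. (gn n y - 1)\<^sup>2) 0)"
      using C \<eta> by (intro ennreal_mult avg_nonneg) (use q' in auto)
    also have "ennreal (avg ?q (\<lambda>y. (gn n y - 1)\<^sup>2) 0) = (\<integral>\<^sup>+y. ennreal (?q y * (gn n y - 1)\<^sup>2) \<partial>lborel)"
      using avg_integrable[OF q'(1) bounded_measurable_power2_diff[OF gb[of n], of 1], of 0] q'(4)
      by (subst nn_integral_eq_integral) (simp_all add: avg_def)
    also have "\<dots> \<le> (\<integral>\<^sup>+y. ennreal ((g y - 1)\<^sup>2 * ?q y) \<partial>lborel)"
    proof (intro nn_integral_mono ennreal_leI)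
      fix y
      have "\<bar>gn n y - 1\<bar> \<le> \<bar>g y - 1\<bar>" using n by (auto simp: gn_def)
      then have "(gn n y - 1)\<^sup>2 \<le> (g y - 1)\<^sup>2" by (simp add: abs_le_square_iff)
      then show "?q y * (gn n y - 1)\<^sup>2 \<le> (g y - 1)\<^sup>2 * ?q y"
        using q(1)[of y] by (simp add: mult.commute mult_right_mono)
    qed
    also have "\<dots> \<le> chi2 \<rho> \<pi>" unfolding g_def by (rule chi2_forward[OF \<pi> \<rho> \<eta>])
    finally show ?thesis by (simp add: mult_left_mono)
  qed
  have "(\<integral>\<^sup>+x. R x \<partial>lborel) = (\<integral>\<^sup>+x. liminf (\<lambda>n. ennreal (\<pi> x * (F n x - m n)\<^sup>2)) \<partial>lborel)"
    by (rule nn_integral_cong_AE) (use lim in \<open>auto elim: eventually_mono\<close>)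
  also have "\<dots> \<le> liminf (\<lambda>n. \<integral>\<^sup>+x. ennreal (\<pi> x * (F n x - m n)\<^sup>2) \<partial>lborel)"
    by (rule nn_integral_liminf) measurable
  also have "\<dots> \<le> liminf (\<lambda>n::nat. ennreal (C / (C + \<eta>)) * chi2 \<rho> \<pi>)"
    by (rule Liminf_mono) (use bound in \<open>auto intro: eventually_sequentiallyI[of 1]\<close>)
  also have "\<dots> = ennreal (C / (C + \<eta>)) * chi2 \<rho> \<pi>" by (simp add: Liminf_const)
  finally show ?thesis unfolding chi .
qed

end

end

lemma contraction_factor_le_exp:
  fixes C \<eta> :: real
  assumes "0 < C" "0 < \<eta>"
  shows "C / (C + \<eta>) \<le> exp (- (\<eta> * inverse (C + \<eta>)))"
proof -
  have "C / (C + \<eta>) = 1 + - (\<eta> * inverse (C + \<eta>))" using assms by (simp add: field_simps)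
  also have "\<dots> \<le> exp (- (\<eta> * inverse (C + \<eta>)))" by (rule exp_ge_add_one_self)
  finally show ?thesis .
qed

theorem theorem3p1:
  fixes \<alpha> \<eta> C :: real and \<pi> \<rho>0 :: "'a::euclidean_space \<Rightarrow> real" and k :: nat
  assumes "0 < \<alpha>" and "\<alpha> < 2"
    and "prob_density \<pi>"
    and "frac_poincare \<alpha> \<pi> C"
    and "0 < \<eta>"
    and "prob_density \<rho>0"
  shows "\<exists>\<rho>k. prob_density \<rho>k \<and>
           sampler_law \<alpha> \<eta> \<pi> \<rho>0 k = density lborel (\<lambda>x. ennreal (\<rho>k x)) \<and>
           chi2 \<rho>k \<pi> \<le> ennreal (exp (- (real k * \<eta> * inverse (C + \<eta>)))) * chi2 \<rho>0 \<pi>"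
proof -
  interpret stable_index \<alpha> by standard (use assms in auto)
  have C: "0 < C" using assms(4) by (simp add: frac_poincare_def)
  show ?thesis
  \<comment> \<open>The induction carries a representing density, because \<open>sampler_law\<close>
    is a measure while \<open>chi2\<close> compares densities.\<close>
  proof (induction k)
    case 0
    show ?case by (rule exI[of _ \<rho>0]) (use assms in simp)
  next
    case (Suc k)
    let ?e = "\<lambda>k::nat. ennreal (exp (- (real k * \<eta> * inverse (C + \<eta>))))"
    from Suc obtain \<rho> where \<rho>: "prob_density \<rho>"
      and law: "sampler_law \<alpha> \<eta> \<pi> \<rho>0 k = density lborel (\<lambda>x. ennreal (\<rho> x))"
      and le: "chi2 \<rho> \<pi> \<le> ?e k * chi2 \<rho>0 \<pi>"
      by blast
    have "chi2 (next_density \<eta> \<pi> \<rho>) \<pi> \<le> ennreal (C / (C + \<eta>)) * chi2 \<rho> \<pi>"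
      by (rule chi2_next_density[OF assms(5,3) \<rho> assms(4)])
    also have "\<dots> \<le> ennreal (exp (- (\<eta> * inverse (C + \<eta>)))) * (?e k * chi2 \<rho>0 \<pi>)"
      by (intro mult_mono ennreal_leI contraction_factor_le_exp C assms(5) le) auto
    also have "\<dots> = ennreal (exp (- (\<eta> * inverse (C + \<eta>))) * exp (- (real k * \<eta> * inverse (C + \<eta>)))) * chi2 \<rho>0 \<pi>"
      by (simp add: ennreal_mult mult.assoc)
    also have "exp (- (\<eta> * inverse (C + \<eta>))) * exp (- (real k * \<eta> * inverse (C + \<eta>))) = exp (- (real (Suc k) * \<eta> * inverse (C + \<eta>)))"
      by (simp add: algebra_simps flip: exp_add)
    finally show ?case
      using next_density_prob_density[OF assms(5,3) \<rho>] next_density_law[OF assms(5,3) \<rho>]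
      by (intro exI[of _ "next_density \<eta> \<pi> \<rho>"]) (simp add: law)
  qed
qed

end
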